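(* The theory of valued vector spaces is model complete relative to the skeleton in the languages $\mathrm{L}_{S,K}$ and $\mathrm{L}_S$. More precisely, given two models $\mathcal{V}\subseteq\mathcal{W}$ (in the language $\mathrm{L}_{S,K}$, resp. $\mathrm{L}_S$), one has $\mathcal{V}\preceq\mathcal{W}$ if and only if $S(V)\preceq S(W)$.
   Context: Valued vector space: $K$ is a field, $V$ a $K$-vector space, $(\Gamma,<,\infty)$ a totally ordered set with last element $\infty$, and $\mathrm{val}:V\to\Gamma$ a surjective map such that $\mathrm{val}(x)=\infty$ iff $x=0$, $\mathrm{val}(x-y)\ge\min(\mathrm{val}(x),\mathrm{val}(y))$, and $\mathrm{val}(kx)=\mathrm{val}(x)$ for all $k\in K\setminus\{0\}$, $x\in V$. For $\gamma\in\Gamma$ write $V_\gamma=\{x\mid\mathrm{val}(x)>\gamma\}$. Skeleton: $S(V)$ is the quotient of $\{(\gamma,v)\in\Gamma\times V\mid\mathrm{val}(v)\ge\gamma\}$ by $(\gamma,v)\simeq(\gamma',v')$ iff $\gamma=\gamma'$ and $\mathrm{val}(v-v')>\gamma$. The class of $(\gamma,v)$ is written $(\gamma,v+V_\gamma)$, and $\mathbf{0}=(\infty,0)$ is the unique class over $\infty$. Maps: $\pi:V\to S(V)$, $v\mapsto(\mathrm{val}(v),v+V_{\mathrm{val}(v)})$; $\mathrm{val}_S:S(V)\to\Gamma$, $(\gamma,v+V_\gamma)\mapsto\gamma$; $\mathrm{scal}_\bullet(k,(\gamma,v+V_\gamma)):=(\gamma,kv+V_\gamma)$ (also $\mathrm{scal}_{\bullet,k}$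 for fixed $k$); $(\gamma,v+V_\gamma)+_\bullet(\gamma',v'+V_{\gamma'}):=(\gamma,v+v'+V_\gamma)$ if $\gamma=\gamma'$, and $\mathbf{0}$ otherwise. Languages: $\mathrm{L}_{S,K}$ (fixed base field $K$) consists of $(V,+,0,(\mathrm{scal}_k:V\to V)_{k\in K})$, $(\Gamma,<,\infty)$, $\mathrm{val}:V\to\Gamma$, $(S(V),+_\bullet,\mathbf{0},(\mathrm{scal}_{\bullet,k})_{k\in K})$, $\mathrm{val}_S$ and $\pi$. $\mathrm{L}_S$ (variable base field) consists of $(V,+,0)$, $(K,+,\cdot,0,1)$, $(\Gamma,<,\infty)$, $\mathrm{scal}:K\times V\to V$, $\mathrm{val}$, $(S(V),+_\bullet,\mathbf{0})$, $\mathrm{scal}_\bullet:K\times S(V)\to S(V)$, $\mathrm{val}_S$ and $\pi$. The skeleton $S(V)$ as a structure means the structure in the sublanguage $\{(S(V),+_\bullet,(\mathrm{scal}_{\bullet,k})_k,\mathbf{0}),(\Gamma,<),\mathrm{val}_S\}$ (case $\mathrm{L}_{S,K}$), resp. $\{(S(V),+_\bullet,\mathbf{0}),(\Gamma,<),(K,+,\cdot,0,1),\mathrm{scal}_\bullet,\mathrm{val}_S\}$ (case $\mathrm{L}_S$). *)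

theory Defs
  imports "HOL-Algebra.Module"
begin

section \<open>Many-sorted first-order logic\<close>

record ('s, 'f, 'r) language =
  sorts :: "'s set"
  funs :: "'f set"
  rels :: "'r set"
  fun_args :: "'f \<Rightarrow> 's list"
  fun_sort :: "'f \<Rightarrow> 's"
  rel_args :: "'r \<Rightarrow> 's list"

datatype ('s, 'f) trm = Var 's nat | App 'f "('s, 'f) trm list"

datatype ('s, 'f, 'r) form =
    Equal "('s, 'f) trm" "('s, 'f) trm"
  | Atom 'r "('s, 'f) trm list"
  | Neg "('s, 'f, 'r) form"
  | Conj "('s, 'f, 'r) form" "('s, 'f, 'r) form"
  | Exists 's nat "('s, 'f, 'r) form"

fun sort_of :: "('s, 'f, 'r) language \<Rightarrow> ('s, 'f) trm \<Rightarrow> 's" where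
  "sort_of L (Var s n) = s"
| "sort_of L (App f ts) = fun_sort L f"

fun wf_trm :: "('s, 'f, 'r) language \<Rightarrow> ('s, 'f) trm \<Rightarrow> bool" where
  "wf_trm L (Var s n) \<longleftrightarrow> s \<in> sorts L"
| "wf_trm L (App f ts) \<longleftrightarrow>
     f \<in> funs L \<and> map (sort_of L) ts = fun_args L f \<and> (\<forall>t\<in>set ts. wf_trm L t)"

fun wf_form :: "('s, 'f, 'r) language \<Rightarrow> ('s, 'f, 'r) form \<Rightarrow> bool" where
  "wf_form L (Equal t u) \<longleftrightarrow> wf_trm L t \<and> wf_trm L u \<and> sort_of L t = sort_of L u"
| "wf_form L (Atom r ts) \<longleftrightarrow>
     r \<in> rels L \<and> map (sort_of L) ts = rel_args L r \<and> (\<forall>t\<in>set ts. wf_trm L t)"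
| "wf_form L (Neg p) \<longleftrightarrow> wf_form L p"
| "wf_form L (Conj p q) \<longleftrightarrow> wf_form L p \<and> wf_form L q"
| "wf_form L (Exists s n p) \<longleftrightarrow> s \<in> sorts L \<and> wf_form L p"

text \<open>The sorts of a structure are subsets of one type \<open>'u\<close>; they need not be disjoint.
  The language is not part of a structure: the notions below take it as an argument and only
  look at the sorts and symbols that belong to it, so the reduct of a structure to a
  sublanguage is the same record considered with the smaller language.\<close>

record ('s, 'f, 'r, 'u) struct =
  univ :: "'s \<Rightarrow> 'u set"
  fun_in :: "'f \<Rightarrow> 'u list \<Rightarrow> 'u"
  rel_in :: "'r \<Rightarrow> 'u list \<Rightarrow> bool"

definition args_in :: "('s, 'f, 'r, 'u) struct \<Rightarrow> 's list \<Rightarrow> 'u list set" where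
  "args_in M ss = {xs. list_all2 (\<lambda>x s. x \<in> univ M s) xs ss}"

definition is_structure :: "('s, 'f, 'r) language \<Rightarrow> ('s, 'f, 'r, 'u) struct \<Rightarrow> bool" where
  "is_structure L M \<longleftrightarrow>
     (\<forall>s\<in>sorts L. univ M s \<noteq> {}) \<and>
     (\<forall>f\<in>funs L. \<forall>xs\<in>args_in M (fun_args L f). fun_in M f xs \<in> univ M (fun_sort L f))"

fun trm_val :: "('s, 'f, 'r, 'u) struct \<Rightarrow> ('s \<Rightarrow> nat \<Rightarrow> 'u) \<Rightarrow> ('s, 'f) trm \<Rightarrow> 'u" where
  "trm_val M e (Var s n) = e s n"
| "trm_val M e (App f ts) = fun_in M f (map (trm_val M e) ts)"

fun sat :: "('s, 'f, 'r, 'u) struct \<Rightarrow> ('s \<Rightarrow> nat \<Rightarrow> 'u) \<Rightarrow> ('s, 'f, 'r) form \<Rightarrow> bool" where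
  "sat M e (Equal t u) \<longleftrightarrow> trm_val M e t = trm_val M e u"
| "sat M e (Atom r ts) \<longleftrightarrow> rel_in M r (map (trm_val M e) ts)"
| "sat M e (Neg p) \<longleftrightarrow> \<not> sat M e p"
| "sat M e (Conj p q) \<longleftrightarrow> sat M e p \<and> sat M e q"
| "sat M e (Exists s n p) \<longleftrightarrow> (\<exists>x\<in>univ M s. sat M (e(s := (e s)(n := x))) p)"

definition substructure ::
  "('s, 'f, 'r) language \<Rightarrow> ('s, 'f, 'r, 'u) struct \<Rightarrow> ('s, 'f, 'r, 'u) struct \<Rightarrow> bool" where
  "substructure L M N \<longleftrightarrow>
     is_structure L M \<and> is_structure L N \<and>
     (\<forall>s\<in>sorts L. univ M s \<subseteq> univ N s) \<and>
     (\<forall>f\<in>funs L. \<forall>xs\<in>args_in M (fun_args L f). fun_in M f xs = fun_in N f xs) \<and>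
     (\<forall>r\<in>rels L. \<forall>xs\<in>args_in M (rel_args L r). rel_in M r xs \<longleftrightarrow> rel_in N r xs)"

definition elementary_substructure ::
  "('s, 'f, 'r) language \<Rightarrow> ('s, 'f, 'r, 'u) struct \<Rightarrow> ('s, 'f, 'r, 'u) struct \<Rightarrow> bool" where
  "elementary_substructure L M N \<longleftrightarrow>
     substructure L M N \<and>
     (\<forall>p e. wf_form L p \<longrightarrow> (\<forall>s\<in>sorts L. \<forall>n. e s n \<in> univ M s) \<longrightarrow> (sat M e p \<longleftrightarrow> sat N e p))"

definition isomorphic ::
  "('s, 'f, 'r) language \<Rightarrow> ('s, 'f, 'r, 'u) struct \<Rightarrow> ('s, 'f, 'r, 'w) struct \<Rightarrow> bool" where
  "isomorphic L M N \<longleftrightarrow>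
     is_structure L M \<and> is_structure L N \<and>
     (\<exists>h :: 's \<Rightarrow> 'u \<Rightarrow> 'w.
        (\<forall>s\<in>sorts L. bij_betw (h s) (univ M s) (univ N s)) \<and>
        (\<forall>f\<in>funs L. \<forall>xs\<in>args_in M (fun_args L f).
           h (fun_sort L f) (fun_in M f xs) = fun_in N f (map2 h (fun_args L f) xs)) \<and>
        (\<forall>r\<in>rels L. \<forall>xs\<in>args_in M (rel_args L r).
           rel_in M r xs \<longleftrightarrow> rel_in N r (map2 h (rel_args L r) xs)))"


section \<open>Valued vector spaces\<close>

text \<open>HOL-Algebra has no separate record for vector spaces: the ring multiplication and unit of
  the record \<open>vecs\<close> are not used.\<close>

record ('k, 'v, 'g) vvs =
  base :: "'k ring"
  vecs :: "('k, 'v) module"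
  gam :: "'g set"
  lt :: "'g rel"
  infty :: 'g
  vl :: "'v \<Rightarrow> 'g"

definition ge :: "('k, 'v, 'g) vvs \<Rightarrow> 'g \<Rightarrow> 'g \<Rightarrow> bool" where
  "ge X a b \<longleftrightarrow> a = b \<or> (b, a) \<in> lt X"

definition gmin :: "('k, 'v, 'g) vvs \<Rightarrow> 'g \<Rightarrow> 'g \<Rightarrow> 'g" where
  "gmin X a b = (if (a, b) \<in> lt X then a else b)"

definition valued_vector_space :: "('k, 'v, 'g) vvs \<Rightarrow> bool" where
  "valued_vector_space X \<longleftrightarrow>
     field (base X) \<and> Module.module (base X) (vecs X) \<and>
     strict_linear_order_on (gam X) (lt X) \<and>
     infty X \<in> gam X \<and> (\<forall>g\<in>gam X. ge X (infty X) g) \<and>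
     vl X ` carrier (vecs X) = gam X \<and>
     (\<forall>x\<in>carrier (vecs X). vl X x = infty X \<longleftrightarrow> x = \<zero>\<^bsub>vecs X\<^esub>) \<and>
     (\<forall>x\<in>carrier (vecs X). \<forall>y\<in>carrier (vecs X).
        ge X (vl X (x \<ominus>\<^bsub>vecs X\<^esub> y)) (gmin X (vl X x) (vl X y))) \<and>
     (\<forall>k\<in>carrier (base X) - {\<zero>\<^bsub>base X\<^esub>}. \<forall>x\<in>carrier (vecs X).
        vl X (k \<odot>\<^bsub>vecs X\<^esub> x) = vl X x)"


subsection \<open>The skeleton\<close>

definition skel_pairs :: "('k, 'v, 'g) vvs \<Rightarrow> ('g \<times> 'v) set" where
  "skel_pairs X = {(g, v). g \<in> gam X \<and> v \<in> carrier (vecs X) \<and> ge X (vl X v) g}"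

text \<open>The disjunct \<open>v = v'\<close> only matters for the pair \<open>(\<infinity>, 0)\<close>, the only pair over
  \<open>\<infinity>\<close>: there \<open>val (v - v') > \<gamma>\<close> would read \<open>\<infinity> > \<infinity>\<close>, and without it
  the relation would fail to be reflexive at that single pair.\<close>

definition skel_rel :: "('k, 'v, 'g) vvs \<Rightarrow> ('g \<times> 'v) rel" where
  "skel_rel X =
     {((g, v), (g', v')). (g, v) \<in> skel_pairs X \<and> (g', v') \<in> skel_pairs X \<and> g = g' \<and>
        (v = v' \<or> (g, vl X (v \<ominus>\<^bsub>vecs X\<^esub> v')) \<in> lt X)}"

definition skeleton :: "('k, 'v, 'g) vvs \<Rightarrow> ('g \<times> 'v) set set" where
  "skeleton X = skel_pairs X // skel_rel X"

text \<open>\<open>skel_class X g v\<close> is the class \<open>(g, v + V\<^sub>g)\<close>. The operations on classes are defined by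
  choosing representatives; the result does not depend on the choice.\<close>

definition skel_class :: "('k, 'v, 'g) vvs \<Rightarrow> 'g \<Rightarrow> 'v \<Rightarrow> ('g \<times> 'v) set" where
  "skel_class X g v = skel_rel X `` {(g, v)}"

definition skel_rep :: "('g \<times> 'v) set \<Rightarrow> 'g \<times> 'v" where
  "skel_rep c = (SOME p. p \<in> c)"

definition skel_proj :: "('k, 'v, 'g) vvs \<Rightarrow> 'v \<Rightarrow> ('g \<times> 'v) set" where
  "skel_proj X v = skel_class X (vl X v) v"

definition skel_val :: "('g \<times> 'v) set \<Rightarrow> 'g" where
  "skel_val c = fst (skel_rep c)"

definition skel_zero :: "('k, 'v, 'g) vvs \<Rightarrow> ('g \<times> 'v) set" where
  "skel_zero X = skel_class X (infty X) \<zero>\<^bsub>vecs X\<^esub>"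

definition skel_scal :: "('k, 'v, 'g) vvs \<Rightarrow> 'k \<Rightarrow> ('g \<times> 'v) set \<Rightarrow> ('g \<times> 'v) set" where
  "skel_scal X k c = skel_class X (skel_val c) (k \<odot>\<^bsub>vecs X\<^esub> snd (skel_rep c))"

definition skel_add ::
  "('k, 'v, 'g) vvs \<Rightarrow> ('g \<times> 'v) set \<Rightarrow> ('g \<times> 'v) set \<Rightarrow> ('g \<times> 'v) set" where
  "skel_add X c d =
     (if skel_val c = skel_val d
      then skel_class X (skel_val c) (snd (skel_rep c) \<oplus>\<^bsub>vecs X\<^esub> snd (skel_rep d))
      else skel_zero X)"


section \<open>The languages and their standard structures\<close>

datatype vsort = VecS | FieldS | GamS | SkelS

datatype vrel = Less

text \<open>The symbols of \<open>L\<^sub>S\<^sub>,\<^sub>K\<close>; \<open>'k\<close> is the type containing the fixed base field.\<close>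

datatype 'k SK_sym =
    AddK | ZeroK | ScalK 'k | InftyK | ValK | SAddK | SZeroK | SScalK 'k | SValK | ProjK

text \<open>The symbols of \<open>L\<^sub>S\<close>.\<close>

datatype S_sym =
    Add | Zero | FAdd | FMult | FZero | FOne | Infty | Scal | Val
  | SAdd | SZero | SScal | SVal | Proj

fun SK_args :: "'k SK_sym \<Rightarrow> vsort list" where
  "SK_args AddK = [VecS, VecS]"
| "SK_args ZeroK = []"
| "SK_args (ScalK k) = [VecS]"
| "SK_args InftyK = []"
| "SK_args ValK = [VecS]"
| "SK_args SAddK = [SkelS, SkelS]"
| "SK_args SZeroK = []"
| "SK_args (SScalK k) = [SkelS]"
| "SK_args SValK = [SkelS]"
| "SK_args ProjK = [VecS]"

fun SK_sort :: "'k SK_sym \<Rightarrow> vsort" where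
  "SK_sort AddK = VecS"
| "SK_sort ZeroK = VecS"
| "SK_sort (ScalK k) = VecS"
| "SK_sort InftyK = GamS"
| "SK_sort ValK = GamS"
| "SK_sort SAddK = SkelS"
| "SK_sort SZeroK = SkelS"
| "SK_sort (SScalK k) = SkelS"
| "SK_sort SValK = GamS"
| "SK_sort ProjK = SkelS"

fun S_args :: "S_sym \<Rightarrow> vsort list" where
  "S_args Add = [VecS, VecS]"
| "S_args Zero = []"
| "S_args FAdd = [FieldS, FieldS]"
| "S_args FMult = [FieldS, FieldS]"
| "S_args FZero = []"
| "S_args FOne = []"
| "S_args Infty = []"
| "S_args Scal = [FieldS, VecS]"
| "S_args Val = [VecS]"
| "S_args SAdd = [SkelS, SkelS]"
| "S_args SZero = []"
| "S_args SScal = [FieldS, SkelS]"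
| "S_args SVal = [SkelS]"
| "S_args Proj = [VecS]"

fun S_sort :: "S_sym \<Rightarrow> vsort" where
  "S_sort Add = VecS"
| "S_sort Zero = VecS"
| "S_sort FAdd = FieldS"
| "S_sort FMult = FieldS"
| "S_sort FZero = FieldS"
| "S_sort FOne = FieldS"
| "S_sort Infty = GamS"
| "S_sort Scal = VecS"
| "S_sort Val = GamS"
| "S_sort SAdd = SkelS"
| "S_sort SZero = SkelS"
| "S_sort SScal = SkelS"
| "S_sort SVal = GamS"
| "S_sort Proj = SkelS"

fun vrel_args :: "vrel \<Rightarrow> vsort list" where
  "vrel_args Less = [GamS, GamS]"

definition L_SK :: "'k ring \<Rightarrow> (vsort, 'k SK_sym, vrel) language" where
  "L_SK K =
     \<lparr>sorts = {VecS, GamS, SkelS},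
      funs = {AddK, ZeroK, InftyK, ValK, SAddK, SZeroK, SValK, ProjK}
               \<union> ScalK ` carrier K \<union> SScalK ` carrier K,
      rels = {Less}, fun_args = SK_args, fun_sort = SK_sort, rel_args = vrel_args\<rparr>"

definition L_SK_skel :: "'k ring \<Rightarrow> (vsort, 'k SK_sym, vrel) language" where
  "L_SK_skel K =
     \<lparr>sorts = {GamS, SkelS},
      funs = {SAddK, SZeroK, SValK} \<union> SScalK ` carrier K,
      rels = {Less}, fun_args = SK_args, fun_sort = SK_sort, rel_args = vrel_args\<rparr>"

definition L_S :: "(vsort, S_sym, vrel) language" where
  "L_S =
     \<lparr>sorts = UNIV, funs = UNIV,
      rels = {Less}, fun_args = S_args, fun_sort = S_sort, rel_args = vrel_args\<rparr>"

definition L_S_skel :: "(vsort, S_sym, vrel) language" where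
  "L_S_skel =
     \<lparr>sorts = {FieldS, GamS, SkelS},
      funs = {SAdd, SZero, FAdd, FMult, FZero, FOne, SScal, SVal},
      rels = {Less}, fun_args = S_args, fun_sort = S_sort, rel_args = vrel_args\<rparr>"

datatype ('k, 'v, 'g) elt =
    Vec (the_vec: 'v)
  | Sca (the_sca: 'k)
  | Gam (the_gam: 'g)
  | Skel (the_skel: "('g \<times> 'v) set")

fun std_univ :: "('k, 'v, 'g) vvs \<Rightarrow> vsort \<Rightarrow> ('k, 'v, 'g) elt set" where
  "std_univ X VecS = Vec ` carrier (vecs X)"
| "std_univ X FieldS = Sca ` carrier (base X)"
| "std_univ X GamS = Gam ` gam X"
| "std_univ X SkelS = Skel ` skeleton X"

fun std_rel :: "('k, 'v, 'g) vvs \<Rightarrow> vrel \<Rightarrow> ('k, 'v, 'g) elt list \<Rightarrow> bool" where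
  "std_rel X Less xs \<longleftrightarrow> (the_gam (xs ! 0), the_gam (xs ! 1)) \<in> lt X"

fun std_SK ::
  "('k, 'v, 'g) vvs \<Rightarrow> 'k SK_sym \<Rightarrow> ('k, 'v, 'g) elt list \<Rightarrow> ('k, 'v, 'g) elt" where
  "std_SK X AddK xs = Vec (the_vec (xs ! 0) \<oplus>\<^bsub>vecs X\<^esub> the_vec (xs ! 1))"
| "std_SK X ZeroK xs = Vec \<zero>\<^bsub>vecs X\<^esub>"
| "std_SK X (ScalK k) xs = Vec (k \<odot>\<^bsub>vecs X\<^esub> the_vec (xs ! 0))"
| "std_SK X InftyK xs = Gam (infty X)"
| "std_SK X ValK xs = Gam (vl X (the_vec (xs ! 0)))"
| "std_SK X SAddK xs = Skel (skel_add X (the_skel (xs ! 0)) (the_skel (xs ! 1)))"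
| "std_SK X SZeroK xs = Skel (skel_zero X)"
| "std_SK X (SScalK k) xs = Skel (skel_scal X k (the_skel (xs ! 0)))"
| "std_SK X SValK xs = Gam (skel_val (the_skel (xs ! 0)))"
| "std_SK X ProjK xs = Skel (skel_proj X (the_vec (xs ! 0)))"

fun std_S ::
  "('k, 'v, 'g) vvs \<Rightarrow> S_sym \<Rightarrow> ('k, 'v, 'g) elt list \<Rightarrow> ('k, 'v, 'g) elt" where
  "std_S X Add xs = Vec (the_vec (xs ! 0) \<oplus>\<^bsub>vecs X\<^esub> the_vec (xs ! 1))"
| "std_S X Zero xs = Vec \<zero>\<^bsub>vecs X\<^esub>"
| "std_S X FAdd xs = Sca (the_sca (xs ! 0) \<oplus>\<^bsub>base X\<^esub> the_sca (xs ! 1))"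
| "std_S X FMult xs = Sca (the_sca (xs ! 0) \<otimes>\<^bsub>base X\<^esub> the_sca (xs ! 1))"
| "std_S X FZero xs = Sca \<zero>\<^bsub>base X\<^esub>"
| "std_S X FOne xs = Sca \<one>\<^bsub>base X\<^esub>"
| "std_S X Infty xs = Gam (infty X)"
| "std_S X Scal xs = Vec (the_sca (xs ! 0) \<odot>\<^bsub>vecs X\<^esub> the_vec (xs ! 1))"
| "std_S X Val xs = Gam (vl X (the_vec (xs ! 0)))"
| "std_S X SAdd xs = Skel (skel_add X (the_skel (xs ! 0)) (the_skel (xs ! 1)))"
| "std_S X SZero xs = Skel (skel_zero X)"
| "std_S X SScal xs = Skel (skel_scal X (the_sca (xs ! 0)) (the_skel (xs ! 1)))"
| "std_S X SVal xs = Gam (skel_val (the_skel (xs ! 0)))"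
| "std_S X Proj xs = Skel (skel_proj X (the_vec (xs ! 0)))"

definition SK_structure ::
  "('k, 'v, 'g) vvs \<Rightarrow> (vsort, 'k SK_sym, vrel, ('k, 'v, 'g) elt) struct" where
  "SK_structure X = \<lparr>univ = std_univ X, fun_in = std_SK X, rel_in = std_rel X\<rparr>"

definition S_structure ::
  "('k, 'v, 'g) vvs \<Rightarrow> (vsort, S_sym, vrel, ('k, 'v, 'g) elt) struct" where
  "S_structure X = \<lparr>univ = std_univ X, fun_in = std_S X, rel_in = std_rel X\<rparr>"

text \<open>Since the skeleton is a sort of the structure, the models of the theory are the structures
  isomorphic to the standard structure of a valued vector space. That the space is sought over
  \<open>'u\<close> is no restriction: its vectors, values and (in \<open>L\<^sub>S\<close>) scalars can be renamed to
  the elements of the corresponding sorts of \<open>M\<close>.\<close>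

definition SK_model :: "'k ring \<Rightarrow> (vsort, 'k SK_sym, vrel, 'u) struct \<Rightarrow> bool" where
  "SK_model K M \<longleftrightarrow>
     (\<exists>X :: ('k, 'u, 'u) vvs. valued_vector_space X \<and> base X = K \<and>
        isomorphic (L_SK K) M (SK_structure X))"

definition S_model :: "(vsort, S_sym, vrel, 'u) struct \<Rightarrow> bool" where
  "S_model M \<longleftrightarrow>
     (\<exists>X :: ('u, 'u, 'u) vvs. valued_vector_space X \<and> isomorphic L_S M (S_structure X))"

end

theory Submission
  imports Defs "HOL-Algebra.QuotRing"
begin

text \<open>A condition on the skeleton that is expressed by the same formula in \<open>V\<close> and in \<open>W\<close> is preserved
  when \<open>S(V)\<close> is elementary in \<open>S(W)\<close>. So it suffices to replace every formula by a condition on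
  the skeleton, in the same way for all models; no saturation and no spherical completeness is
  needed.

  With a fixed base field, a vector variable \<open>x\<close> only enters through finitely many \<open>\<pi>(c (x - a))\<close>
  with \<open>a\<close> in a finite set \<open>A\<close> of terms without \<open>x\<close>. If \<open>a\<^sub>0 \<in> A\<close> is closest to \<open>x\<close>, then
  \<open>\<pi>(x - a)\<close> is computed from \<open>\<sigma> = \<pi>(x - a\<^sub>0)\<close> and \<open>\<pi>(a\<^sub>0 - a)\<close>; conversely, every value \<open>\<sigma>\<close> of
  \<open>\<pi>\<close> whose sums with the \<open>\<pi>(a\<^sub>0 - a)\<close> do not cancel arises in this way. Hence the quantifier over \<open>x\<close>
  becomes one over \<open>\<sigma>\<close>.

  With a variable base field, coefficients can be quantified, and the vectors are instead written
  in coordinates with respect to a finite tuple \<open>y\<close> that is separated: the value of a linear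
  combination is the minimum of the values of its terms. Then \<open>\<pi>\<close> of a vector is determined by its
  coordinates and the \<open>\<pi>(y\<^sub>i)\<close>, and a further vector is \<open>x = \<Sum> k\<^sub>i y\<^sub>i + z\<close> where \<open>(y, z)\<close> is again
  separated, because the span of a separated tuple contains a vector closest to \<open>x\<close>. Being separated
  is a condition on the \<open>\<pi>(y\<^sub>i)\<close>, so it passes from \<open>V\<close> to \<open>W\<close>.\<close>

section \<open>Uniformly definable relations\<close>

text \<open>The obstacle behind both eliminations is cancellation: when leading terms cancel,
  \<pi>(u + v) is not determined by \<pi>(u) and \<pi>(v). Centring at the closest point of
  \<open>A\<close> avoids such sums; in a separated tuple they cannot occur. That their absence is
  expressible rests on a remark about groups: over \<gamma> < \<infinity> the classes form a group,
  whose only idempotent is its zero, in every characteristic, and this zero is the one class over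
  \<gamma> to which no vector projects. The two methods cannot be exchanged. With scalars as a sort,
  the coefficient of \<open>x\<close> in a term varies with the scalar variables, so the centres are
  no longer finitely many terms. When a vector is recovered from a class \<sigma>, any preimage
  under \<pi> serves, because the truth of the remaining formula depends on skeleton data only. This
  is why nothing has to be realised in a larger model.\<close>

definition good_env ::
  "('s, 'f, 'r) language \<Rightarrow> ('s, 'f, 'r, 'u) struct \<Rightarrow> ('s \<Rightarrow> 'i \<Rightarrow> 'u) \<Rightarrow> bool" where
  "good_env L M e \<longleftrightarrow> (\<forall>s\<in>sorts L. \<forall>i. e s i \<in> univ M s)"

text \<open>Environments are indexed by an arbitrary type \<open>'i\<close>, and a relation may depend on finitely many
  indices \<open>I\<close> only. A formula is required for every numbering \<open>f\<close> of \<open>I\<close> by variables, so that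
  variables can be renamed and chosen fresh without looking at the formulas.\<close>

definition represents ::
  "('s, 'f, 'r) language \<Rightarrow> ('s, 'f, 'r, 'u) struct set \<Rightarrow> 'i set \<Rightarrow> ('i \<Rightarrow> nat) \<Rightarrow> ('s, 'f, 'r) form \<Rightarrow>
   (('s, 'f, 'r, 'u) struct \<Rightarrow> ('s \<Rightarrow> 'i \<Rightarrow> 'u) \<Rightarrow> bool) \<Rightarrow> bool" where
  "represents L MM I f p Q \<longleftrightarrow> wf_form L p \<and>
     (\<forall>M\<in>MM. \<forall>e e'. good_env L M e \<longrightarrow> good_env L M e' \<longrightarrow>
        (\<forall>s\<in>sorts L. \<forall>i\<in>I. e' s (f i) = e s i) \<longrightarrow> sat M e' p = Q M e)"

definition definable ::
  "('s, 'f, 'r) language \<Rightarrow> ('s, 'f, 'r, 'u) struct set \<Rightarrow>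
   (('s, 'f, 'r, 'u) struct \<Rightarrow> ('s \<Rightarrow> 'i \<Rightarrow> 'u) \<Rightarrow> bool) \<Rightarrow> bool" where
  "definable L MM Q \<longleftrightarrow>
     (\<exists>I. finite I \<and> (\<forall>f::'i \<Rightarrow> nat. inj_on f I \<longrightarrow> (\<exists>p. represents L MM I f p Q)))"

text \<open>A function is handled through its graph, with the value at the extra index
  \<open>Inr ()\<close>. The membership clause allows the value to be named by a quantified
  variable, since quantifiers range over the sort only.\<close>

definition definable_fun ::
  "('s, 'f, 'r) language \<Rightarrow> ('s, 'f, 'r, 'u) struct set \<Rightarrow> 's \<Rightarrow>
   (('s, 'f, 'r, 'u) struct \<Rightarrow> ('s \<Rightarrow> 'i \<Rightarrow> 'u) \<Rightarrow> 'u) \<Rightarrow> bool" where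
  "definable_fun L MM s F \<longleftrightarrow>
     s \<in> sorts L \<and> (\<forall>M\<in>MM. \<forall>e. good_env L M e \<longrightarrow> F M e \<in> univ M s) \<and>
     definable L MM (\<lambda>M (e :: 's \<Rightarrow> 'i + unit \<Rightarrow> 'u). e s (Inr ()) = F M (\<lambda>s i. e s (Inl i)))"

section \<open>Blocks of quantifiers and conjunctions\<close>

fun exs :: "('s \<times> nat) list \<Rightarrow> ('s, 'f, 'r) form \<Rightarrow> ('s, 'f, 'r) form" where
  "exs [] p = p"
| "exs ((s, n) # vs) p = Exists s n (exs vs p)"

lemma wf_exs: "wf_form L (exs vs p) \<longleftrightarrow> (\<forall>v\<in>set vs. fst v \<in> sorts L) \<and> wf_form L p"
  by (induction vs) auto

lemma sat_exs:
  "sat M e (exs vs p) \<longleftrightarrow>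
   (\<exists>e'. (\<forall>s n. (s, n) \<notin> set vs \<longrightarrow> e' s n = e s n) \<and> (\<forall>(s, n)\<in>set vs. e' s n \<in> univ M s) \<and>
     sat M e' p)"
proof (induction vs arbitrary: e)
  case Nil
  have "e' = e" if "\<forall>s n. e' s n = e s n" for e' using that by (intro ext) auto
  then show ?case by auto
next
  case (Cons v vs)
  obtain s n where v: "v = (s, n)" by (cases v)
  show ?case
  proof
    assume "sat M e (exs (v # vs) p)"
    then obtain x e' where x: "x \<in> univ M s"
      and e': "\<forall>s' n'. (s', n') \<notin> set vs \<longrightarrow> e' s' n' = (e(s := (e s)(n := x))) s' n'"
        "\<forall>(s', n')\<in>set vs. e' s' n' \<in> univ M s'" "sat M e' p"
      unfolding v using Cons.IH by auto
    \<comment> \<open>The rest of the block may bind the same variable again; then its last value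
      counts and not \<open>x\<close>.\<close>
    have "e' s n \<in> univ M s"
      using x e' by (cases "(s, n) \<in> set vs") auto
    moreover have "\<forall>s' n'. (s', n') \<notin> set (v # vs) \<longrightarrow> e' s' n' = e s' n'"
      using e' v by auto
    moreover have "\<forall>(s, n)\<in>set (v # vs). e' s n \<in> univ M s"
      using calculation(1) e'(2) v by simp
    ultimately show "\<exists>e'. (\<forall>s n. (s, n) \<notin> set (v # vs) \<longrightarrow> e' s n = e s n) \<and>
      (\<forall>(s, n)\<in>set (v # vs). e' s n \<in> univ M s) \<and> sat M e' p"
      using e'(3) by (intro exI[of _ e'] conjI)
  next
    assume "\<exists>e'. (\<forall>s n. (s, n) \<notin> set (v # vs) \<longrightarrow> e' s n = e s n) \<and>
      (\<forall>(s, n)\<in>set (v # vs). e' s n \<in> univ M s) \<and> sat M e' p"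
    then obtain e' where e': "\<forall>s n. (s, n) \<notin> set (v # vs) \<longrightarrow> e' s n = e s n"
      "\<forall>(s, n)\<in>set (v # vs). e' s n \<in> univ M s" "sat M e' p" by auto
    have "sat M (e(s := (e s)(n := e' s n))) (exs vs p)"
      unfolding Cons.IH using e' v by (intro exI[of _ e']) auto
    then show "sat M e (exs (v # vs) p)"
      unfolding v using e' v by auto
  qed
qed

fun conjs :: "('s, 'f, 'r) form list \<Rightarrow> ('s, 'f, 'r) form \<Rightarrow> ('s, 'f, 'r) form" where
  "conjs [] q = q"
| "conjs (p # ps) q = Conj p (conjs ps q)"

lemma wf_conjs: "wf_form L (conjs ps q) \<longleftrightarrow> (\<forall>p\<in>set ps. wf_form L p) \<and> wf_form L q"
  by (induction ps) auto

lemma sat_conjs: "sat M e (conjs ps q) \<longleftrightarrow> (\<forall>p\<in>set ps. sat M e p) \<and> sat M e q"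
  by (induction ps) auto

text \<open>A source of fresh variables: they are taken above a bound for those already in
  use.\<close>

lemma finite_inj_above:
  assumes "finite J"
  obtains h :: "'j \<Rightarrow> nat" where "inj_on h J" "\<And>j. N \<le> h j"
proof -
  obtain g :: "'j \<Rightarrow> nat" where "inj_on g J"
    using finite_imp_inj_to_nat_seg[OF assms] by auto
  then have "inj_on (\<lambda>j. N + g j) J" by (auto simp: inj_on_def)
  then show ?thesis by (rule that) simp
qed

lemma finite_nat_above:
  assumes "finite I"
  obtains N :: nat where "\<And>i. i \<in> I \<Longrightarrow> f i < N"
proof
  fix i assume "i \<in> I"
  then show "f i < Suc (\<Sum>i\<in>I. f i)" using assms by (simp add: less_Suc_eq_le member_le_sum)
qed

section \<open>Closure of definable relations under logical operations and substitution\<close>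

lemma representsI:
  assumes "wf_form L p"
    and "\<And>M e e'. \<lbrakk>M \<in> MM; good_env L M e; good_env L M e';
      \<And>s i. \<lbrakk>s \<in> sorts L; i \<in> I\<rbrakk> \<Longrightarrow> e' s (f i) = e s i\<rbrakk> \<Longrightarrow> sat M e' p = Q M e"
  shows "represents L MM I f p Q"
  using assms unfolding represents_def by blast

lemma representsD:
  assumes "represents L MM I f p Q" "M \<in> MM" "good_env L M e" "good_env L M e'"
    "\<And>s i. \<lbrakk>s \<in> sorts L; i \<in> I\<rbrakk> \<Longrightarrow> e' s (f i) = e s i"
  shows "sat M e' p = Q M e"
  using assms unfolding represents_def by blast

lemma represents_wf: "represents L MM I f p Q \<Longrightarrow> wf_form L p"
  by (simp add: represents_def)

lemma definableE:
  assumes "definable L MM Q"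
  obtains I where "finite I" "\<And>f. inj_on f I \<Longrightarrow> \<exists>p. represents L MM I f p Q"
  using assms unfolding definable_def by blast

lemma definableI:
  assumes "finite I" "\<And>f. inj_on f I \<Longrightarrow> \<exists>p. represents L MM I f p Q"
  shows "definable L MM Q"
  using assms unfolding definable_def by blast

lemma definable_map:
  assumes "\<And>I f p. represents L MM I f p Q \<Longrightarrow> represents L MM I f (g p) Q'" "definable L MM Q"
  shows "definable L MM Q'"
proof -
  obtain I where I: "finite I" and H: "\<And>f. inj_on f I \<Longrightarrow> \<exists>p. represents L MM I f p Q"
    by (rule definableE[OF assms(2)]) (rule that)
  show ?thesis
  proof (rule definableI[OF I])
    fix f :: "_ \<Rightarrow> nat" assume "inj_on f I"
    from H[OF this] obtain p where "represents L MM I f p Q" by (rule exE)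
    from assms(1)[OF this] show "\<exists>p. represents L MM I f p Q'" by (rule exI)
  qed
qed

text \<open>Pull an environment back along the inverse of an injective numbering of
  \<open>I\<close>. The truth value of the representing formula at this single assignment is the
  value of \<open>Q\<close> at both environments.\<close>

lemma definable_support:
  assumes "definable L MM Q"
  obtains I where "finite I"
    and "\<And>M e e'. \<lbrakk>M \<in> MM; good_env L M e; good_env L M e';
           \<forall>s\<in>sorts L. \<forall>i\<in>I. e s i = e' s i\<rbrakk> \<Longrightarrow> Q M e = Q M e'"
proof -
  obtain I where I: "finite I" and H: "\<And>f. inj_on f I \<Longrightarrow> \<exists>p. represents L MM I f p Q"
    by (rule definableE[OF assms]) (rule that)
  obtain f :: "_ \<Rightarrow> nat" where f: "inj_on f I"
    using finite_imp_inj_to_nat_seg[OF I] by auto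
  obtain p where p: "represents L MM I f p Q"
    using H[OF f] by blast
  show ?thesis
  proof (rule that[OF I])
    fix M e e'
    assume M: "M \<in> MM" and g: "good_env L M e" "good_env L M e'"
      and eq: "\<forall>s\<in>sorts L. \<forall>i\<in>I. e s i = e' s i"
    let ?e = "\<lambda>s n. e s (inv_into I f n)"
    have ge: "good_env L M ?e" using g(1) by (simp add: good_env_def)
    have "sat M ?e p = Q M e"
      by (rule representsD[OF p M g(1) ge]) (simp add: f)
    moreover have "sat M ?e p = Q M e'"
      by (rule representsD[OF p M g(2) ge]) (simp add: f eq)
    ultimately show "Q M e = Q M e'" by simp
  qed
qed

lemma definable_cong:
  assumes "definable L MM Q" and "\<And>M e. \<lbrakk>M \<in> MM; good_env L M e\<rbrakk> \<Longrightarrow> Q M e = Q' M e"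
  shows "definable L MM Q'"
proof -
  have "represents L MM I f p Q'" if "represents L MM I f p Q" for I f p
    using that assms(2) unfolding represents_def by simp
  then show ?thesis using assms(1) by (rule definable_map)
qed

lemma definable_not:
  assumes "definable L MM Q"
  shows "definable L MM (\<lambda>M e. \<not> Q M e)"
proof -
  have "represents L MM I f (Neg p) (\<lambda>M e. \<not> Q M e)" if "represents L MM I f p Q" for I f p
    using that unfolding represents_def by simp
  then show ?thesis using assms by (rule definable_map)
qed

lemma represents_mono:
  assumes "represents L MM I f p Q" "I \<subseteq> J" shows "represents L MM J f p Q"
  using assms unfolding represents_def by blast

lemma definable_conj:
  assumes "definable L MM Q" "definable L MM R"
  shows "definable L MM (\<lambda>M e. Q M e \<and> R M e)"
proof -
  obtain I where I: "finite I" and HI: "\<And>f. inj_on f I \<Longrightarrow> \<exists>p. represents L MM I f p Q"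
    by (rule definableE[OF assms(1)]) (rule that)
  obtain J where J: "finite J" and HJ: "\<And>f. inj_on f J \<Longrightarrow> \<exists>p. represents L MM J f p R"
    by (rule definableE[OF assms(2)]) (rule that)
  show ?thesis
  proof (rule definableI[of "I \<union> J"])
    show "finite (I \<union> J)" using I J by simp
    fix f :: "_ \<Rightarrow> nat" assume "inj_on f (I \<union> J)"
    then have "inj_on f I" "inj_on f J" by (auto simp: inj_on_Un)
    from HI[OF this(1)] HJ[OF this(2)] obtain p q where
      "represents L MM I f p Q" "represents L MM J f q R" by blast
    then have "represents L MM (I \<union> J) f p Q" "represents L MM (I \<union> J) f q R"
      using represents_mono by blast+
    then have "represents L MM (I \<union> J) f (Conj p q) (\<lambda>M e. Q M e \<and> R M e)"
      unfolding represents_def by simp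
    then show "\<exists>p. represents L MM (I \<union> J) f p (\<lambda>M e. Q M e \<and> R M e)" by (rule exI)
  qed
qed

lemma definable_disj:
  assumes "definable L MM Q" "definable L MM R"
  shows "definable L MM (\<lambda>M e. Q M e \<or> R M e)"
  using definable_not[OF definable_conj[OF definable_not[OF assms(1)] definable_not[OF assms(2)]]]
  by simp

lemma definable_const:
  fixes MM :: "('s, 'f, 'r, 'u) struct set"
  assumes "sorts L \<noteq> {}"
  shows "definable L MM (\<lambda>M (e :: 's \<Rightarrow> 'i \<Rightarrow> 'u). b)"
proof -
  obtain s where s: "s \<in> sorts L" using assms by blast
  have "represents L MM {} f (Equal (Var s 0) (Var s 0)) (\<lambda>M e. True)" for f :: "'i \<Rightarrow> nat"
    using s by (simp add: represents_def)
  then have "\<exists>p. represents L MM {} f p (\<lambda>M e. True)" for f :: "'i \<Rightarrow> nat"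
    by (rule exI)
  then have "definable L MM (\<lambda>M (e :: 's \<Rightarrow> 'i \<Rightarrow> 'u). True)"
    by (intro definableI[of "{}"]) simp_all
  with definable_not[OF this] show ?thesis by (cases b) simp_all
qed

lemma definable_ball:
  assumes "finite A" "sorts L \<noteq> {}" "\<And>a. a \<in> A \<Longrightarrow> definable L MM (Q a)"
  shows "definable L MM (\<lambda>M e. \<forall>a\<in>A. Q a M e)"
  using assms(1,3)
proof (induction A)
  case empty then show ?case using definable_const[OF assms(2)] by simp
next
  case (insert a A)
  then show ?case using definable_conj[of L MM "Q a" "\<lambda>M e. \<forall>a\<in>A. Q a M e"] by simp
qed

lemma definable_bex:
  assumes "finite A" "sorts L \<noteq> {}" "\<And>a. a \<in> A \<Longrightarrow> definable L MM (Q a)"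
  shows "definable L MM (\<lambda>M e. \<exists>a\<in>A. Q a M e)"
  using definable_not[OF definable_ball[OF assms(1,2), of MM "\<lambda>a M e. \<not> Q a M e"]]
    definable_not[OF assms(3)] by simp

text \<open>\<open>c\<close> is a family over a possibly infinite index type, yet one block of
  quantifiers suffices, since a definable relation reads only the finitely many entries with index
  in \<open>J\<close>. This later expresses quantification over all coefficient sequences.\<close>

lemma definable_ex:
  fixes R :: "('s, 'f, 'r, 'u) struct \<Rightarrow> ('j \<Rightarrow> 'u) \<Rightarrow> ('s \<Rightarrow> 'i \<Rightarrow> 'u) \<Rightarrow> bool"
  assumes R: "definable L MM (\<lambda>M (e :: 's \<Rightarrow> 'i + 'j \<Rightarrow> 'u). R M (\<lambda>j. e s (Inr j)) (\<lambda>s i. e s (Inl i)))"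
    and s: "s \<in> sorts L"
  shows "definable L MM (\<lambda>M e. \<exists>c. (\<forall>j. c j \<in> univ M s) \<and> R M c e)"
proof -
  obtain I :: "('i + 'j) set" where I: "finite I" and HI: "\<And>f. inj_on f I \<Longrightarrow>
      \<exists>p. represents L MM I f p (\<lambda>M e. R M (\<lambda>j. e s (Inr j)) (\<lambda>s i. e s (Inl i)))"
    by (rule definableE[OF R]) (rule that)
  define I' where "I' = Inl -` I"
  define J where "J = Inr -` I"
  have fin: "finite I'" "finite J" unfolding I'_def J_def using I by (auto intro!: finite_vimageI)
  show ?thesis
  proof (rule definableI[OF fin(1)])
    fix f :: "'i \<Rightarrow> nat" assume f: "inj_on f I'"
    obtain N where N: "\<And>i. i \<in> I' \<Longrightarrow> f i < N" using finite_nat_above[OF fin(1)] by blast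
    obtain h :: "'j \<Rightarrow> nat" where h: "inj_on h J" "\<And>j. N \<le> h j"
      using finite_inj_above[OF fin(2)] by blast
    have ne: "f i \<noteq> h j" if "i \<in> I'" for i j
      using N[OF that] h(2)[of j] by auto
    have "inj_on (case_sum f h) I"
    proof (rule inj_onI)
      fix x y assume "x \<in> I" "y \<in> I" "case_sum f h x = case_sum f h y"
      then show "x = y" using inj_onD[OF f] inj_onD[OF h(1)] ne ne[symmetric]
        by (cases x; cases y) (simp_all add: I'_def J_def)
    qed
    from HI[OF this] obtain p where
      p: "represents L MM I (case_sum f h) p (\<lambda>M e. R M (\<lambda>j. e s (Inr j)) (\<lambda>s i. e s (Inl i)))"
      by blast
    obtain jl where jl: "set jl = J" using finite_list[OF fin(2)] by blast
    let ?vs = "map (\<lambda>j. (s, h j)) jl"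
    have "represents L MM I' f (exs ?vs p) (\<lambda>M e. \<exists>c. (\<forall>j. c j \<in> univ M s) \<and> R M c e)"
    proof (rule representsI)
      show "wf_form L (exs ?vs p)" using represents_wf[OF p] s by (auto simp: wf_exs)
      fix M and e :: "'s \<Rightarrow> 'i \<Rightarrow> 'u" and e'
      assume M: "M \<in> MM" and g: "good_env L M e" "good_env L M e'"
        and m: "\<And>s i. \<lbrakk>s \<in> sorts L; i \<in> I'\<rbrakk> \<Longrightarrow> e' s (f i) = e s i"
      have key: "sat M e'' p = R M c e"
        if off: "\<forall>s' n. (s', n) \<notin> set ?vs \<longrightarrow> e'' s' n = e' s' n"
          and on: "\<And>j. j \<in> J \<Longrightarrow> e'' s (h j) = c j" and c: "\<forall>j. c j \<in> univ M s" for e'' c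
      proof -
        \<comment> \<open>\<open>R\<close> reads the new indices in sort \<open>s\<close> only, and
          there all of \<open>c\<close> must appear, also outside \<open>J\<close>. In the other
          sorts the entries just repeat what the formula sees.\<close>
        define E where "E = (\<lambda>s'. case_sum (e s') (\<lambda>j. if s' = s then c j else e'' s' (h j)))"
        have g'': "good_env L M e''"
          unfolding good_env_def
        proof (intro ballI allI)
          fix s' n assume "s' \<in> sorts L"
          then show "e'' s' n \<in> univ M s'"
            using off on c g(2) jl by (cases "(s', n) \<in> set ?vs") (auto simp: good_env_def)
        qed
        have gE: "good_env L M E"
          using g(1) g'' c by (auto simp: good_env_def E_def split: sum.splits)
        have "sat M e'' p = R M (\<lambda>j. E s (Inr j)) (\<lambda>s i. E s (Inl i))"
        proof (rule representsD[OF p M gE g''])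
          fix s' i assume s': "s' \<in> sorts L" and i: "i \<in> I"
          show "e'' s' (case_sum f h i) = E s' i"
          proof (cases i)
            case (Inl k)
            then have k: "k \<in> I'" using i by (simp add: I'_def)
            have "(s', f k) \<notin> set ?vs" using ne[OF k] by auto
            then have "e'' s' (f k) = e' s' (f k)" using off by blast
            then show ?thesis using Inl m s' k by (simp add: E_def)
          next
            case (Inr j)
            then show ?thesis using on i by (simp add: E_def J_def)
          qed
        qed
        then show ?thesis by (simp add: E_def)
      qed
      show "sat M e' (exs ?vs p) = (\<exists>c. (\<forall>j. c j \<in> univ M s) \<and> R M c e)"
      proof
        assume "sat M e' (exs ?vs p)"
        then obtain e'' where e'': "\<forall>s' n. (s', n) \<notin> set ?vs \<longrightarrow> e'' s' n = e' s' n"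
          "\<forall>(s', n)\<in>set ?vs. e'' s' n \<in> univ M s'" "sat M e'' p"
          unfolding sat_exs by (elim exE conjE)
        let ?c = "\<lambda>j. e'' s (h j)"
        have "?c j \<in> univ M s" for j
          using e''(1,2) g(2) s by (cases "(s, h j) \<in> set ?vs") (auto simp: good_env_def)
        then have c: "\<forall>j. ?c j \<in> univ M s" by blast
        have "R M ?c e" using key[OF e''(1) _ c] e''(3) by simp
        with c show "\<exists>c. (\<forall>j. c j \<in> univ M s) \<and> R M c e" by (intro exI[of _ ?c] conjI)
      next
        assume "\<exists>c. (\<forall>j. c j \<in> univ M s) \<and> R M c e"
        then obtain c where c: "\<forall>j. c j \<in> univ M s" "R M c e" by (elim exE conjE)
        define e'' where "e'' = e'(s := (\<lambda>n. if n \<in> h ` J then c (inv_into J h n) else e' s n))"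
        have off: "\<forall>s' n. (s', n) \<notin> set ?vs \<longrightarrow> e'' s' n = e' s' n"
          using jl by (auto simp: e''_def)
        have on: "e'' s (h j) = c j" if "j \<in> J" for j
          using that h(1) by (simp add: e''_def)
        have "sat M e'' p" using key[OF off on c(1)] c(2) by simp
        moreover have "\<forall>(s', n)\<in>set ?vs. e'' s' n \<in> univ M s'"
          using on c(1) jl by auto
        ultimately show "sat M e' (exs ?vs p)"
          unfolding sat_exs using off by (intro exI[of _ e''] conjI)
      qed
    qed
    then show "\<exists>p. represents L MM I' f p (\<lambda>M e. \<exists>c. (\<forall>j. c j \<in> univ M s) \<and> R M c e)" by (rule exI)
  qed
qed

text \<open>No term is substituted. The finitely many values \<open>F s j\<close> that
  \<open>Q\<close> reads get fresh variables \<open>h j\<close>, and the formula says that some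
  values of these variables satisfy the graphs of the \<open>F s j\<close> together with
  \<open>Q\<close>.\<close>

lemma definable_subst:
  fixes Q :: "('s, 'f, 'r, 'u) struct \<Rightarrow> ('s \<Rightarrow> 'j \<Rightarrow> 'u) \<Rightarrow> bool"
    and F :: "'s \<Rightarrow> 'j \<Rightarrow> ('s, 'f, 'r, 'u) struct \<Rightarrow> ('s \<Rightarrow> 'i \<Rightarrow> 'u) \<Rightarrow> 'u"
  assumes Q: "definable L MM Q" and fin: "finite (sorts L)"
    and F: "\<And>s j. s \<in> sorts L \<Longrightarrow> definable_fun L MM s (F s j)"
  shows "definable L MM (\<lambda>M e. Q M (\<lambda>s j. F s j M e))"
proof -
  obtain J :: "'j set" where J: "finite J"
    and HJ: "\<And>f. inj_on f J \<Longrightarrow> \<exists>p. represents L MM J f p Q"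
    by (rule definableE[OF Q]) (rule that)
  let ?G = "\<lambda>s j M (e :: 's \<Rightarrow> 'i + unit \<Rightarrow> 'u). e s (Inr ()) = F s j M (\<lambda>s i. e s (Inl i))"
  have "\<exists>I. finite I \<and> (\<forall>f. inj_on f I \<longrightarrow> (\<exists>p. represents L MM I f p (?G s j)))"
    if "s \<in> sorts L" for s j
    using F[OF that, of j] unfolding definable_fun_def definable_def by (elim conjE)
  then have "\<forall>s j. \<exists>I. s \<in> sorts L \<longrightarrow>
      finite I \<and> (\<forall>f. inj_on f I \<longrightarrow> (\<exists>p. represents L MM I f p (?G s j)))"
    by simp
  then obtain I0 where "\<forall>s j. s \<in> sorts L \<longrightarrow> finite (I0 s j) \<and>
      (\<forall>f. inj_on f (I0 s j) \<longrightarrow> (\<exists>p. represents L MM (I0 s j) f p (?G s j)))"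
    unfolding choice_iff by (elim exE)
  then have I0: "\<And>s j. s \<in> sorts L \<Longrightarrow> finite (I0 s j)"
    and HI0: "\<And>s j f. \<lbrakk>s \<in> sorts L; inj_on f (I0 s j)\<rbrakk> \<Longrightarrow>
      \<exists>p. represents L MM (I0 s j) f p (?G s j)"
    by simp_all
  define I where "I = (\<Union>s\<in>sorts L. \<Union>j\<in>J. Inl -` I0 s j)"
  have I: "finite I" unfolding I_def using fin J I0 by (auto intro!: finite_vimageI)
  have Fgood: "good_env L M (\<lambda>s j. F s j M e)" if "M \<in> MM" "good_env L M e" for M e
    using F that by (auto simp: good_env_def definable_fun_def)
  show ?thesis
  proof (rule definableI[OF I])
    fix f :: "'i \<Rightarrow> nat" assume f: "inj_on f I"
    obtain N where N: "\<And>i. i \<in> I \<Longrightarrow> f i < N" using finite_nat_above[OF I] by blast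
    obtain h :: "'j \<Rightarrow> nat" where h: "inj_on h J" "\<And>j. N \<le> h j"
      using finite_inj_above[OF J] by blast
    have ne: "f i \<noteq> h j" if "i \<in> I" for i j
      using N[OF that] h(2)[of j] by auto
    obtain q where q: "represents L MM J h q Q"
      using HJ[OF h(1)] by blast
    have sub: "k \<in> I" if "s \<in> sorts L" "j \<in> J" "Inl k \<in> I0 s j" for s j k
      using that by (auto simp: I_def)
    have inj: "inj_on (case_sum f (\<lambda>_. h j)) (I0 s j)" if "s \<in> sorts L" "j \<in> J" for s j
    proof (rule inj_onI)
      fix x y assume xy: "x \<in> I0 s j" "y \<in> I0 s j" "case_sum f (\<lambda>_. h j) x = case_sum f (\<lambda>_. h j) y"
      show "x = y"
        using xy sub[OF that] ne ne[symmetric] inj_onD[OF f]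
        by (cases x; cases y) simp_all
    qed
    have "\<forall>s j. \<exists>p. s \<in> sorts L \<longrightarrow> j \<in> J \<longrightarrow>
        represents L MM (I0 s j) (case_sum f (\<lambda>_. h j)) p (?G s j)"
      using HI0[OF _ inj] by simp
    then obtain G where "\<forall>s j. s \<in> sorts L \<longrightarrow> j \<in> J \<longrightarrow>
        represents L MM (I0 s j) (case_sum f (\<lambda>_. h j)) (G s j) (?G s j)"
      unfolding choice_iff by (elim exE)
    then have G: "\<And>s j. \<lbrakk>s \<in> sorts L; j \<in> J\<rbrakk> \<Longrightarrow>
        represents L MM (I0 s j) (case_sum f (\<lambda>_. h j)) (G s j) (?G s j)"
      by simp
    obtain vl where vl: "set vl = sorts L \<times> J"
      using finite_list fin J by (metis finite_cartesian_product)
    define vs where "vs = map (\<lambda>(s, j). (s, h j)) vl"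
    have vs: "(s, n) \<in> set vs \<longleftrightarrow> s \<in> sorts L \<and> n \<in> h ` J" for s n
      unfolding vs_def using vl by force
    let ?p = "exs vs (conjs (map (\<lambda>(s, j). G s j) vl) q)"
    have "represents L MM I f ?p (\<lambda>M e. Q M (\<lambda>s j. F s j M e))"
    proof (rule representsI)
      show "wf_form L ?p"
        using represents_wf[OF q] represents_wf[OF G] vl vs by (auto simp: wf_exs wf_conjs)
      fix M and e :: "'s \<Rightarrow> 'i \<Rightarrow> 'u" and e'
      assume M: "M \<in> MM" and g: "good_env L M e" "good_env L M e'"
        and m: "\<And>s i. \<lbrakk>s \<in> sorts L; i \<in> I\<rbrakk> \<Longrightarrow> e' s (f i) = e s i"
      have graph: "sat M e'' (G s j) \<longleftrightarrow> e'' s (h j) = F s j M e"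
        if off: "\<forall>s n. (s, n) \<notin> set vs \<longrightarrow> e'' s n = e' s n" and g'': "good_env L M e''"
          and sj: "s \<in> sorts L" "j \<in> J" for e'' s j
      proof -
        define E where "E = (\<lambda>s'. case_sum (e s') (\<lambda>_ :: unit. e'' s' (h j)))"
        have gE: "good_env L M E"
          using g(1) g'' by (auto simp: good_env_def E_def split: sum.splits)
        have "sat M e'' (G s j) = (E s (Inr ()) = F s j M (\<lambda>s i. E s (Inl i)))"
        proof (rule representsD[OF G[OF sj] M gE g''])
          fix s' i assume s': "s' \<in> sorts L" and i: "i \<in> I0 s j"
          show "e'' s' (case_sum f (\<lambda>_. h j) i) = E s' i"
          proof (cases i)
            case (Inl k)
            then have k: "k \<in> I" using i sub[OF sj] by simp
            have "(s', f k) \<notin> set vs" using ne[OF k] vs by auto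
            then show ?thesis using off m[OF s' k] Inl by (simp add: E_def)
          qed (simp add: E_def)
        qed
        then show ?thesis by (simp add: E_def)
      qed
      have main: "sat M e'' q = Q M (\<lambda>s j. F s j M e)"
        if g'': "good_env L M e''" and on: "\<forall>s\<in>sorts L. \<forall>j\<in>J. e'' s (h j) = F s j M e" for e''
        by (rule representsD[OF q M Fgood[OF M g(1)] g'']) (use on in blast)
      show "sat M e' ?p = Q M (\<lambda>s j. F s j M e)"
      proof
        assume "sat M e' ?p"
        then obtain e'' where e'': "\<forall>s n. (s, n) \<notin> set vs \<longrightarrow> e'' s n = e' s n"
          "\<forall>(s, n)\<in>set vs. e'' s n \<in> univ M s" "\<forall>p\<in>set (map (\<lambda>(s, j). G s j) vl). sat M e'' p"
          "sat M e'' q"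
          unfolding sat_exs sat_conjs by (elim exE conjE)
        have g'': "good_env L M e''" unfolding good_env_def
        proof (intro ballI allI)
          fix s n assume "s \<in> sorts L"
          then show "e'' s n \<in> univ M s"
            using e''(1,2) g(2) by (cases "(s, n) \<in> set vs") (auto simp: good_env_def)
        qed
        have "\<forall>s\<in>sorts L. \<forall>j\<in>J. sat M e'' (G s j)" using e''(3) vl by auto
        then have "\<forall>s\<in>sorts L. \<forall>j\<in>J. e'' s (h j) = F s j M e" using graph[OF e''(1) g''] by blast
        then show "Q M (\<lambda>s j. F s j M e)" using main[OF g''] e''(4) by blast
      next
        assume Q: "Q M (\<lambda>s j. F s j M e)"
        define e'' where
          "e'' = (\<lambda>s n. if s \<in> sorts L \<and> n \<in> h ` J then F s (inv_into J h n) M e else e' s n)"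
        have off: "\<forall>s n. (s, n) \<notin> set vs \<longrightarrow> e'' s n = e' s n"
          by (simp add: e''_def vs)
        have on: "\<forall>s\<in>sorts L. \<forall>j\<in>J. e'' s (h j) = F s j M e"
          using h(1) by (simp add: e''_def)
        have g'': "good_env L M e''"
          using Fgood[OF M g(1)] g(2) by (simp add: good_env_def e''_def)
        have "\<forall>p\<in>set (map (\<lambda>(s, j). G s j) vl). sat M e'' p"
          using graph[OF off g''] on vl by auto
        moreover have "sat M e'' q" using main[OF g'' on] Q by blast
        moreover have "\<forall>(s, n)\<in>set vs. e'' s n \<in> univ M s"
          using g'' vs by (auto simp: good_env_def)
        ultimately show "sat M e' ?p"
          unfolding sat_exs sat_conjs using off by (intro exI[of _ e''] conjI)
      qed
    qed
    then show "\<exists>p. represents L MM I f p (\<lambda>M e. Q M (\<lambda>s j. F s j M e))" by (rule exI)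
  qed
qed

section \<open>Atomic relations and definable functions\<close>

lemma definable_eq_var:
  fixes MM :: "('s, 'f, 'r, 'u) struct set"
  assumes "s \<in> sorts L"
  shows "definable L MM (\<lambda>M (e :: 's \<Rightarrow> 'i \<Rightarrow> 'u). e s i = e s j)"
proof (rule definableI[of "{i, j}"])
  fix f :: "'i \<Rightarrow> nat" assume "inj_on f {i, j}"
  have "represents L MM {i, j} f (Equal (Var s (f i)) (Var s (f j))) (\<lambda>M e. e s i = e s j)"
    using assms by (simp add: represents_def)
  then show "\<exists>p. represents L MM {i, j} f p (\<lambda>M e. e s i = e s j)" by (rule exI)
qed simp

lemma definable_rel_var:
  fixes MM :: "('s, 'f, 'r, 'u) struct set"
  assumes "r \<in> rels L" "rel_args L r = [s, t]" "s \<in> sorts L" "t \<in> sorts L"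
  shows "definable L MM (\<lambda>M (e :: 's \<Rightarrow> 'i \<Rightarrow> 'u). rel_in M r [e s i, e t j])"
proof (rule definableI[of "{i, j}"])
  fix f :: "'i \<Rightarrow> nat" assume "inj_on f {i, j}"
  have "represents L MM {i, j} f (Atom r [Var s (f i), Var t (f j)]) (\<lambda>M e. rel_in M r [e s i, e t j])"
    using assms by (simp add: represents_def)
  then show "\<exists>p. represents L MM {i, j} f p (\<lambda>M e. rel_in M r [e s i, e t j])" by (rule exI)
qed simp

lemma definable_app_var:
  fixes MM :: "('s, 'f, 'r, 'u) struct set" and ix :: "nat \<Rightarrow> 'i"
  assumes "g \<in> funs L" "fun_sort L g \<in> sorts L" "set (fun_args L g) \<subseteq> sorts L"
  shows "definable L MM (\<lambda>M (e :: 's \<Rightarrow> 'i \<Rightarrow> 'u).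
    e (fun_sort L g) i =
      fun_in M g (map (\<lambda>k. e (fun_args L g ! k) (ix k)) [0..<length (fun_args L g)]))"
    (is "definable L MM ?Q")
proof (rule definableI[of "insert i (ix ` {..<length (fun_args L g)})"])
  let ?I = "insert i (ix ` {..<length (fun_args L g)})"
  fix f :: "'i \<Rightarrow> nat" assume "inj_on f ?I"
  let ?p = "Equal (Var (fun_sort L g) (f i))
     (App g (map (\<lambda>k. Var (fun_args L g ! k) (f (ix k))) [0..<length (fun_args L g)]))"
  have "wf_form L ?p" using assms by (auto simp: o_def map_nth)
  moreover have "sat M e' ?p = ?Q M e" if "\<And>s i. \<lbrakk>s \<in> sorts L; i \<in> ?I\<rbrakk> \<Longrightarrow> e' s (f i) = e s i"
    for M e e'
  proof -
    have "e' (fun_args L g ! k) (f (ix k)) = e (fun_args L g ! k) (ix k)"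
      if "k < length (fun_args L g)" for k
    proof -
      have "fun_args L g ! k \<in> sorts L" using assms(3) that nth_mem by blast
      then show ?thesis using \<open>\<And>s i. \<lbrakk>s \<in> sorts L; i \<in> ?I\<rbrakk> \<Longrightarrow> e' s (f i) = e s i\<close> that by auto
    qed
    then have "map (trm_val M e') (map (\<lambda>k. Var (fun_args L g ! k) (f (ix k))) [0..<length (fun_args L g)]) =
       map (\<lambda>k. e (fun_args L g ! k) (ix k)) [0..<length (fun_args L g)]" by simp
    then show ?thesis using that[OF assms(2), of i] by (simp only: sat.simps trm_val.simps) simp
  qed
  ultimately have "represents L MM ?I f ?p ?Q" by (rule representsI)
  then show "\<exists>p. represents L MM ?I f p ?Q" by (rule exI)
qed simp

lemma definable_fun_var:
  fixes MM :: "('s, 'f, 'r, 'u) struct set"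
  assumes "s \<in> sorts L"
  shows "definable_fun L MM s (\<lambda>M (e :: 's \<Rightarrow> 'i \<Rightarrow> 'u). e s i)"
  using assms definable_eq_var[OF assms] by (simp add: definable_fun_def good_env_def)

lemma definable_rename:
  fixes Q :: "('s, 'f, 'r, 'u) struct \<Rightarrow> ('s \<Rightarrow> 'j \<Rightarrow> 'u) \<Rightarrow> bool" and r :: "'j \<Rightarrow> 'i"
  assumes "definable L MM Q" "finite (sorts L)"
  shows "definable L MM (\<lambda>M e. Q M (\<lambda>s j. e s (r j)))"
  using definable_subst[OF assms, of "\<lambda>s j M e. e s (r j)", OF definable_fun_var] .

lemma definable_fun_closed:
  "\<lbrakk>definable_fun L MM s F; M \<in> MM; good_env L M e\<rbrakk> \<Longrightarrow> F M e \<in> univ M s"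
  by (simp add: definable_fun_def)

lemma definable_fun_sort: "definable_fun L MM s F \<Longrightarrow> s \<in> sorts L"
  by (simp add: definable_fun_def)

lemma good_env_comp: "good_env L M e \<Longrightarrow> good_env L M (\<lambda>s j. e s (r j))"
  by (simp add: good_env_def)

lemma definable_fun_rename:
  fixes F :: "('s, 'f, 'r, 'u) struct \<Rightarrow> ('s \<Rightarrow> 'j \<Rightarrow> 'u) \<Rightarrow> 'u" and r :: "'j \<Rightarrow> 'i"
  assumes "definable_fun L MM s F" "finite (sorts L)"
  shows "definable_fun L MM s (\<lambda>M e. F M (\<lambda>s j. e s (r j)))"
proof -
  have "definable L MM (\<lambda>M (e :: 's \<Rightarrow> 'i + unit \<Rightarrow> 'u).
      e s (map_sum r (\<lambda>x. x) (Inr ())) = F M (\<lambda>s i. e s (map_sum r (\<lambda>x. x) (Inl i))))"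
    using assms(1) definable_rename[OF _ assms(2), where r = "map_sum r (\<lambda>x. x)"]
    unfolding definable_fun_def by fast
  then show ?thesis using assms(1) by (simp add: definable_fun_def good_env_comp)
qed

lemma definable_eq:
  fixes F G :: "('s, 'f, 'r, 'u) struct \<Rightarrow> ('s \<Rightarrow> 'i \<Rightarrow> 'u) \<Rightarrow> 'u"
  assumes "finite (sorts L)" "definable_fun L MM s F" "definable_fun L MM s G"
  shows "definable L MM (\<lambda>M e. F M e = G M e)"
proof -
  \<comment> \<open>An environment has a value in every sort; in the sorts other than
    \<open>s\<close> any variable will do.\<close>
  let ?T = "\<lambda>s' j M e. if s' = s then (if j then F M e else G M e) else e s' undefined"
  have "definable_fun L MM s' (?T s' j)" if "s' \<in> sorts L" for s' j
    using assms(2,3) definable_fun_var[OF that] by (cases "s' = s"; cases j) simp_all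
  from definable_subst[OF definable_eq_var[OF definable_fun_sort[OF assms(2)], of MM True False] assms(1), of ?T, OF this]
  show ?thesis by simp
qed

lemma definable_rel:
  fixes F G :: "('s, 'f, 'r, 'u) struct \<Rightarrow> ('s \<Rightarrow> 'i \<Rightarrow> 'u) \<Rightarrow> 'u"
  assumes "finite (sorts L)" "definable_fun L MM s F" "definable_fun L MM s G"
    "r \<in> rels L" "rel_args L r = [s, s]"
  shows "definable L MM (\<lambda>M e. rel_in M r [F M e, G M e])"
proof -
  let ?T = "\<lambda>s' j M e. if s' = s then (if j then F M e else G M e) else e s' undefined"
  have "definable_fun L MM s' (?T s' j)" if "s' \<in> sorts L" for s' j
    using assms(2,3) definable_fun_var[OF that] by (cases "s' = s"; cases j) simp_all
  moreover have s: "s \<in> sorts L" by (rule definable_fun_sort[OF assms(2)])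
  ultimately show ?thesis
    using definable_subst[OF definable_rel_var[OF assms(4,5) s s, of MM True False] assms(1), of ?T]
    by simp
qed

lemma definable_fun_app:
  fixes MM :: "('s, 'f, 'r, 'u) struct set"
    and Fs :: "(('s, 'f, 'r, 'u) struct \<Rightarrow> ('s \<Rightarrow> 'i \<Rightarrow> 'u) \<Rightarrow> 'u) list"
  assumes fin: "finite (sorts L)" and g: "g \<in> funs L" "fun_sort L g \<in> sorts L"
    and st: "\<And>M. M \<in> MM \<Longrightarrow> is_structure L M"
    and Fs: "list_all2 (definable_fun L MM) (fun_args L g) Fs"
  shows "definable_fun L MM (fun_sort L g) (\<lambda>M e. fun_in M g (map (\<lambda>F. F M e) Fs))"
  unfolding definable_fun_def
proof (intro conjI ballI allI impI g)
  fix M and e :: "'s \<Rightarrow> 'i \<Rightarrow> 'u"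
  assume "M \<in> MM" "good_env L M e"
  then have "map (\<lambda>F. F M e) Fs \<in> args_in M (fun_args L g)"
    using Fs by (auto simp: args_in_def list_all2_conv_all_nth definable_fun_def)
  then show "fun_in M g (map (\<lambda>F. F M e) Fs) \<in> univ M (fun_sort L g)"
    using st[OF \<open>M \<in> MM\<close>] g by (auto simp: is_structure_def)
next
  let ?n = "length (fun_args L g)"
  have len: "length Fs = ?n" using Fs by (simp add: list_all2_lengthD)
  have Fk: "definable_fun L MM (fun_args L g ! k) (Fs ! k)" if "k < ?n" for k
    using Fs that by (simp add: list_all2_conv_all_nth)
  have sub: "set (fun_args L g) \<subseteq> sorts L"
    using Fk definable_fun_sort by (metis in_set_conv_nth subsetI)
  \<comment> \<open>Index 0 carries the value and \<open>Suc k\<close> the k-th argument. At a sort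
    that does not belong to the index the entry is a placeholder that is never read.\<close>
  define T where "T = (\<lambda>s j M (e :: 's \<Rightarrow> 'i + unit \<Rightarrow> 'u).
    case j of Suc k \<Rightarrow> if k < ?n \<and> s = fun_args L g ! k then (Fs ! k) M (\<lambda>s i. e s (Inl i))
        else e s (Inr ())
      | 0 \<Rightarrow> e s (Inr ()))"
  have "definable_fun L MM s (T s j)" if s: "s \<in> sorts L" for s j
  proof (cases "\<exists>k. j = Suc k \<and> k < ?n \<and> s = fun_args L g ! k")
    case True
    then obtain k where k: "j = Suc k" "k < ?n" "s = fun_args L g ! k" by blast
    have "T s j = (\<lambda>M e. (Fs ! k) M (\<lambda>s i. e s (Inl i)))"
      using k by (simp add: T_def)
    then show ?thesis using definable_fun_rename[OF Fk[OF k(2)] fin, where r = Inl] k(3) by simp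
  next
    case False
    then have "T s j = (\<lambda>M e. e s (Inr ()))"
      by (intro ext) (auto simp: T_def split: nat.splits)
    then show ?thesis using definable_fun_var[OF s] by simp
  qed
  from definable_subst[OF definable_app_var[OF g sub, of MM 0 Suc] fin this]
  have "definable L MM (\<lambda>M (e :: 's \<Rightarrow> 'i + unit \<Rightarrow> 'u).
    T (fun_sort L g) 0 M e =
      fun_in M g (map (\<lambda>k. T (fun_args L g ! k) (Suc k) M e) [0..<?n]))" .
  moreover have "map (\<lambda>k. T (fun_args L g ! k) (Suc k) M e) [0..<?n] =
    map (\<lambda>F. F M (\<lambda>s i. e s (Inl i))) Fs" for M e
    by (rule nth_equalityI) (simp_all add: len T_def)
  ultimately show "definable L MM (\<lambda>M (e :: 's \<Rightarrow> 'i + unit \<Rightarrow> 'u). e (fun_sort L g) (Inr ()) =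
      fun_in M g (map (\<lambda>F. F M (\<lambda>s i. e s (Inl i))) Fs))"
    by (simp add: T_def)
qed

lemma definable_fun_if:
  fixes F G :: "('s, 'f, 'r, 'u) struct \<Rightarrow> ('s \<Rightarrow> 'i \<Rightarrow> 'u) \<Rightarrow> 'u"
  assumes "finite (sorts L)" "definable L MM Q" "definable_fun L MM s F" "definable_fun L MM s G"
  shows "definable_fun L MM s (\<lambda>M e. if Q M e then F M e else G M e)"
proof -
  let ?r = "\<lambda>e :: 's \<Rightarrow> 'i + unit \<Rightarrow> 'u. \<lambda>s i. e s (Inl i)"
  have "definable L MM (\<lambda>M (e :: 's \<Rightarrow> 'i + unit \<Rightarrow> 'u). Q M (?r e) \<and> e s (Inr ()) = F M (?r e) \<or>
      \<not> Q M (?r e) \<and> e s (Inr ()) = G M (?r e))"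
    using assms(3,4) definable_rename[OF assms(2,1), where r = Inl]
    by (intro definable_disj definable_conj definable_not) (simp_all add: definable_fun_def)
  then have "definable L MM (\<lambda>M (e :: 's \<Rightarrow> 'i + unit \<Rightarrow> 'u). e s (Inr ()) =
      (if Q M (?r e) then F M (?r e) else G M (?r e)))"
    by (rule definable_cong) auto
  then show ?thesis using assms(3,4) by (simp add: definable_fun_def)
qed

lemma definable_bex_univ:
  fixes R :: "('s, 'f, 'r, 'u) struct \<Rightarrow> 'u \<Rightarrow> ('s \<Rightarrow> 'i \<Rightarrow> 'u) \<Rightarrow> bool"
  assumes "definable L MM (\<lambda>M (e :: 's \<Rightarrow> 'i + unit \<Rightarrow> 'u). R M (e s (Inr ())) (\<lambda>s i. e s (Inl i)))"
    and "s \<in> sorts L"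
  shows "definable L MM (\<lambda>M e. \<exists>x\<in>univ M s. R M x e)"
proof -
  have "definable L MM (\<lambda>M e. \<exists>c. (\<forall>j :: unit. c j \<in> univ M s) \<and> R M (c ()) e)"
    using definable_ex[where R = "\<lambda>M (c :: unit \<Rightarrow> 'u) e. R M (c ()) e", OF assms] .
  then show ?thesis
  proof (rule definable_cong)
    fix M and e :: "'s \<Rightarrow> 'i \<Rightarrow> 'u"
    show "(\<exists>c. (\<forall>j :: unit. c j \<in> univ M s) \<and> R M (c ()) e) = (\<exists>x\<in>univ M s. R M x e)"
    proof
      assume "\<exists>c. (\<forall>j :: unit. c j \<in> univ M s) \<and> R M (c ()) e"
      then obtain c where c: "\<forall>j :: unit. c j \<in> univ M s" "R M (c ()) e" by (elim exE conjE)
      then show "\<exists>x\<in>univ M s. R M x e" by (intro bexI[of _ "c ()"]) simp_all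
    next
      assume "\<exists>x\<in>univ M s. R M x e"
      then obtain x where "x \<in> univ M s" "R M x e" by (elim bexE)
      then show "\<exists>c. (\<forall>j :: unit. c j \<in> univ M s) \<and> R M (c ()) e"
        by (intro exI[of _ "\<lambda>_. x"]) simp
    qed
  qed
qed

lemma definable_fun_cong:
  assumes "definable_fun L MM s F" "\<And>M e. \<lbrakk>M \<in> MM; good_env L M e\<rbrakk> \<Longrightarrow> F M e = G M e"
  shows "definable_fun L MM s G"
proof -
  have "definable L MM (\<lambda>M e. e s (Inr ()) = G M (\<lambda>s i. e s (Inl i)))"
    using assms(1) unfolding definable_fun_def
    by (elim conjE definable_cong) (simp add: assms(2) good_env_comp)
  then show ?thesis using assms by (simp add: definable_fun_def)
qed

lemma finite_vsorts: "finite (A :: vsort set)"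
proof (rule finite_subset)
  show "A \<subseteq> {VecS, FieldS, GamS, SkelS}" using vsort.exhaust by blast
qed simp

lemma definable_fun_app1:
  fixes L :: "(vsort, 'f, 'r) language"
  assumes "g \<in> funs L" "fun_args L g = [a]" "fun_sort L g = s" "s \<in> sorts L"
    "\<And>M. M \<in> MM \<Longrightarrow> is_structure L M" "definable_fun L MM a F"
  shows "definable_fun L MM s (\<lambda>M e. fun_in M g [F M e])"
  using definable_fun_app[of L g MM "[F]"] assms finite_vsorts by auto

lemma definable_fun_app2:
  fixes L :: "(vsort, 'f, 'r) language"
  assumes "g \<in> funs L" "fun_args L g = [a, b]" "fun_sort L g = s" "s \<in> sorts L"
    "\<And>M. M \<in> MM \<Longrightarrow> is_structure L M" "definable_fun L MM a F" "definable_fun L MM b G"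
  shows "definable_fun L MM s (\<lambda>M e. fun_in M g [F M e, G M e])"
  using definable_fun_app[of L g MM "[F, G]"] assms finite_vsorts by auto

lemma definable_fun_app0:
  fixes L :: "(vsort, 'f, 'r) language"
  assumes "g \<in> funs L" "fun_args L g = []" "fun_sort L g = s" "s \<in> sorts L"
    "\<And>M. M \<in> MM \<Longrightarrow> is_structure L M"
  shows "definable_fun L MM s (\<lambda>M e. fun_in M g [])"
  using definable_fun_app[of L g MM "[]"] assms finite_vsorts by auto

section \<open>Elementary substructures and sublanguages\<close>

lemma elementary_definable:
  fixes Q :: "('s, 'f, 'r, 'u) struct \<Rightarrow> ('s \<Rightarrow> 'i \<Rightarrow> 'u) \<Rightarrow> bool"
  assumes "elementary_substructure L V W" "definable L MM Q" "V \<in> MM" "W \<in> MM" "good_env L V e"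
  shows "Q V e = Q W e"
proof -
  obtain I where I: "finite I" and H: "\<And>f. inj_on f I \<Longrightarrow> \<exists>p. represents L MM I f p Q"
    by (rule definableE[OF assms(2)]) (rule that)
  obtain f :: "'i \<Rightarrow> nat" where f: "inj_on f I"
    using finite_imp_inj_to_nat_seg[OF I] by auto
  obtain p where p: "represents L MM I f p Q"
    using H[OF f] by (rule exE)
  let ?e = "\<lambda>s n. e s (inv_into I f n)"
  have sub: "good_env L V e \<Longrightarrow> good_env L W e" for e :: "'s \<Rightarrow> 'k \<Rightarrow> 'u"
    using assms(1) unfolding elementary_substructure_def substructure_def good_env_def by blast
  have gV: "good_env L V ?e" using good_env_comp[OF assms(5)] .
  have gW: "good_env L W e" "good_env L W ?e"
    using assms(1,5) unfolding elementary_substructure_def substructure_def good_env_def by blast+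
  \<comment> \<open>One formula represents \<open>Q\<close> in both models, so elementarity applies
    to it; \<open>?e\<close> carries the values from the abstract indices to the variables.\<close>
  have "Q V e = sat V ?e p"
    by (rule representsD[OF p assms(3) assms(5) gV, symmetric]) (simp add: f)
  also have "\<dots> = sat W ?e p"
    using assms(1) represents_wf[OF p] gV by (simp add: elementary_substructure_def good_env_def)
  also have "\<dots> = Q W e"
    by (rule representsD[OF p assms(4) gW]) (simp add: f)
  finally show ?thesis .
qed

lemma trm_val_cong:
  assumes "wf_trm L t" "\<And>s. s \<in> sorts L \<Longrightarrow> e s = e' s"
  shows "trm_val M e t = trm_val M e' t"
  using assms(1)
proof (induction t)
  case (App g ts)
  then have "map (trm_val M e) ts = map (trm_val M e') ts" by simp
  then show ?case by (simp only: trm_val.simps)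
qed (simp add: assms(2))

lemma sat_cong:
  assumes "wf_form L p" "\<And>s. s \<in> sorts L \<Longrightarrow> e s = e' s"
  shows "sat M e p = sat M e' p"
  using assms
proof (induction p arbitrary: e e')
  case (Equal t u)
  then show ?case using trm_val_cong[of L t e e' M] trm_val_cong[of L u e e' M] by simp
next
  case (Atom r ts)
  then have "map (trm_val M e) ts = map (trm_val M e') ts"
    using trm_val_cong[of L _ e e' M] by simp
  then show ?case by (simp only: sat.simps)
next
  case (Neg p) then show ?case by (metis sat.simps(3) wf_form.simps(3))
next
  case (Conj p q) then show ?case by (metis sat.simps(4) wf_form.simps(4))
next
  case (Exists s n p)
  have "sat M (e(s := (e s)(n := x))) p = sat M (e'(s := (e' s)(n := x))) p" for x
    using Exists.prems by (intro Exists.IH) auto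
  then show ?case by simp
qed

lemma substructure_trm_val:
  assumes "substructure L V W" "wf_trm L t" "good_env L V e"
    and "\<And>f. f \<in> funs L \<Longrightarrow> set (fun_args L f) \<subseteq> sorts L"
  shows "trm_val V e t = trm_val W e t \<and> trm_val V e t \<in> univ V (sort_of L t)"
  using assms(2)
proof (induction t)
  case (Var s n)
  then show ?case using assms(3) by (simp add: good_env_def)
next
  case (App f ts)
  have eq: "map (trm_val V e) ts = map (trm_val W e) ts" using App by simp
  have "map (trm_val V e) ts \<in> args_in V (fun_args L f)"
  proof -
    have "fun_args L f = map (sort_of L) ts" using App.prems by simp
    then show ?thesis using App
      by (auto simp: args_in_def list.rel_map intro!: list.rel_refl_strong)
  qed
  then have "fun_in V f (map (trm_val V e) ts) = fun_in W f (map (trm_val V e) ts)"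
    "fun_in V f (map (trm_val V e) ts) \<in> univ V (fun_sort L f)"
    using assms(1) App.prems by (auto simp: substructure_def is_structure_def)
  then show ?case using eq by (simp only: trm_val.simps sort_of.simps)
qed

lemma is_structure_mono:
  assumes "is_structure L M" "sorts L' \<subseteq> sorts L" "funs L' \<subseteq> funs L" "fun_args L' = fun_args L"
    "fun_sort L' = fun_sort L"
  shows "is_structure L' M"
  using assms unfolding is_structure_def by auto

lemma wf_trm_mono:
  assumes "sorts L' \<subseteq> sorts L" "funs L' \<subseteq> funs L" "fun_args L' = fun_args L"
    "fun_sort L' = fun_sort L"
  shows "sort_of L' t = sort_of L t" "wf_trm L' t \<Longrightarrow> wf_trm L t"
proof -
  show so: "sort_of L' t = sort_of L t" for t using assms(4) by (cases t) simp_all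
  then have "sort_of L' = sort_of L" by (rule ext)
  then show "wf_trm L' t \<Longrightarrow> wf_trm L t"
    by (induction t) (use assms in auto)
qed

lemma wf_form_mono:
  assumes "sorts L' \<subseteq> sorts L" "funs L' \<subseteq> funs L" "rels L' \<subseteq> rels L" "fun_args L' = fun_args L"
    "fun_sort L' = fun_sort L" "rel_args L' = rel_args L"
  shows "wf_form L' p \<Longrightarrow> wf_form L p"
proof (induction p)
  case (Atom r ts)
  have "sort_of L' = sort_of L" using wf_trm_mono(1)[OF assms(1,2,4,5)] by (rule ext)
  then show ?case using Atom wf_trm_mono(2)[OF assms(1,2,4,5)] assms(3,6) by auto
qed (use wf_trm_mono[OF assms(1,2,4,5)] assms in auto)

lemma elementary_sublanguage:
  assumes el: "elementary_substructure L V W"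
    and sub: "sorts L' \<subseteq> sorts L" "funs L' \<subseteq> funs L" "rels L' \<subseteq> rels L" "fun_args L' = fun_args L"
      "fun_sort L' = fun_sort L" "rel_args L' = rel_args L"
  shows "elementary_substructure L' V W"
  unfolding elementary_substructure_def
proof (intro conjI allI impI)
  have "substructure L V W" using el by (simp add: elementary_substructure_def)
  then show "substructure L' V W"
    using sub is_structure_mono[OF _ sub(1,2,4,5)] unfolding substructure_def
    by (auto simp: subset_iff)
  fix p and e :: "'a \<Rightarrow> nat \<Rightarrow> 'd"
  assume p: "wf_form L' p" and e: "\<forall>s\<in>sorts L'. \<forall>n. e s n \<in> univ V s"
  have "\<forall>s\<in>sorts L. \<exists>x. x \<in> univ V s"
    using \<open>substructure L V W\<close> by (auto simp: substructure_def is_structure_def)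
  then obtain d where d: "\<forall>s\<in>sorts L. d s \<in> univ V s" by metis
  \<comment> \<open>An environment for the smaller language is unconstrained in the missing sorts
    and has to be repaired there before elementarity in \<open>L\<close> applies.\<close>
  define e' where "e' = (\<lambda>s. if s \<in> sorts L' then e s else (\<lambda>_. d s))"
  have "sat V e' p = sat W e' p"
    using el wf_form_mono[OF sub p] e d by (simp add: elementary_substructure_def e'_def)
  moreover have "sat M e' p = sat M e p" for M
    by (rule sat_cong[OF p]) (simp add: e'_def)
  ultimately show "sat V e p = sat W e p" by simp
qed

section \<open>Bounding the variables of a formula\<close>

fun trm_bound :: "('s, 'f) trm \<Rightarrow> nat" where
  "trm_bound (Var s n) = Suc n"
| "trm_bound (App f ts) = sum_list (map trm_bound ts)"

text \<open>Any strict bound for the variable numbers will do, so sums replace maxima and bound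
  variables are counted as well. It makes an infinite environment of vectors effectively
  finite.\<close>

fun form_bound :: "('s, 'f, 'r) form \<Rightarrow> nat" where
  "form_bound (Equal t u) = trm_bound t + trm_bound u"
| "form_bound (Atom r ts) = sum_list (map trm_bound ts)"
| "form_bound (Neg p) = form_bound p"
| "form_bound (Conj p q) = form_bound p + form_bound q"
| "form_bound (Exists s n p) = form_bound p"

lemma trm_val_bound:
  assumes "\<And>s n. n < trm_bound t \<Longrightarrow> e s n = e' s n"
  shows "trm_val M e t = trm_val M e' t"
  using assms
proof (induction t)
  case (App f ts)
  have "trm_val M e t = trm_val M e' t" if t: "t \<in> set ts" for t
  proof (rule App.IH[OF t])
    fix s n assume "n < trm_bound t"
    then show "e s n = e' s n"
      using member_le_sum_list[of "trm_bound t" "map trm_bound ts"] t by (intro App.prems) simp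
  qed
  then have "map (trm_val M e) ts = map (trm_val M e') ts" by simp
  then show ?case by (simp only: trm_val.simps)
qed simp

lemma sat_bound:
  assumes "\<And>s n. n < form_bound p \<Longrightarrow> e s n = e' s n"
  shows "sat M e p = sat M e' p"
  using assms
proof (induction p arbitrary: e e')
  case (Equal t u)
  then show ?case using trm_val_bound[of t e e' M] trm_val_bound[of u e e' M] by simp
next
  case (Atom r ts)
  have "trm_val M e t = trm_val M e' t" if t: "t \<in> set ts" for t
  proof (rule trm_val_bound)
    fix s n assume "n < trm_bound t"
    then show "e s n = e' s n"
      using member_le_sum_list[of "trm_bound t" "map trm_bound ts"] t by (intro Atom.prems) simp
  qed
  then have "map (trm_val M e) ts = map (trm_val M e') ts" by simp
  then show ?case by (simp only: sat.simps)
next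
  case (Neg p)
  have "sat M e p = sat M e' p" by (rule Neg.IH) (simp add: Neg.prems)
  then show ?case by simp
next
  case (Conj p q)
  have "sat M e p = sat M e' p" by (rule Conj.IH(1)) (simp add: Conj.prems)
  moreover have "sat M e q = sat M e' q" by (rule Conj.IH(2)) (simp add: Conj.prems)
  ultimately show ?case by simp
next
  case (Exists s m p)
  have "sat M (e(s := (e s)(m := x))) p = sat M (e'(s := (e' s)(m := x))) p" for x
    by (rule Exists.IH) (simp add: Exists.prems)
  then show ?case by simp
qed

section \<open>Skeletons\<close>

text \<open>A view without syntax, shared by the standard structures and the models of both
  languages, so that the algebra is carried out once. The valuation is absent because it is
  \<open>sval\<close> after \<open>sproj\<close>.\<close>

record ('k, 'v, 'g, 's) skel_ops =
  sfield :: "'k ring"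
  svecs :: "('k, 'v) module"
  sgam :: "'g set"
  sskel :: "'s set"
  sless :: "'g \<Rightarrow> 'g \<Rightarrow> bool"
  sadd :: "'s \<Rightarrow> 's \<Rightarrow> 's"
  szero :: 's
  sscal :: "'k \<Rightarrow> 's \<Rightarrow> 's"
  sval :: "'s \<Rightarrow> 'g"
  sproj :: "'v \<Rightarrow> 's"

text \<open>Over every \<open>\<gamma> < \<infinity>\<close> the class \<open>(\<gamma>, 0 + V\<^sub>\<gamma>)\<close> is not a value of \<open>\<pi>\<close>; these classes are
  the idempotents of \<open>+\<^sub>\<bullet>\<close> other than \<open>\<zero>\<close>.\<close>

definition in_image :: "('k, 'v, 'g, 's) skel_ops \<Rightarrow> 's \<Rightarrow> bool" where
  "in_image S s \<longleftrightarrow> s = szero S \<or> sadd S s s \<noteq> s"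

text \<open>The value \<open>\<pi>(u + v)\<close> computed from \<open>\<pi>(u)\<close> and \<open>\<pi>(v)\<close>, correct as long as the leading terms
  do not cancel; cancellation shows in the result not being in the image of \<open>\<pi>\<close>.\<close>

definition sjoin :: "('k, 'v, 'g, 's) skel_ops \<Rightarrow> 's \<Rightarrow> 's \<Rightarrow> 's" where
  "sjoin S s t = (if sless S (sval S s) (sval S t) then s
     else if sless S (sval S t) (sval S s) then t else sadd S s t)"

text \<open>\<open>cancellation\<close> links geometry and skeleton: when the value of u + v jumps,
  the sum of the classes is the zero class over the old value, which \<open>in_image\<close>
  rejects. \<open>proj_image\<close> conversely provides a vector for every class that passes the
  test.\<close>

locale skel_space =
  field "sfield S" + module "sfield S" "svecs S" for S :: "('k, 'v, 'g, 's) skel_ops" +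
  assumes proj_closed: "v \<in> carrier (svecs S) \<Longrightarrow> sproj S v \<in> sskel S"
    and sval_closed: "s \<in> sskel S \<Longrightarrow> sval S s \<in> sgam S"
    and less_irrefl: "\<not> sless S g g"
    and less_trans: "sless S g h \<Longrightarrow> sless S h g' \<Longrightarrow> sless S g g'"
    and less_total: "g \<in> sgam S \<Longrightarrow> h \<in> sgam S \<Longrightarrow> sless S g h \<or> g = h \<or> sless S h g"
    and proj_eq_zero: "v \<in> carrier (svecs S) \<Longrightarrow> sproj S v = szero S \<longleftrightarrow> v = \<zero>\<^bsub>svecs S\<^esub>"
    and proj_add_less:
      "\<lbrakk>u \<in> carrier (svecs S); v \<in> carrier (svecs S);
        sless S (sval S (sproj S u)) (sval S (sproj S v))\<rbrakk> \<Longrightarrow>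
       sproj S (u \<oplus>\<^bsub>svecs S\<^esub> v) = sproj S u"
    and proj_add_eq:
      "\<lbrakk>u \<in> carrier (svecs S); v \<in> carrier (svecs S); sval S (sproj S u) = sval S (sproj S v);
        sval S (sproj S (u \<oplus>\<^bsub>svecs S\<^esub> v)) = sval S (sproj S u)\<rbrakk> \<Longrightarrow>
       sproj S (u \<oplus>\<^bsub>svecs S\<^esub> v) = sadd S (sproj S u) (sproj S v)"
    and cancellation:
      "\<lbrakk>u \<in> carrier (svecs S); v \<in> carrier (svecs S); sval S (sproj S u) = sval S (sproj S v);
        sval S (sproj S (u \<oplus>\<^bsub>svecs S\<^esub> v)) \<noteq> sval S (sproj S u)\<rbrakk> \<Longrightarrow>
       \<not> in_image S (sadd S (sproj S u) (sproj S v))"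
    and ultrametric:
      "\<lbrakk>u \<in> carrier (svecs S); v \<in> carrier (svecs S)\<rbrakk> \<Longrightarrow>
       \<not> (sless S (sval S (sproj S (u \<oplus>\<^bsub>svecs S\<^esub> v))) (sval S (sproj S u)) \<and>
          sless S (sval S (sproj S (u \<oplus>\<^bsub>svecs S\<^esub> v))) (sval S (sproj S v)))"
    and proj_smult:
      "\<lbrakk>k \<in> carrier (sfield S); k \<noteq> \<zero>\<^bsub>sfield S\<^esub>; v \<in> carrier (svecs S)\<rbrakk> \<Longrightarrow>
       sproj S (k \<odot>\<^bsub>svecs S\<^esub> v) = sscal S k (sproj S v)"
    and val_smult:
      "\<lbrakk>k \<in> carrier (sfield S); k \<noteq> \<zero>\<^bsub>sfield S\<^esub>; v \<in> carrier (svecs S)\<rbrakk> \<Longrightarrow>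
       sval S (sproj S (k \<odot>\<^bsub>svecs S\<^esub> v)) = sval S (sproj S v)"
    and proj_image: "sproj S ` carrier (svecs S) = {s \<in> sskel S. in_image S s}"

section \<open>Linear combinations and separated tuples\<close>

fun lin :: "('k, 'v) module \<Rightarrow> nat \<Rightarrow> (nat \<Rightarrow> 'k) \<Rightarrow> (nat \<Rightarrow> 'v) \<Rightarrow> 'v" where
  "lin U 0 c y = \<zero>\<^bsub>U\<^esub>"
| "lin U (Suc n) c y = lin U n c y \<oplus>\<^bsub>U\<^esub> c n \<odot>\<^bsub>U\<^esub> y n"

text \<open>Here \<open>k = 0\<close> needs a separate case: \<open>scal\<^sub>\<bullet>(0, (\<gamma>, v + V\<^sub>\<gamma>)) = (\<gamma>, 0 + V\<^sub>\<gamma>)\<close> is not \<open>\<pi>(0 v)\<close>.\<close>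

definition smul :: "('k, 'v, 'g, 's) skel_ops \<Rightarrow> 'k \<Rightarrow> 's \<Rightarrow> 's" where
  "smul S k s = (if k = \<zero>\<^bsub>sfield S\<^esub> then szero S else sscal S k s)"

text \<open>The skeleton counterpart of \<open>lin\<close>. It equals \<pi> of the linear
  combination as long as no partial sum cancels.\<close>

fun ssum :: "('k, 'v, 'g, 's) skel_ops \<Rightarrow> nat \<Rightarrow> (nat \<Rightarrow> 'k) \<Rightarrow> (nat \<Rightarrow> 's) \<Rightarrow> 's" where
  "ssum S 0 c \<sigma> = szero S"
| "ssum S (Suc n) c \<sigma> = sjoin S (ssum S n c \<sigma>) (smul S (c n) (\<sigma> n))"

text \<open>All partial sums are required, since \<open>ssum\<close> is evaluated step by step. Only
  classes and scalars occur, which makes the condition definable where scalars form a sort. Entries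
  of a tuple may be zero vectors, so separated tuples can be linearly dependent and coordinates need
  not be unique.\<close>

definition separated :: "('k, 'v, 'g, 's) skel_ops \<Rightarrow> nat \<Rightarrow> (nat \<Rightarrow> 's) \<Rightarrow> bool" where
  "separated S n \<sigma> \<longleftrightarrow>
     (\<forall>c. (\<forall>i. c i \<in> carrier (sfield S)) \<longrightarrow> (\<forall>m\<in>{..n}. in_image S (ssum S m c \<sigma>)))"

lemma ssum_cong: "(\<And>i. i < n \<Longrightarrow> \<sigma> i = \<tau> i) \<Longrightarrow> ssum S n c \<sigma> = ssum S n c \<tau>"
  by (induction n) simp_all

lemma lin_cong:
  "(\<And>i. i < n \<Longrightarrow> c i = d i) \<Longrightarrow> (\<And>i. i < n \<Longrightarrow> y i = z i) \<Longrightarrow> lin U n c y = lin U n d z"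
  by (induction n) simp_all

section \<open>Computing with \<pi>\<close>

context skel_space
begin

abbreviation "K \<equiv> sfield S"
abbreviation "U \<equiv> svecs S"
abbreviation "val v \<equiv> sval S (sproj S v)"

lemma val_closed: "v \<in> carrier U \<Longrightarrow> val v \<in> sgam S"
  by (simp add: proj_closed sval_closed)

lemma proj_in_image: "v \<in> carrier U \<Longrightarrow> in_image S (sproj S v)"
  using proj_image by blast

lemma less_asym: "sless S g h \<Longrightarrow> \<not> sless S h g"
  using less_irrefl less_trans by blast

lemma proj_add_less2:
  assumes "u \<in> carrier U" "v \<in> carrier U" "sless S (val v) (val u)"
  shows "sproj S (u \<oplus>\<^bsub>U\<^esub> v) = sproj S v"
  using proj_add_less[OF assms(2,1,3)] assms by (simp add: M.add.m_comm)

text \<open>For equal values the ultrametric inequality excludes a smaller value of u + v and the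
  hypothesis a larger one, so \<open>proj_add_eq\<close> applies; for different values the dominant
  term survives.\<close>

lemma sjoin_proj:
  assumes u: "u \<in> carrier U" and v: "v \<in> carrier U"
    and le: "\<not> (val u = val v \<and> sless S (val u) (val (u \<oplus>\<^bsub>U\<^esub> v)))"
  shows "sjoin S (sproj S u) (sproj S v) = sproj S (u \<oplus>\<^bsub>U\<^esub> v)"
proof -
  consider "val u = val v" | "sless S (val u) (val v)" | "sless S (val v) (val u)"
    using less_total[OF val_closed[OF u] val_closed[OF v]] by blast
  then show ?thesis
  proof cases
    case 1
    have "\<not> sless S (val (u \<oplus>\<^bsub>U\<^esub> v)) (val u)" using ultrametric[OF u v] 1 by metis
    moreover have "\<not> sless S (val u) (val (u \<oplus>\<^bsub>U\<^esub> v))" using le 1 by blast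
    moreover have uv: "u \<oplus>\<^bsub>U\<^esub> v \<in> carrier U" using u v by (rule M.add.m_closed)
    ultimately have "val (u \<oplus>\<^bsub>U\<^esub> v) = val u"
      using less_total[OF val_closed[OF uv] val_closed[OF u]] by metis
    from proj_add_eq[OF u v 1 this] show ?thesis by (simp add: sjoin_def 1 less_irrefl)
  next
    case 2
    then show ?thesis using proj_add_less[OF u v 2] by (simp add: sjoin_def)
  next
    case 3
    then show ?thesis using proj_add_less2[OF u v 3] less_asym[OF 3] by (simp add: sjoin_def)
  qed
qed

text \<open>Membership of the result in the image certifies that nothing cancelled, by
  \<open>cancellation\<close>. The second conclusion keeps the values of linear combinations within
  a finite set.\<close>

lemma sjoin_proj_image:
  assumes u: "u \<in> carrier U" and v: "v \<in> carrier U"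
    and im: "in_image S (sjoin S (sproj S u) (sproj S v))"
  shows "sjoin S (sproj S u) (sproj S v) = sproj S (u \<oplus>\<^bsub>U\<^esub> v)"
    and "val (u \<oplus>\<^bsub>U\<^esub> v) \<in> {val u, val v}"
proof -
  have eq: "val (u \<oplus>\<^bsub>U\<^esub> v) = val u" if e: "val u = val v"
  proof (rule ccontr)
    assume "val (u \<oplus>\<^bsub>U\<^esub> v) \<noteq> val u"
    from cancellation[OF u v e this] im show False by (simp add: sjoin_def e less_irrefl)
  qed
  then have "\<not> (val u = val v \<and> sless S (val u) (val (u \<oplus>\<^bsub>U\<^esub> v)))"
    using less_irrefl[of "val u"] by metis
  then show "sjoin S (sproj S u) (sproj S v) = sproj S (u \<oplus>\<^bsub>U\<^esub> v)"
    by (rule sjoin_proj[OF u v])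
  consider "val u = val v" | "sless S (val u) (val v)" | "sless S (val v) (val u)"
    using less_total[OF val_closed[OF u] val_closed[OF v]] by blast
  then show "val (u \<oplus>\<^bsub>U\<^esub> v) \<in> {val u, val v}"
    by cases (simp_all add: eq proj_add_less[OF u v] proj_add_less2[OF u v])
qed

lemma inverse_props:
  assumes "k \<in> carrier K" "k \<noteq> \<zero>\<^bsub>K\<^esub>"
  shows "inv\<^bsub>K\<^esub> k \<in> carrier K" "inv\<^bsub>K\<^esub> k \<noteq> \<zero>\<^bsub>K\<^esub>"
    "inv\<^bsub>K\<^esub> k \<otimes>\<^bsub>K\<^esub> k = \<one>\<^bsub>K\<^esub>" "k \<otimes>\<^bsub>K\<^esub> inv\<^bsub>K\<^esub> k = \<one>\<^bsub>K\<^esub>"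
proof -
  have u: "k \<in> Units K" using assms field_Units by simp
  then show *: "inv\<^bsub>K\<^esub> k \<in> carrier K" "inv\<^bsub>K\<^esub> k \<otimes>\<^bsub>K\<^esub> k = \<one>\<^bsub>K\<^esub>" "k \<otimes>\<^bsub>K\<^esub> inv\<^bsub>K\<^esub> k = \<one>\<^bsub>K\<^esub>"
    by simp_all
  show "inv\<^bsub>K\<^esub> k \<noteq> \<zero>\<^bsub>K\<^esub>"
  proof
    assume "inv\<^bsub>K\<^esub> k = \<zero>\<^bsub>K\<^esub>"
    then show False using *(2) assms(1) one_not_zero by simp
  qed
qed

lemma finite_max:
  assumes "finite B" "B \<noteq> {}"
  obtains b where "b \<in> B" "\<And>b'. b' \<in> B \<Longrightarrow> \<not> sless S b b'"
proof -
  have "asymp_on B (sless S)" "transp_on B (sless S)"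
    unfolding asymp_on_def transp_on_def using less_asym less_trans by blast+
  then obtain b where "b \<in> B" "\<forall>x\<in>B. x \<noteq> b \<longrightarrow> \<not> sless S b x"
    using Finite_Set.bex_max_element[OF assms(1) _ _ assms(2)] by blast
  moreover have "\<not> sless S b b'" if "b' \<in> B" for b'
    using that calculation(2) less_irrefl by (cases "b' = b") auto
  ultimately show ?thesis using that by blast
qed

text \<open>Take \<open>a\<close> with val(x - a) maximal. Then x - b = (x - a) + (a - b) has no
  larger value than x - a, so the two summands cannot cancel.\<close>

lemma best_approximation:
  assumes "finite A" "A \<noteq> {}" "A \<subseteq> carrier U" "x \<in> carrier U"
  obtains a where "a \<in> A"
    "\<And>b. b \<in> A \<Longrightarrow> sjoin S (sproj S (x \<ominus>\<^bsub>U\<^esub> a)) (sproj S (a \<ominus>\<^bsub>U\<^esub> b)) = sproj S (x \<ominus>\<^bsub>U\<^esub> b)"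
proof -
  obtain v where "v \<in> (\<lambda>a. val (x \<ominus>\<^bsub>U\<^esub> a)) ` A"
    "\<And>w. w \<in> (\<lambda>a. val (x \<ominus>\<^bsub>U\<^esub> a)) ` A \<Longrightarrow> \<not> sless S v w"
    using finite_max[of "(\<lambda>a. val (x \<ominus>\<^bsub>U\<^esub> a)) ` A"] assms by blast
  then obtain a where a: "a \<in> A" "\<And>b. b \<in> A \<Longrightarrow> \<not> sless S (val (x \<ominus>\<^bsub>U\<^esub> a)) (val (x \<ominus>\<^bsub>U\<^esub> b))"
    by blast
  show ?thesis
  proof (rule that[OF a(1)])
    fix b assume b: "b \<in> A"
    have c: "a \<in> carrier U" "b \<in> carrier U" using a(1) b assms(3) by auto
    have "(x \<ominus>\<^bsub>U\<^esub> a) \<oplus>\<^bsub>U\<^esub> (a \<ominus>\<^bsub>U\<^esub> b) = x \<ominus>\<^bsub>U\<^esub> b"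
      using c assms(4)
      by (simp add: M.minus_eq M.a_assoc M.r_neg2 M.r_neg1)
    then show "sjoin S (sproj S (x \<ominus>\<^bsub>U\<^esub> a)) (sproj S (a \<ominus>\<^bsub>U\<^esub> b)) = sproj S (x \<ominus>\<^bsub>U\<^esub> b)"
      using sjoin_proj[of "x \<ominus>\<^bsub>U\<^esub> a" "a \<ominus>\<^bsub>U\<^esub> b"] a(2)[OF b] c assms(4) by simp
  qed
qed

section \<open>Closest vectors in the span of a separated tuple\<close>

lemma lin_closed [simp]:
  "(\<And>i. c i \<in> carrier K) \<Longrightarrow> (\<And>i. y i \<in> carrier U) \<Longrightarrow> lin U n c y \<in> carrier U"
  by (induction n) simp_all

lemma lin_zero: "(\<And>i. y i \<in> carrier U) \<Longrightarrow> lin U n (\<lambda>_. \<zero>\<^bsub>K\<^esub>) y = \<zero>\<^bsub>U\<^esub>"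
  by (induction n) (simp_all add: smult_l_null)

lemma lin_add:
  assumes "\<And>i. c i \<in> carrier K" "\<And>i. d i \<in> carrier K" "\<And>i. y i \<in> carrier U"
  shows "lin U n (\<lambda>i. c i \<oplus>\<^bsub>K\<^esub> d i) y = lin U n c y \<oplus>\<^bsub>U\<^esub> lin U n d y"
  by (induction n) (simp_all add: assms smult_l_distr M.a_ac)

lemma lin_smult:
  assumes "k \<in> carrier K" "\<And>i. c i \<in> carrier K" "\<And>i. y i \<in> carrier U"
  shows "lin U n (\<lambda>i. k \<otimes>\<^bsub>K\<^esub> c i) y = k \<odot>\<^bsub>U\<^esub> lin U n c y"
  by (induction n) (simp_all add: assms smult_assoc1 smult_r_distr smult_r_null)

lemma lin_minus:
  assumes "\<And>i. c i \<in> carrier K" "\<And>i. y i \<in> carrier U"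
  shows "lin U n (\<lambda>i. \<ominus>\<^bsub>K\<^esub> c i) y = \<ominus>\<^bsub>U\<^esub> lin U n c y"
  by (induction n) (simp_all add: assms smult_l_minus M.minus_add M.minus_equality[of "\<zero>\<^bsub>U\<^esub>" "\<zero>\<^bsub>U\<^esub>"])

lemma minus_one_smult: "v \<in> carrier U \<Longrightarrow> (\<ominus>\<^bsub>K\<^esub> \<one>\<^bsub>K\<^esub>) \<odot>\<^bsub>U\<^esub> v = \<ominus>\<^bsub>U\<^esub> v"
  by (simp add: smult_l_minus)

lemma val_minus:
  assumes "v \<in> carrier U"
  shows "val (\<ominus>\<^bsub>U\<^esub> v) = val v"
proof -
  have "\<ominus>\<^bsub>K\<^esub> \<one>\<^bsub>K\<^esub> \<noteq> \<zero>\<^bsub>K\<^esub>"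
  proof
    assume "\<ominus>\<^bsub>K\<^esub> \<one>\<^bsub>K\<^esub> = \<zero>\<^bsub>K\<^esub>"
    then have "\<ominus>\<^bsub>K\<^esub> (\<ominus>\<^bsub>K\<^esub> \<one>\<^bsub>K\<^esub>) = \<ominus>\<^bsub>K\<^esub> \<zero>\<^bsub>K\<^esub>" by (rule arg_cong)
    then show False by simp
  qed
  then show ?thesis using val_smult[of "\<ominus>\<^bsub>K\<^esub> \<one>\<^bsub>K\<^esub>" v] assms by (simp add: minus_one_smult)
qed

lemma proj_zero: "sproj S \<zero>\<^bsub>U\<^esub> = szero S"
  by (simp add: proj_eq_zero)

lemma smul_proj:
  assumes "k \<in> carrier K" "v \<in> carrier U"
  shows "smul S k (sproj S v) = sproj S (k \<odot>\<^bsub>U\<^esub> v)"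
  using assms by (simp add: smul_def proj_smult smult_l_null proj_zero)

text \<open>Separatedness puts every partial sum in the image, so each step of the recursion is a
  sum without cancellation.\<close>

lemma ssum_proj:
  assumes "separated S n (\<lambda>i. sproj S (y i))" "\<And>i. c i \<in> carrier K" "\<And>i. y i \<in> carrier U" "m \<le> n"
  shows "ssum S m c (\<lambda>i. sproj S (y i)) = sproj S (lin U m c y)"
  using assms(4)
proof (induction m)
  case 0
  then show ?case by (simp add: proj_zero)
next
  case (Suc m)
  have "in_image S (ssum S (Suc m) c (\<lambda>i. sproj S (y i)))"
    using assms(1,2) Suc.prems unfolding separated_def by blast
  then show ?case using Suc assms(2,3) by (simp add: smul_proj sjoin_proj_image(1))
qed

text \<open>No step cancels, so each partial sum inherits the value of one of its two summands.
  Hence the span takes only finitely many values.\<close>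

lemma val_lin:
  assumes "separated S n (\<lambda>i. sproj S (y i))" "\<And>i. c i \<in> carrier K" "\<And>i. y i \<in> carrier U" "m \<le> n"
  shows "val (lin U m c y) \<in> insert (sval S (szero S)) ((\<lambda>i. val (y i)) ` {..<m})"
  using assms(4)
proof (induction m)
  case 0
  then show ?case by (simp add: proj_zero)
next
  case (Suc m)
  have "in_image S (ssum S (Suc m) c (\<lambda>i. sproj S (y i)))"
    using assms(1,2) Suc.prems unfolding separated_def by blast
  then have "in_image S (sjoin S (sproj S (lin U m c y)) (sproj S (c m \<odot>\<^bsub>U\<^esub> y m)))"
    using ssum_proj[OF assms(1-3), of m] Suc.prems assms(2,3) by (simp add: smul_proj)
  then have "val (lin U (Suc m) c y) \<in> {val (lin U m c y), val (c m \<odot>\<^bsub>U\<^esub> y m)}"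
    using sjoin_proj_image(2) assms(2,3) by simp
  moreover have "val (c m \<odot>\<^bsub>U\<^esub> y m) \<in> {sval S (szero S), val (y m)}"
    using assms(2,3) by (cases "c m = \<zero>\<^bsub>K\<^esub>") (simp_all add: val_smult smult_l_null proj_zero)
  ultimately show ?case using Suc by (auto simp: lessThan_Suc)
qed

text \<open>This stands in for completeness. If every approximation of \<open>x\<close> from the
  span could be improved, each val(x - k) would be the value of a difference of two vectors of the
  span, and by \<open>val_lin\<close> there are only finitely many such values. But then one of the
  val(x - k) is maximal.\<close>

lemma best_approximation_lin:
  assumes sep: "separated S n (\<lambda>i. sproj S (y i))" and y: "\<And>i. y i \<in> carrier U"
    and x: "x \<in> carrier U"
  obtains k where "\<forall>i. k i \<in> carrier K"
    "\<And>l. \<forall>i. l i \<in> carrier K \<Longrightarrow> \<not> sless S (val (x \<ominus>\<^bsub>U\<^esub> lin U n k y)) (val (x \<ominus>\<^bsub>U\<^esub> lin U n l y))"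
proof -
  define C where "C = {k :: nat \<Rightarrow> 'k. \<forall>i. k i \<in> carrier K}"
  define B where "B = (\<lambda>k. val (x \<ominus>\<^bsub>U\<^esub> lin U n k y)) ` C"
  have CK: "\<And>i. k i \<in> carrier K" if "k \<in> C" for k using that by (simp add: C_def)
  have "\<exists>b\<in>B. \<forall>b'\<in>B. \<not> sless S b b'"
  proof (rule ccontr)
    assume not: "\<not> ?thesis"
    have "B \<subseteq> insert (sval S (szero S)) ((\<lambda>i. val (y i)) ` {..<n})"
    proof
      fix b assume b: "b \<in> B"
      with not obtain b' where b': "b' \<in> B" "sless S b b'" by blast
      obtain k where k: "k \<in> C" "b = val (x \<ominus>\<^bsub>U\<^esub> lin U n k y)" using b by (auto simp: B_def)
      obtain l where l: "l \<in> C" "b' = val (x \<ominus>\<^bsub>U\<^esub> lin U n l y)" using b' by (auto simp: B_def)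
      let ?k = "lin U n k y" and ?l = "lin U n l y"
      have c: "?k \<in> carrier U" "?l \<in> carrier U" using CK[OF k(1)] CK[OF l(1)] y by auto
      \<comment> \<open>As x - l has a larger value than x - k, subtracting it does not affect
        \<pi>; so val(x - k) is the value of l - k.\<close>
      have "sproj S ((x \<ominus>\<^bsub>U\<^esub> ?k) \<oplus>\<^bsub>U\<^esub> (\<ominus>\<^bsub>U\<^esub> (x \<ominus>\<^bsub>U\<^esub> ?l))) = sproj S (x \<ominus>\<^bsub>U\<^esub> ?k)"
        using b'(2) c x k(2) l(2) by (intro proj_add_less) (simp_all add: val_minus)
      moreover have "(x \<ominus>\<^bsub>U\<^esub> ?k) \<oplus>\<^bsub>U\<^esub> (\<ominus>\<^bsub>U\<^esub> (x \<ominus>\<^bsub>U\<^esub> ?l)) = ?l \<ominus>\<^bsub>U\<^esub> ?k"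
      proof -
        have "(x \<ominus>\<^bsub>U\<^esub> ?k) \<oplus>\<^bsub>U\<^esub> (\<ominus>\<^bsub>U\<^esub> (x \<ominus>\<^bsub>U\<^esub> ?l)) =
            (x \<oplus>\<^bsub>U\<^esub> \<ominus>\<^bsub>U\<^esub> x) \<oplus>\<^bsub>U\<^esub> (?l \<ominus>\<^bsub>U\<^esub> ?k)"
          using c x by (simp add: M.minus_eq M.minus_add M.minus_minus M.a_ac)
        then show ?thesis using c x by (simp add: M.r_neg)
      qed
      moreover have "?l \<ominus>\<^bsub>U\<^esub> ?k = lin U n (\<lambda>i. l i \<oplus>\<^bsub>K\<^esub> \<ominus>\<^bsub>K\<^esub> k i) y"
        using CK[OF k(1)] CK[OF l(1)] y by (simp add: lin_add lin_minus M.minus_eq)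
      ultimately have "b = val (lin U n (\<lambda>i. l i \<oplus>\<^bsub>K\<^esub> \<ominus>\<^bsub>K\<^esub> k i) y)" using k(2) by simp
      then show "b \<in> insert (sval S (szero S)) ((\<lambda>i. val (y i)) ` {..<n})"
        using val_lin[OF sep _ y order_refl, of "\<lambda>i. l i \<oplus>\<^bsub>K\<^esub> \<ominus>\<^bsub>K\<^esub> k i"] CK[OF k(1)] CK[OF l(1)] by simp
    qed
    then have "finite B" by (rule finite_subset) simp
    moreover have "B \<noteq> {}"
    proof -
      have "(\<lambda>_. \<zero>\<^bsub>K\<^esub>) \<in> C" by (simp add: C_def)
      then show ?thesis unfolding B_def by blast
    qed
    ultimately obtain b where b: "b \<in> B" "\<And>b'. b' \<in> B \<Longrightarrow> \<not> sless S b b'"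
      by (rule finite_max) (rule that)
    then show False using not by blast
  qed
  then obtain b where "b \<in> B" and b: "\<And>b'. b' \<in> B \<Longrightarrow> \<not> sless S b b'" by blast
  then obtain k where k: "k \<in> C" "b = val (x \<ominus>\<^bsub>U\<^esub> lin U n k y)" by (auto simp: B_def)
  show ?thesis
  proof (rule that[of k])
    show "\<forall>i. k i \<in> carrier K" using CK[OF k(1)] by blast
    fix l :: "nat \<Rightarrow> 'k" assume "\<forall>i. l i \<in> carrier K"
    then have "val (x \<ominus>\<^bsub>U\<^esub> lin U n l y) \<in> B" by (auto simp: B_def C_def)
    then show "\<not> sless S (val (x \<ominus>\<^bsub>U\<^esub> lin U n k y)) (val (x \<ominus>\<^bsub>U\<^esub> lin U n l y))"
      using b k(2) by simp
  qed
qed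

text \<open>\<open>z\<close> is the difference between \<open>x\<close> and a closest vector of the
  span, so adding a vector of the span never increases its value. A combination with last
  coefficient c n \<noteq> 0 becomes such a sum after division by c n, hence its last step does not
  cancel.\<close>

lemma separated_extend:
  assumes sep: "separated S n (\<lambda>i. sproj S (y i))" and y: "\<And>i. y i \<in> carrier U"
    and x: "x \<in> carrier U"
  obtains k z where "\<forall>i. k i \<in> carrier K" "z \<in> carrier U" "x = lin U n k y \<oplus>\<^bsub>U\<^esub> z"
    "separated S (Suc n) (\<lambda>i. sproj S ((y(n := z)) i))"
proof -
  obtain k where k: "\<forall>i. k i \<in> carrier K"
    "\<And>l. \<forall>i. l i \<in> carrier K \<Longrightarrow> \<not> sless S (val (x \<ominus>\<^bsub>U\<^esub> lin U n k y)) (val (x \<ominus>\<^bsub>U\<^esub> lin U n l y))"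
    by (rule best_approximation_lin[OF assms]) (rule that)
  define z where "z = x \<ominus>\<^bsub>U\<^esub> lin U n k y"
  have lk: "lin U n k y \<in> carrier U" using k y by simp
  have z: "z \<in> carrier U" using lk x by (simp add: z_def)
  have xz: "x = lin U n k y \<oplus>\<^bsub>U\<^esub> z"
    using x lk by (simp add: z_def M.minus_eq M.a_lcomm[of "lin U n k y" x] M.r_neg)
  have max: "\<not> sless S (val z) (val (z \<oplus>\<^bsub>U\<^esub> lin U n c y))" if c: "\<And>i. c i \<in> carrier K" for c
  proof -
    have "z \<oplus>\<^bsub>U\<^esub> lin U n c y = x \<ominus>\<^bsub>U\<^esub> lin U n (\<lambda>i. k i \<oplus>\<^bsub>K\<^esub> \<ominus>\<^bsub>K\<^esub> c i) y"
      using c k y x by (simp add: z_def lin_add lin_minus M.minus_eq M.minus_add M.minus_minus M.a_assoc)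
    then show ?thesis using k(2)[of "\<lambda>i. k i \<oplus>\<^bsub>K\<^esub> \<ominus>\<^bsub>K\<^esub> c i"] c k(1) by (simp add: z_def)
  qed
  have "in_image S (ssum S m c (\<lambda>i. sproj S ((y(n := z)) i)))"
    if c: "\<And>i. c i \<in> carrier K" and m: "m \<le> Suc n" for c m
  proof (cases "m \<le> n")
    case True
    have "ssum S m c (\<lambda>i. sproj S ((y(n := z)) i)) = ssum S m c (\<lambda>i. sproj S (y i))"
      using True by (intro ssum_cong) simp
    then show ?thesis using sep c True by (simp add: separated_def)
  next
    case False
    then have mn: "m = Suc n" using m by simp
    let ?u = "lin U n c y" and ?v = "c n \<odot>\<^bsub>U\<^esub> z"
    have u: "?u \<in> carrier U" and v: "?v \<in> carrier U" using c y z by simp_all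
    have "ssum S n c (\<lambda>i. sproj S ((y(n := z)) i)) = ssum S n c (\<lambda>i. sproj S (y i))"
      by (intro ssum_cong) simp
    then have eq: "ssum S m c (\<lambda>i. sproj S ((y(n := z)) i)) = sjoin S (sproj S ?u) (sproj S ?v)"
      using ssum_proj[OF sep c y order_refl] c z mn by (simp add: smul_proj)
    have "\<not> (val ?u = val ?v \<and> sless S (val ?u) (val (?u \<oplus>\<^bsub>U\<^esub> ?v)))"
    proof (cases "c n = \<zero>\<^bsub>K\<^esub>")
      case True
      then show ?thesis using u z less_irrefl by (simp add: smult_l_null)
    next
      case False
      let ?i = "inv\<^bsub>K\<^esub> (c n)"
      have i: "?i \<in> carrier K" "?i \<noteq> \<zero>\<^bsub>K\<^esub>" "?i \<otimes>\<^bsub>K\<^esub> c n = \<one>\<^bsub>K\<^esub>"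
        using inverse_props[OF c False] by simp_all
      have "?i \<odot>\<^bsub>U\<^esub> (?u \<oplus>\<^bsub>U\<^esub> ?v) = z \<oplus>\<^bsub>U\<^esub> lin U n (\<lambda>j. ?i \<otimes>\<^bsub>K\<^esub> c j) y"
        using i c u v y z by (simp add: smult_r_distr lin_smult smult_assoc1[symmetric] M.a_comm)
      then have "val (?u \<oplus>\<^bsub>U\<^esub> ?v) = val (z \<oplus>\<^bsub>U\<^esub> lin U n (\<lambda>j. ?i \<otimes>\<^bsub>K\<^esub> c j) y)"
        using val_smult[OF i(1,2), of "?u \<oplus>\<^bsub>U\<^esub> ?v"] u v by simp
      moreover have "val ?v = val z" using val_smult[OF c False z] .
      ultimately show ?thesis using max[of "\<lambda>j. ?i \<otimes>\<^bsub>K\<^esub> c j"] i(1) c by simp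
    qed
    then show ?thesis using sjoin_proj[OF u v] proj_in_image u v eq by simp
  qed
  then have "separated S (Suc n) (\<lambda>i. sproj S ((y(n := z)) i))" by (simp add: separated_def)
  with k(1) z xz show ?thesis by (rule that)
qed

lemma diff_eq_zero:
  assumes "u \<in> carrier U" "v \<in> carrier U"
  shows "u \<ominus>\<^bsub>U\<^esub> v = \<zero>\<^bsub>U\<^esub> \<longleftrightarrow> u = v"
proof
  assume "u \<ominus>\<^bsub>U\<^esub> v = \<zero>\<^bsub>U\<^esub>"
  moreover have "(u \<ominus>\<^bsub>U\<^esub> v) \<oplus>\<^bsub>U\<^esub> v = u"
    using assms by (simp add: M.minus_eq M.a_assoc M.l_neg)
  ultimately show "u = v" using assms by simp
next
  assume "u = v"
  then show "u \<ominus>\<^bsub>U\<^esub> v = \<zero>\<^bsub>U\<^esub>" using assms by (simp add: M.minus_eq M.r_neg)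
qed

lemma field_closed:
  "a \<in> carrier K \<Longrightarrow> b \<in> carrier K \<Longrightarrow> a \<oplus>\<^bsub>K\<^esub> b \<in> carrier K"
  "a \<in> carrier K \<Longrightarrow> b \<in> carrier K \<Longrightarrow> a \<otimes>\<^bsub>K\<^esub> b \<in> carrier K"
  "\<ominus>\<^bsub>K\<^esub> \<one>\<^bsub>K\<^esub> \<in> carrier K" "\<one>\<^bsub>K\<^esub> \<in> carrier K" "\<zero>\<^bsub>K\<^esub> \<in> carrier K"
  by simp_all

lemma one_add_eq_zero:
  assumes "a \<in> carrier K"
  shows "\<one>\<^bsub>K\<^esub> \<oplus>\<^bsub>K\<^esub> a = \<zero>\<^bsub>K\<^esub> \<longleftrightarrow> a = \<ominus>\<^bsub>K\<^esub> \<one>\<^bsub>K\<^esub>"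
proof
  assume *: "\<one>\<^bsub>K\<^esub> \<oplus>\<^bsub>K\<^esub> a = \<zero>\<^bsub>K\<^esub>"
  have "a = \<ominus>\<^bsub>K\<^esub> \<one>\<^bsub>K\<^esub> \<oplus>\<^bsub>K\<^esub> (\<one>\<^bsub>K\<^esub> \<oplus>\<^bsub>K\<^esub> a)" 
    using assms cring.cring_simprules(19)[OF is_cring, of "\<one>\<^bsub>K\<^esub>" a] by simp
  then show "a = \<ominus>\<^bsub>K\<^esub> \<one>\<^bsub>K\<^esub>" unfolding * by simp
next
  assume "a = \<ominus>\<^bsub>K\<^esub> \<one>\<^bsub>K\<^esub>"
  then show "\<one>\<^bsub>K\<^esub> \<oplus>\<^bsub>K\<^esub> a = \<zero>\<^bsub>K\<^esub>" using cring.cring_simprules(17)[OF is_cring, of "\<one>\<^bsub>K\<^esub>"] by simp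
qed

lemma lin_upd_zero:
  assumes "\<And>i. c i \<in> carrier K" "\<And>i. y i \<in> carrier U" "z \<in> carrier U"
  shows "lin U (Suc n) (\<lambda>b. if b = n then \<zero>\<^bsub>K\<^esub> else c b) (y(n := z)) = lin U n c y"
proof -
  have "lin U n (\<lambda>b. if b = n then \<zero>\<^bsub>K\<^esub> else c b) (y(n := z)) = lin U n c y"
    by (rule lin_cong) simp_all
  then show ?thesis using assms by simp
qed

lemma lin_upd_one:
  assumes "\<And>i. c i \<in> carrier K" "\<And>i. y i \<in> carrier U" "z \<in> carrier U"
  shows "lin U (Suc n) (\<lambda>b. if b = n then \<one>\<^bsub>K\<^esub> else c b) (y(n := z)) = lin U n c y \<oplus>\<^bsub>U\<^esub> z"
proof -
  have "lin U n (\<lambda>b. if b = n then \<one>\<^bsub>K\<^esub> else c b) (y(n := z)) = lin U n c y"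
    by (rule lin_cong) simp_all
  then show ?thesis using assms by simp
qed

text \<open>Each vector adds exactly one entry to the tuple, possibly zero, so the length is
  \<open>N\<close> without any case distinction on linear dependence.\<close>

lemma separated_basis_exists:
  fixes xs :: "nat \<Rightarrow> 'v"
  assumes xs: "\<And>j. xs j \<in> carrier U"
  shows "\<exists>y c. (\<forall>i. y i \<in> carrier U) \<and> (\<forall>j i. c j i \<in> carrier K) \<and>
    separated S N (\<lambda>i. sproj S (y i)) \<and> (\<forall>j<N. xs j = lin U N (c j) y)"
proof (induction N)
  case 0
  have "separated S 0 (\<lambda>i. sproj S \<zero>\<^bsub>U\<^esub>)"
    by (simp add: separated_def in_image_def)
  then show ?case by (intro exI[of _ "\<lambda>_. \<zero>\<^bsub>U\<^esub>"] exI[of _ "\<lambda>_ _. \<zero>\<^bsub>K\<^esub>"]) simp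
next
  case (Suc N)
  then obtain y :: "nat \<Rightarrow> 'v" and c :: "nat \<Rightarrow> nat \<Rightarrow> 'k" where y: "\<And>i. y i \<in> carrier U"
    and c: "\<And>j i. c j i \<in> carrier K" and sep: "separated S N (\<lambda>i. sproj S (y i))"
    and rep: "\<And>j. j < N \<Longrightarrow> xs j = lin U N (c j) y" by blast
  obtain k z where k: "\<forall>i. k i \<in> carrier K" and z: "z \<in> carrier U" "xs N = lin U N k y \<oplus>\<^bsub>U\<^esub> z"
    "separated S (Suc N) (\<lambda>i. sproj S ((y(N := z)) i))"
    by (rule separated_extend[OF sep y xs]) (rule that)
  \<comment> \<open>The new vector has coefficient 1 at \<open>z\<close>. The old vectors get 0
    there, since their previous coefficients at index \<open>N\<close> were arbitrary.\<close>
  define d where "d = (\<lambda>j b. if j = N then (if b = N then \<one>\<^bsub>K\<^esub> else k b)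
      else (if b = N then \<zero>\<^bsub>K\<^esub> else c j b))"
  have "xs j = lin U (Suc N) (d j) (y(N := z))" if "j < Suc N" for j
  proof (cases "j = N")
    case True
    then show ?thesis using lin_upd_one[of k y z N] k y z by (simp only: d_def simp_thms if_True)
  next
    case False
    then have "lin U (Suc N) (d j) (y(N := z)) = lin U N (c j) y"
      using lin_upd_zero[of "c j" y z N, OF c y z(1)] by (simp only: d_def if_False)
    then show ?thesis using rep[of j] that False by simp
  qed
  moreover have "d j i \<in> carrier K" for j i using k c by (simp add: d_def)
  moreover have "(y(N := z)) i \<in> carrier U" for i using y z(1) by simp
  ultimately show ?case using z(3) by blast
qed

end

section \<open>The skeleton of a valued vector space satisfies the axioms\<close>

definition std_ops :: "('k, 'v, 'g) vvs \<Rightarrow> ('k, 'v, 'g, ('g \<times> 'v) set) skel_ops" where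
  "std_ops X = \<lparr>sfield = base X, svecs = vecs X, sgam = gam X, sskel = skeleton X,
     sless = (\<lambda>a b. (a, b) \<in> lt X), sadd = skel_add X, szero = skel_zero X,
     sscal = skel_scal X, sval = skel_val, sproj = skel_proj X\<rparr>"

lemma std_ops_simps [simp]:
  "sfield (std_ops X) = base X" "svecs (std_ops X) = vecs X" "sgam (std_ops X) = gam X"
  "sskel (std_ops X) = skeleton X" "sless (std_ops X) = (\<lambda>a b. (a, b) \<in> lt X)"
  "sadd (std_ops X) = skel_add X" "szero (std_ops X) = skel_zero X"
  "sscal (std_ops X) = skel_scal X" "sval (std_ops X) = skel_val" "sproj (std_ops X) = skel_proj X"
  by (simp_all add: std_ops_def)

locale vvs_space =
  fixes X :: "('k, 'v, 'g) vvs"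
  assumes vvs: "valued_vector_space X"

sublocale vvs_space \<subseteq> field "base X" + module "base X" "vecs X"
  using vvs by (simp_all add: valued_vector_space_def)

context vvs_space
begin

abbreviation "K \<equiv> base X"
abbreviation "U \<equiv> vecs X"

lemma lt_order: "trans (lt X)" "irrefl (lt X)" "total_on (gam X) (lt X)"
  using vvs by (simp_all add: valued_vector_space_def strict_linear_order_on_def)

lemma lt_irrefl: "(g, g) \<notin> lt X"
  using lt_order(2) by (simp add: irrefl_def)

lemma lt_trans: "(g, h) \<in> lt X \<Longrightarrow> (h, g') \<in> lt X \<Longrightarrow> (g, g') \<in> lt X"
  using lt_order(1) by (rule transD)

lemma lt_total: "g \<in> gam X \<Longrightarrow> h \<in> gam X \<Longrightarrow> (g, h) \<in> lt X \<or> g = h \<or> (h, g) \<in> lt X"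
  using lt_order(3) by (auto simp: total_on_def)

lemma vl_closed: "v \<in> carrier U \<Longrightarrow> vl X v \<in> gam X"
  using vvs by (auto simp: valued_vector_space_def)

lemma vl_eq_infty: "v \<in> carrier U \<Longrightarrow> vl X v = infty X \<longleftrightarrow> v = \<zero>\<^bsub>U\<^esub>"
  using vvs by (auto simp: valued_vector_space_def)

lemma infty_closed: "infty X \<in> gam X"
  using vvs by (auto simp: valued_vector_space_def)

lemma infty_max: "g \<in> gam X \<Longrightarrow> g = infty X \<or> (g, infty X) \<in> lt X"
  using vvs by (auto simp: valued_vector_space_def ge_def)

lemma infty_not_less: "g \<in> gam X \<Longrightarrow> (infty X, g) \<notin> lt X"
  using infty_max lt_irrefl lt_trans by blast

lemma vl_smult: "k \<in> carrier K \<Longrightarrow> k \<noteq> \<zero>\<^bsub>K\<^esub> \<Longrightarrow> v \<in> carrier U \<Longrightarrow> vl X (k \<odot>\<^bsub>U\<^esub> v) = vl X v"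
  using vvs by (auto simp: valued_vector_space_def)

lemma vl_minus:
  assumes "v \<in> carrier U"
  shows "vl X (\<ominus>\<^bsub>U\<^esub> v) = vl X v"
proof -
  have "\<ominus>\<^bsub>K\<^esub> \<one>\<^bsub>K\<^esub> \<noteq> \<zero>\<^bsub>K\<^esub>"
  proof
    assume "\<ominus>\<^bsub>K\<^esub> \<one>\<^bsub>K\<^esub> = \<zero>\<^bsub>K\<^esub>"
    then have "\<ominus>\<^bsub>K\<^esub> (\<ominus>\<^bsub>K\<^esub> \<one>\<^bsub>K\<^esub>) = \<ominus>\<^bsub>K\<^esub> \<zero>\<^bsub>K\<^esub>" by (rule arg_cong)
    then show False by simp
  qed
  then show ?thesis using vl_smult[of "\<ominus>\<^bsub>K\<^esub> \<one>\<^bsub>K\<^esub>" v] assms by (simp add: smult_l_minus)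
qed

lemma vl_diff_less:
  assumes "u \<in> carrier U" "v \<in> carrier U" "g \<in> gam X" "(g, vl X u) \<in> lt X" "(g, vl X v) \<in> lt X"
  shows "(g, vl X (u \<ominus>\<^bsub>U\<^esub> v)) \<in> lt X"
proof -
  have "ge X (vl X (u \<ominus>\<^bsub>U\<^esub> v)) (gmin X (vl X u) (vl X v))"
    using vvs assms by (auto simp: valued_vector_space_def)
  then show ?thesis using assms lt_trans by (auto simp: ge_def gmin_def split: if_splits)
qed

lemma vl_add_less:
  assumes "u \<in> carrier U" "v \<in> carrier U" "g \<in> gam X" "(g, vl X u) \<in> lt X" "(g, vl X v) \<in> lt X"
  shows "(g, vl X (u \<oplus>\<^bsub>U\<^esub> v)) \<in> lt X"
  using vl_diff_less[of u "\<ominus>\<^bsub>U\<^esub> v" g] assms by (simp add: vl_minus M.minus_eq M.minus_minus)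

lemma vl_add_ge:
  assumes "u \<in> carrier U" "v \<in> carrier U"
  shows "\<not> ((vl X (u \<oplus>\<^bsub>U\<^esub> v), vl X u) \<in> lt X \<and> (vl X (u \<oplus>\<^bsub>U\<^esub> v), vl X v) \<in> lt X)"
  using vl_add_less[OF assms vl_closed] assms lt_irrefl by blast

lemma vl_add_ge':
  assumes "u \<in> carrier U" "v \<in> carrier U" "g \<in> gam X" "ge X (vl X u) g" "ge X (vl X v) g"
  shows "ge X (vl X (u \<oplus>\<^bsub>U\<^esub> v)) g"
proof -
  have "(vl X (u \<oplus>\<^bsub>U\<^esub> v), g) \<notin> lt X"
    using vl_add_ge[OF assms(1,2)] assms(4,5) lt_trans unfolding ge_def by metis
  then show ?thesis using lt_total[OF vl_closed assms(3)] assms(1,2) by (auto simp: ge_def)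
qed

lemma skel_pairs_iff: "(g, v) \<in> skel_pairs X \<longleftrightarrow> g \<in> gam X \<and> v \<in> carrier U \<and> ge X (vl X v) g"
  by (simp add: skel_pairs_def)

lemma skel_rel_iff: "((g, v), (g', v')) \<in> skel_rel X \<longleftrightarrow>
   (g, v) \<in> skel_pairs X \<and> (g', v') \<in> skel_pairs X \<and> g = g' \<and>
        (v = v' \<or> (g, vl X (v \<ominus>\<^bsub>U\<^esub> v')) \<in> lt X)"
  by (simp add: skel_rel_def)

lemma equiv_skel_rel: "equiv (skel_pairs X) (skel_rel X)"
proof (rule equivI)
  show "skel_rel X \<subseteq> skel_pairs X \<times> skel_pairs X" by (auto simp: skel_rel_def)
  show "refl_on (skel_pairs X) (skel_rel X)"
    by (auto simp: refl_on_def skel_rel_def)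
  show "sym (skel_rel X)"
  proof (rule symI, clarify)
    fix g v g' v' assume "((g, v), (g', v')) \<in> skel_rel X"
    moreover have "vl X (v' \<ominus>\<^bsub>U\<^esub> v) = vl X (v \<ominus>\<^bsub>U\<^esub> v')" if "v \<in> carrier U" "v' \<in> carrier U"
    proof -
      have "v' \<ominus>\<^bsub>U\<^esub> v = \<ominus>\<^bsub>U\<^esub> (v \<ominus>\<^bsub>U\<^esub> v')"
        using that by (simp add: M.minus_eq M.minus_add M.minus_minus M.a_comm)
      then show ?thesis using that by (simp add: vl_minus)
    qed
    ultimately show "((g', v'), (g, v)) \<in> skel_rel X"
      by (auto simp: skel_rel_iff skel_pairs_iff)
  qed
  show "trans (skel_rel X)"
  proof (rule transI, clarify)
    fix g v g' v' g'' v''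
    assume 1: "((g, v), (g', v')) \<in> skel_rel X" and 2: "((g', v'), (g'', v'')) \<in> skel_rel X"
    show "((g, v), (g'', v'')) \<in> skel_rel X"
    proof (cases "v = v' \<or> v' = v''")
      case False
      then have c: "v \<in> carrier U" "v' \<in> carrier U" "v'' \<in> carrier U" "g \<in> gam X"
        and l: "(g, vl X (v \<ominus>\<^bsub>U\<^esub> v')) \<in> lt X" "(g, vl X (v' \<ominus>\<^bsub>U\<^esub> v'')) \<in> lt X"
        using 1 2 by (auto simp: skel_rel_iff skel_pairs_iff)
      have "(v \<ominus>\<^bsub>U\<^esub> v') \<oplus>\<^bsub>U\<^esub> (v' \<ominus>\<^bsub>U\<^esub> v'') = v \<ominus>\<^bsub>U\<^esub> v''"
        using c by (simp add: M.minus_eq M.a_assoc M.r_neg1)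
      then have "(g, vl X (v \<ominus>\<^bsub>U\<^esub> v'')) \<in> lt X"
        using vl_add_less[OF _ _ c(4) l] c by simp
      then show ?thesis using 1 2 by (auto simp: skel_rel_iff)
    qed (use 1 2 in \<open>auto simp: skel_rel_iff\<close>)
  qed
qed

lemma skel_class_eq:
  assumes "(g, v) \<in> skel_pairs X" "(g', v') \<in> skel_pairs X"
  shows "skel_class X g v = skel_class X g' v' \<longleftrightarrow>
    g = g' \<and> (v = v' \<or> (g, vl X (v \<ominus>\<^bsub>U\<^esub> v')) \<in> lt X)"
  unfolding skel_class_def eq_equiv_class_iff[OF equiv_skel_rel assms] skel_rel_iff
  using assms by auto

lemma skeleton_iff: "s \<in> skeleton X \<longleftrightarrow> (\<exists>g v. (g, v) \<in> skel_pairs X \<and> s = skel_class X g v)"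
  unfolding skeleton_def quotient_def skel_class_def by auto

lemma skel_rep_class:
  assumes "(g, v) \<in> skel_pairs X"
  obtains v' where "skel_rep (skel_class X g v) = (g, v')" "(g, v') \<in> skel_pairs X"
    "v = v' \<or> (g, vl X (v \<ominus>\<^bsub>U\<^esub> v')) \<in> lt X"
proof -
  have "(g, v) \<in> skel_class X g v"
    unfolding skel_class_def using equiv_class_self[OF equiv_skel_rel assms] .
  then have "skel_rep (skel_class X g v) \<in> skel_class X g v"
    unfolding skel_rep_def by (rule someI)
  then show ?thesis
    using that by (cases "skel_rep (skel_class X g v)") (auto simp: skel_class_def skel_rel_iff)
qed

lemma skel_val_class: "(g, v) \<in> skel_pairs X \<Longrightarrow> skel_val (skel_class X g v) = g"
  by (metis skel_rep_class skel_val_def fst_conv)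

lemma skel_pairs_add:
  "(g, u) \<in> skel_pairs X \<Longrightarrow> (g, v) \<in> skel_pairs X \<Longrightarrow> (g, u \<oplus>\<^bsub>U\<^esub> v) \<in> skel_pairs X"
  by (auto simp: skel_pairs_iff vl_add_ge')

text \<open>Passing to the chosen representatives changes the sum by a vector of value above
  \<open>g\<close>. Equal representatives are kept apart because over \<infinity> the difference 0
  does not have a larger value.\<close>

lemma skel_add_class:
  assumes u: "(g, u) \<in> skel_pairs X" and v: "(g, v) \<in> skel_pairs X"
  shows "skel_add X (skel_class X g u) (skel_class X g v) = skel_class X g (u \<oplus>\<^bsub>U\<^esub> v)"
proof -
  obtain u' where u': "skel_rep (skel_class X g u) = (g, u')" "(g, u') \<in> skel_pairs X"
    "u = u' \<or> (g, vl X (u \<ominus>\<^bsub>U\<^esub> u')) \<in> lt X" using skel_rep_class[OF u] by blast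
  obtain v' where v': "skel_rep (skel_class X g v) = (g, v')" "(g, v') \<in> skel_pairs X"
    "v = v' \<or> (g, vl X (v \<ominus>\<^bsub>U\<^esub> v')) \<in> lt X" using skel_rep_class[OF v] by blast
  have c: "u \<in> carrier U" "v \<in> carrier U" "u' \<in> carrier U" "v' \<in> carrier U" "g \<in> gam X"
    using u v u' v' by (auto simp: skel_pairs_iff)
  have e: "(u' \<oplus>\<^bsub>U\<^esub> v') \<ominus>\<^bsub>U\<^esub> (u \<oplus>\<^bsub>U\<^esub> v) = \<ominus>\<^bsub>U\<^esub> ((u \<ominus>\<^bsub>U\<^esub> u') \<oplus>\<^bsub>U\<^esub> (v \<ominus>\<^bsub>U\<^esub> v'))"
    using c by (simp add: M.minus_eq M.minus_add M.minus_minus M.a_ac)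
  have z: "u \<ominus>\<^bsub>U\<^esub> u = \<zero>\<^bsub>U\<^esub>" "v \<ominus>\<^bsub>U\<^esub> v = \<zero>\<^bsub>U\<^esub>"
    using c by (simp_all add: M.minus_eq M.r_neg)
  have "u' \<oplus>\<^bsub>U\<^esub> v' = u \<oplus>\<^bsub>U\<^esub> v \<or> (g, vl X ((u' \<oplus>\<^bsub>U\<^esub> v') \<ominus>\<^bsub>U\<^esub> (u \<oplus>\<^bsub>U\<^esub> v))) \<in> lt X"
    unfolding e using u'(3) v'(3) c vl_add_less[of "u \<ominus>\<^bsub>U\<^esub> u'" "v \<ominus>\<^bsub>U\<^esub> v'" g] z
    by (auto simp: vl_minus)
  then have "skel_class X g (u' \<oplus>\<^bsub>U\<^esub> v') = skel_class X g (u \<oplus>\<^bsub>U\<^esub> v)"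
    using skel_class_eq skel_pairs_add u v u'(2) v'(2) by simp
  then show ?thesis
    unfolding skel_add_def skel_val_def u'(1) v'(1) by simp
qed

lemma smult_minus_distr:
  assumes "k \<in> carrier K" "u \<in> carrier U" "v \<in> carrier U"
  shows "k \<odot>\<^bsub>U\<^esub> u \<ominus>\<^bsub>U\<^esub> k \<odot>\<^bsub>U\<^esub> v = k \<odot>\<^bsub>U\<^esub> (u \<ominus>\<^bsub>U\<^esub> v)"
  using assms by (simp add: M.minus_eq smult_r_distr smult_r_minus)

lemma skel_scal_class:
  assumes k: "k \<in> carrier K" "k \<noteq> \<zero>\<^bsub>K\<^esub>" and v: "(g, v) \<in> skel_pairs X"
  shows "skel_scal X k (skel_class X g v) = skel_class X g (k \<odot>\<^bsub>U\<^esub> v)"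
proof -
  obtain v' where v': "skel_rep (skel_class X g v) = (g, v')" "(g, v') \<in> skel_pairs X"
    "v = v' \<or> (g, vl X (v \<ominus>\<^bsub>U\<^esub> v')) \<in> lt X" using skel_rep_class[OF v] by blast
  have eq: "skel_class X g v' = skel_class X g v"
    using skel_class_eq[OF v v'(2)] v'(3) by simp
  have c: "v \<in> carrier U" "v' \<in> carrier U"
    using v v' by (auto simp: skel_pairs_iff)
  have p: "(g, k \<odot>\<^bsub>U\<^esub> w) \<in> skel_pairs X" if "(g, w) \<in> skel_pairs X" for w
    using that k by (auto simp: skel_pairs_iff vl_smult)
  have "v = v' \<or> (g, vl X (k \<odot>\<^bsub>U\<^esub> v \<ominus>\<^bsub>U\<^esub> k \<odot>\<^bsub>U\<^esub> v')) \<in> lt X"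
    using v'(3) c k by (simp add: smult_minus_distr vl_smult)
  then have "skel_class X g (k \<odot>\<^bsub>U\<^esub> v) = skel_class X g (k \<odot>\<^bsub>U\<^esub> v')"
    using skel_class_eq[OF p[OF v] p[OF v'(2)]] by auto
  then show ?thesis
    unfolding skel_scal_def skel_val_def v'(1) by simp
qed

lemma proj_pair: "v \<in> carrier U \<Longrightarrow> (vl X v, v) \<in> skel_pairs X"
  by (simp add: skel_pairs_iff vl_closed ge_def)

lemma skel_val_proj: "v \<in> carrier U \<Longrightarrow> skel_val (skel_proj X v) = vl X v"
  by (simp add: skel_proj_def skel_val_class proj_pair)

lemma zero_pair: "g \<in> gam X \<Longrightarrow> (g, \<zero>\<^bsub>U\<^esub>) \<in> skel_pairs X"
  using infty_max vl_eq_infty[of "\<zero>\<^bsub>U\<^esub>"] by (auto simp: skel_pairs_iff ge_def)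

text \<open>v + v and v differ by \<open>v\<close>, so the class is idempotent exactly if
  \<open>v\<close> is zero or has value above \<open>g\<close>. The zero over \<infinity> is the one
  idempotent in the image, and \<open>in_image\<close> admits it separately.\<close>

lemma in_image_class:
  assumes p: "(g, v) \<in> skel_pairs X"
  shows "in_image (std_ops X) (skel_class X g v) \<longleftrightarrow> vl X v = g"
proof -
  have c: "v \<in> carrier U" "g \<in> gam X" "ge X (vl X v) g" using p by (auto simp: skel_pairs_iff)
  have "v \<ominus>\<^bsub>U\<^esub> \<zero>\<^bsub>U\<^esub> = v" using c by (simp add: M.minus_eq M.minus_equality[of "\<zero>\<^bsub>U\<^esub>" "\<zero>\<^bsub>U\<^esub>"])
  then have 1: "skel_class X g v = skel_zero X \<longleftrightarrow> g = infty X \<and> v = \<zero>\<^bsub>U\<^esub>"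
    using skel_class_eq[OF p zero_pair[OF infty_closed]] infty_not_less vl_closed c(1)
    by (auto simp: skel_zero_def)
  have "(v \<oplus>\<^bsub>U\<^esub> v) \<ominus>\<^bsub>U\<^esub> v = v" using c by (simp add: M.minus_eq M.a_assoc M.r_neg)
  moreover from this have "v \<oplus>\<^bsub>U\<^esub> v = v \<longleftrightarrow> v = \<zero>\<^bsub>U\<^esub>"
    using c M.r_neg[of v] by (auto simp: M.minus_eq)
  ultimately have 2: "skel_add X (skel_class X g v) (skel_class X g v) = skel_class X g v \<longleftrightarrow>
      v = \<zero>\<^bsub>U\<^esub> \<or> (g, vl X v) \<in> lt X"
    using skel_class_eq[OF skel_pairs_add[OF p p] p] skel_add_class[OF p p] by simp
  show ?thesis unfolding in_image_def std_ops_simps 1 2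
    using c vl_eq_infty[of v] lt_irrefl unfolding ge_def by auto
qed

lemma skel_space_std: "skel_space (std_ops X)"
proof (intro skel_space.intro skel_space_axioms.intro, unfold std_ops_simps)
  show "field K" "module K U" by unfold_locales
next
  fix u v assume u: "u \<in> carrier U" and v: "v \<in> carrier U"
  have uv: "u \<oplus>\<^bsub>U\<^esub> v \<in> carrier U" using u v by simp
  show "skel_proj X v \<in> skeleton X"
    unfolding skeleton_iff skel_proj_def using proj_pair[OF v] by blast
  show "skel_proj X v = skel_zero X \<longleftrightarrow> v = \<zero>\<^bsub>U\<^esub>"
  proof
    assume "skel_proj X v = skel_zero X"
    then have "vl X v = infty X" unfolding skel_proj_def skel_zero_def
      using skel_class_eq[OF proj_pair[OF v] zero_pair[OF infty_closed]] by simp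
    then show "v = \<zero>\<^bsub>U\<^esub>" using vl_eq_infty[OF v] by simp
  next
    assume "v = \<zero>\<^bsub>U\<^esub>"
    then show "skel_proj X v = skel_zero X"
      using vl_eq_infty[OF v] by (simp add: skel_proj_def skel_zero_def)
  qed
  have "(vl X u, u \<oplus>\<^bsub>U\<^esub> v) \<in> skel_pairs X" if "vl X u = vl X v"
    using skel_pairs_add proj_pair[OF u] proj_pair[OF v] that by simp
  moreover have "skel_add X (skel_proj X u) (skel_proj X v) = skel_class X (vl X u) (u \<oplus>\<^bsub>U\<^esub> v)"
    if "vl X u = vl X v"
    using skel_add_class proj_pair[OF u] proj_pair[OF v] that by (simp add: skel_proj_def)
  ultimately have sum: "skel_add X (skel_proj X u) (skel_proj X v) = skel_class X (vl X u) (u \<oplus>\<^bsub>U\<^esub> v)"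
    "(vl X u, u \<oplus>\<^bsub>U\<^esub> v) \<in> skel_pairs X" if "vl X u = vl X v"
    using that by simp_all
  show "skel_proj X (u \<oplus>\<^bsub>U\<^esub> v) = skel_add X (skel_proj X u) (skel_proj X v)"
    if "skel_val (skel_proj X u) = skel_val (skel_proj X v)"
      "skel_val (skel_proj X (u \<oplus>\<^bsub>U\<^esub> v)) = skel_val (skel_proj X u)"
  proof -
    have "vl X u = vl X v" "vl X (u \<oplus>\<^bsub>U\<^esub> v) = vl X u"
      using that u v uv by (simp_all add: skel_val_proj)
    then show ?thesis using sum(1) by (simp add: skel_proj_def)
  qed
  show "\<not> in_image (std_ops X) (skel_add X (skel_proj X u) (skel_proj X v))"
    if "skel_val (skel_proj X u) = skel_val (skel_proj X v)"
      "skel_val (skel_proj X (u \<oplus>\<^bsub>U\<^esub> v)) \<noteq> skel_val (skel_proj X u)"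
  proof -
    have "vl X u = vl X v" "vl X (u \<oplus>\<^bsub>U\<^esub> v) \<noteq> vl X u"
      using that u v uv by (simp_all add: skel_val_proj)
    then show ?thesis using sum by (simp add: in_image_class)
  qed
  show "\<not> ((skel_val (skel_proj X (u \<oplus>\<^bsub>U\<^esub> v)), skel_val (skel_proj X u)) \<in> lt X \<and>
           (skel_val (skel_proj X (u \<oplus>\<^bsub>U\<^esub> v)), skel_val (skel_proj X v)) \<in> lt X)"
    using vl_add_ge[OF u v] u v uv by (simp add: skel_val_proj)
  assume "(skel_val (skel_proj X u), skel_val (skel_proj X v)) \<in> lt X"
  then have l: "(vl X u, vl X v) \<in> lt X" using u v by (simp add: skel_val_proj)
  \<comment> \<open>Writing u as (u + v) - v shows that the value of u + v cannot exceed
    val(u).\<close>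
  have "(u \<oplus>\<^bsub>U\<^esub> v) \<oplus>\<^bsub>U\<^esub> \<ominus>\<^bsub>U\<^esub> v = u" using u v by (simp add: M.a_assoc M.r_neg)
  then have "\<not> (vl X u, vl X (u \<oplus>\<^bsub>U\<^esub> v)) \<in> lt X"
    using vl_add_less[OF uv _ vl_closed[OF u], of "\<ominus>\<^bsub>U\<^esub> v"] l v lt_irrefl by (auto simp: vl_minus)
  moreover have "(vl X (u \<oplus>\<^bsub>U\<^esub> v), vl X u) \<notin> lt X"
    using vl_add_ge[OF u v] l lt_trans by blast
  ultimately have eq: "vl X (u \<oplus>\<^bsub>U\<^esub> v) = vl X u"
    using lt_total[OF vl_closed[OF u] vl_closed[OF uv]] by simp
  have "(u \<oplus>\<^bsub>U\<^esub> v) \<ominus>\<^bsub>U\<^esub> u = v" using u v by (simp add: M.minus_eq M.a_comm[of u v] M.a_assoc M.r_neg)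
  then show "skel_proj X (u \<oplus>\<^bsub>U\<^esub> v) = skel_proj X u"
    unfolding skel_proj_def using skel_class_eq[OF proj_pair[OF uv] proj_pair[OF u]] eq l by simp
next
  fix s assume "s \<in> skeleton X"
  then show "skel_val s \<in> gam X"
    by (auto simp: skeleton_iff skel_val_class skel_pairs_iff)
next
  fix g show "(g, g) \<notin> lt X" by (rule lt_irrefl)
next
  fix g h g' assume "(g, h) \<in> lt X" "(h, g') \<in> lt X"
  then show "(g, g') \<in> lt X" by (rule lt_trans)
next
  fix g h assume "g \<in> gam X" "h \<in> gam X"
  then show "(g, h) \<in> lt X \<or> g = h \<or> (h, g) \<in> lt X" by (rule lt_total)
next
  fix k v assume k: "k \<in> carrier K" "k \<noteq> \<zero>\<^bsub>K\<^esub>" and v: "v \<in> carrier U"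
  then show "skel_proj X (k \<odot>\<^bsub>U\<^esub> v) = skel_scal X k (skel_proj X v)"
    by (simp add: skel_proj_def vl_smult skel_scal_class proj_pair)
  show "skel_val (skel_proj X (k \<odot>\<^bsub>U\<^esub> v)) = skel_val (skel_proj X v)"
    using k v by (simp add: skel_val_proj vl_smult)
next
  show "skel_proj X ` carrier U = {s \<in> skeleton X. in_image (std_ops X) s}"
  proof (intro equalityI subsetI)
    fix s assume "s \<in> skel_proj X ` carrier U"
    then show "s \<in> {s \<in> skeleton X. in_image (std_ops X) s}"
      using proj_pair in_image_class skeleton_iff by (auto simp: skel_proj_def)
  next
    fix s assume "s \<in> {s \<in> skeleton X. in_image (std_ops X) s}"
    then obtain g v where "(g, v) \<in> skel_pairs X" "s = skel_class X g v" "vl X v = g"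
      using skeleton_iff in_image_class by auto
    then have "s = skel_proj X v" "v \<in> carrier U" by (auto simp: skel_proj_def skel_pairs_iff)
    then show "s \<in> skel_proj X ` carrier U" by blast
  qed
qed

end

section \<open>Transport along isomorphisms\<close>

locale skel_iso = T: skel_space T
  for S :: "('k, 'v, 'g, 's) skel_ops" and T :: "('l, 'w, 'h, 't) skel_ops" +
  fixes hk hv hg hs
  assumes field: "field (sfield S)"
    and hk: "hk \<in> ring_iso (sfield S) (sfield T)"
    and hv: "bij_betw hv (carrier (svecs S)) (carrier (svecs T))"
    and hg: "bij_betw hg (sgam S) (sgam T)"
    and hs: "bij_betw hs (sskel S) (sskel T)"
    and add_closed: "\<lbrakk>u \<in> carrier (svecs S); v \<in> carrier (svecs S)\<rbrakk> \<Longrightarrow>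
      u \<oplus>\<^bsub>svecs S\<^esub> v \<in> carrier (svecs S) \<and> hv (u \<oplus>\<^bsub>svecs S\<^esub> v) = hv u \<oplus>\<^bsub>svecs T\<^esub> hv v"
    and zero_closed: "\<zero>\<^bsub>svecs S\<^esub> \<in> carrier (svecs S) \<and> hv \<zero>\<^bsub>svecs S\<^esub> = \<zero>\<^bsub>svecs T\<^esub>"
    and smult_closed: "\<lbrakk>k \<in> carrier (sfield S); v \<in> carrier (svecs S)\<rbrakk> \<Longrightarrow>
      k \<odot>\<^bsub>svecs S\<^esub> v \<in> carrier (svecs S) \<and> hv (k \<odot>\<^bsub>svecs S\<^esub> v) = hk k \<odot>\<^bsub>svecs T\<^esub> hv v"
    and proj_closed: "v \<in> carrier (svecs S) \<Longrightarrow>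
      sproj S v \<in> sskel S \<and> hs (sproj S v) = sproj T (hv v)"
    and szero_closed: "szero S \<in> sskel S \<and> hs (szero S) = szero T"
    and sadd_closed: "\<lbrakk>s \<in> sskel S; t \<in> sskel S\<rbrakk> \<Longrightarrow>
      sadd S s t \<in> sskel S \<and> hs (sadd S s t) = sadd T (hs s) (hs t)"
    and sscal_closed: "\<lbrakk>k \<in> carrier (sfield S); s \<in> sskel S\<rbrakk> \<Longrightarrow>
      sscal S k s \<in> sskel S \<and> hs (sscal S k s) = sscal T (hk k) (hs s)"
    and sval_closed: "s \<in> sskel S \<Longrightarrow> sval S s \<in> sgam S \<and> hg (sval S s) = sval T (hs s)"
    and less: "sless S a b \<longleftrightarrow> a \<in> sgam S \<and> b \<in> sgam S \<and> sless T (hg a) (hg b)"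
begin

lemma hk_props:
  "k \<in> carrier (sfield S) \<Longrightarrow> hk k \<in> carrier (sfield T)"
  "hk \<one>\<^bsub>sfield S\<^esub> = \<one>\<^bsub>sfield T\<^esub>"
  "\<lbrakk>k \<in> carrier (sfield S); l \<in> carrier (sfield S)\<rbrakk> \<Longrightarrow> hk (k \<oplus>\<^bsub>sfield S\<^esub> l) = hk k \<oplus>\<^bsub>sfield T\<^esub> hk l"
  "\<lbrakk>k \<in> carrier (sfield S); l \<in> carrier (sfield S)\<rbrakk> \<Longrightarrow> hk (k \<otimes>\<^bsub>sfield S\<^esub> l) = hk k \<otimes>\<^bsub>sfield T\<^esub> hk l"
  "k \<in> carrier (sfield S) \<Longrightarrow> hk k = \<zero>\<^bsub>sfield T\<^esub> \<longleftrightarrow> k = \<zero>\<^bsub>sfield S\<^esub>"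
proof -
  have h: "hk \<in> ring_hom (sfield S) (sfield T)" and b: "bij_betw hk (carrier (sfield S)) (carrier (sfield T))"
    using hk by (auto simp: ring_iso_def)
  interpret F: field "sfield S" by (rule field)
  show "k \<in> carrier (sfield S) \<Longrightarrow> hk k \<in> carrier (sfield T)"
    "hk \<one>\<^bsub>sfield S\<^esub> = \<one>\<^bsub>sfield T\<^esub>"
    "\<lbrakk>k \<in> carrier (sfield S); l \<in> carrier (sfield S)\<rbrakk> \<Longrightarrow> hk (k \<oplus>\<^bsub>sfield S\<^esub> l) = hk k \<oplus>\<^bsub>sfield T\<^esub> hk l"
    "\<lbrakk>k \<in> carrier (sfield S); l \<in> carrier (sfield S)\<rbrakk> \<Longrightarrow> hk (k \<otimes>\<^bsub>sfield S\<^esub> l) = hk k \<otimes>\<^bsub>sfield T\<^esub> hk l"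
    using h by (simp_all add: ring_hom_def Pi_iff)
  have z: "hk \<zero>\<^bsub>sfield S\<^esub> = \<zero>\<^bsub>sfield T\<^esub>"
    using ring_hom_zero[OF h F.ring_axioms T.ring_axioms] .
  show "k \<in> carrier (sfield S) \<Longrightarrow> hk k = \<zero>\<^bsub>sfield T\<^esub> \<longleftrightarrow> k = \<zero>\<^bsub>sfield S\<^esub>"
    using inj_onD[OF bij_betw_imp_inj_on[OF b], of k "\<zero>\<^bsub>sfield S\<^esub>"] z by auto
qed

lemma hv_closed: "v \<in> carrier (svecs S) \<Longrightarrow> hv v \<in> carrier (svecs T)"
  using hv by (rule bij_betw_apply)

lemma hs_closed: "s \<in> sskel S \<Longrightarrow> hs s \<in> sskel T"
  using hs by (rule bij_betw_apply)

lemma hg_closed: "g \<in> sgam S \<Longrightarrow> hg g \<in> sgam T"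
  using hg by (rule bij_betw_apply)

lemma hv_eq: "u \<in> carrier (svecs S) \<Longrightarrow> v \<in> carrier (svecs S) \<Longrightarrow> u = v \<longleftrightarrow> hv u = hv v"
  using bij_betw_imp_inj_on[OF hv] by (auto dest: inj_onD)

lemma hs_eq: "s \<in> sskel S \<Longrightarrow> t \<in> sskel S \<Longrightarrow> s = t \<longleftrightarrow> hs s = hs t"
  using bij_betw_imp_inj_on[OF hs] by (auto dest: inj_onD)

lemma hg_eq: "g \<in> sgam S \<Longrightarrow> h \<in> sgam S \<Longrightarrow> g = h \<longleftrightarrow> hg g = hg h"
  using bij_betw_imp_inj_on[OF hg] by (auto dest: inj_onD)

lemma hv_surj: "w \<in> carrier (svecs T) \<Longrightarrow> \<exists>v\<in>carrier (svecs S). w = hv v"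
  using bij_betw_imp_surj_on[OF hv] by blast

lemma hom_simps:
  "\<lbrakk>u \<in> carrier (svecs S); v \<in> carrier (svecs S)\<rbrakk> \<Longrightarrow> u \<oplus>\<^bsub>svecs S\<^esub> v \<in> carrier (svecs S)"
  "\<lbrakk>u \<in> carrier (svecs S); v \<in> carrier (svecs S)\<rbrakk> \<Longrightarrow> hv (u \<oplus>\<^bsub>svecs S\<^esub> v) = hv u \<oplus>\<^bsub>svecs T\<^esub> hv v"
  "\<zero>\<^bsub>svecs S\<^esub> \<in> carrier (svecs S)" "hv \<zero>\<^bsub>svecs S\<^esub> = \<zero>\<^bsub>svecs T\<^esub>"
  "\<lbrakk>k \<in> carrier (sfield S); v \<in> carrier (svecs S)\<rbrakk> \<Longrightarrow> k \<odot>\<^bsub>svecs S\<^esub> v \<in> carrier (svecs S)"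
  "\<lbrakk>k \<in> carrier (sfield S); v \<in> carrier (svecs S)\<rbrakk> \<Longrightarrow> hv (k \<odot>\<^bsub>svecs S\<^esub> v) = hk k \<odot>\<^bsub>svecs T\<^esub> hv v"
  "v \<in> carrier (svecs S) \<Longrightarrow> sproj S v \<in> sskel S"
  "v \<in> carrier (svecs S) \<Longrightarrow> hs (sproj S v) = sproj T (hv v)"
  "szero S \<in> sskel S" "hs (szero S) = szero T"
  "\<lbrakk>s \<in> sskel S; t \<in> sskel S\<rbrakk> \<Longrightarrow> sadd S s t \<in> sskel S"
  "\<lbrakk>s \<in> sskel S; t \<in> sskel S\<rbrakk> \<Longrightarrow> hs (sadd S s t) = sadd T (hs s) (hs t)"
  "\<lbrakk>k \<in> carrier (sfield S); s \<in> sskel S\<rbrakk> \<Longrightarrow> sscal S k s \<in> sskel S"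
  "\<lbrakk>k \<in> carrier (sfield S); s \<in> sskel S\<rbrakk> \<Longrightarrow> hs (sscal S k s) = sscal T (hk k) (hs s)"
  "s \<in> sskel S \<Longrightarrow> sval S s \<in> sgam S" "s \<in> sskel S \<Longrightarrow> hg (sval S s) = sval T (hs s)"
  using add_closed zero_closed smult_closed proj_closed szero_closed sadd_closed sscal_closed
    sval_closed by simp_all

lemmas iso_simps = hom_simps hk_props hv_closed hs_closed hg_closed

text \<open>Of \<open>S\<close> only the field and the closure of the operations are known
  beforehand. Equations are checked in \<open>T\<close> through the injection \<open>hv\<close>;
  additive inverses are the one point that needs its surjectivity.\<close>

lemma module_S: "module (sfield S) (svecs S)"
proof -
  interpret F: field "sfield S" by (rule field)
  show ?thesis
  proof (rule moduleI)
    show "cring (sfield S)" by (rule F.is_cring)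
    show "abelian_group (svecs S)"
    proof (rule abelian_groupI)
      fix x assume x: "x \<in> carrier (svecs S)"
      obtain y where "y \<in> carrier (svecs S)" "hv y = \<ominus>\<^bsub>svecs T\<^esub> hv x"
        using hv_surj[of "\<ominus>\<^bsub>svecs T\<^esub> hv x"] x by (auto simp: iso_simps)
      then show "\<exists>y\<in>carrier (svecs S). y \<oplus>\<^bsub>svecs S\<^esub> x = \<zero>\<^bsub>svecs S\<^esub>"
        using x by (intro bexI[of _ y]) (simp_all add: iso_simps hv_eq T.M.l_neg)
    qed (simp_all add: iso_simps hv_eq T.M.a_ac)
  qed (simp_all add: iso_simps hv_eq T.smult_l_distr T.smult_r_distr T.smult_assoc1)
qed

lemma in_image_iff: "s \<in> sskel S \<Longrightarrow> in_image S s \<longleftrightarrow> in_image T (hs s)"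
  by (simp add: in_image_def hs_eq iso_simps)

lemma skel_space_S: "skel_space S"
proof (intro skel_space.intro skel_space_axioms.intro)
  show "field (sfield S)" "module (sfield S) (svecs S)" by (rule field, rule module_S)
next
  fix g show "\<not> sless S g g" by (simp add: less T.less_irrefl)
next
  fix a b c assume "sless S a b" "sless S b c"
  then show "sless S a c" using T.less_trans by (auto simp: less)
next
  fix g h assume "g \<in> sgam S" "h \<in> sgam S"
  then show "sless S g h \<or> g = h \<or> sless S h g"
    using T.less_total[of "hg g" "hg h"] by (simp add: less hg_closed hg_eq)
next
  fix v assume "v \<in> carrier (svecs S)"
  then show "sproj S v = szero S \<longleftrightarrow> v = \<zero>\<^bsub>svecs S\<^esub>"
    by (simp add: hs_eq hv_eq iso_simps T.proj_eq_zero)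
next
  fix u v assume "u \<in> carrier (svecs S)" "v \<in> carrier (svecs S)"
    "sless S (sval S (sproj S u)) (sval S (sproj S v))"
  then show "sproj S (u \<oplus>\<^bsub>svecs S\<^esub> v) = sproj S u"
    by (simp add: hs_eq less iso_simps T.proj_add_less)
next
  fix u v assume "u \<in> carrier (svecs S)" "v \<in> carrier (svecs S)"
    "sval S (sproj S u) = sval S (sproj S v)"
    "sval S (sproj S (u \<oplus>\<^bsub>svecs S\<^esub> v)) = sval S (sproj S u)"
  then show "sproj S (u \<oplus>\<^bsub>svecs S\<^esub> v) = sadd S (sproj S u) (sproj S v)"
    by (simp add: hs_eq hg_eq iso_simps T.proj_add_eq)
next
  fix u v assume "u \<in> carrier (svecs S)" "v \<in> carrier (svecs S)"
    "sval S (sproj S u) = sval S (sproj S v)"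
    "sval S (sproj S (u \<oplus>\<^bsub>svecs S\<^esub> v)) \<noteq> sval S (sproj S u)"
  then show "\<not> in_image S (sadd S (sproj S u) (sproj S v))"
    by (simp add: in_image_iff hs_eq hg_eq iso_simps T.cancellation)
next
  fix u v assume "u \<in> carrier (svecs S)" "v \<in> carrier (svecs S)"
  then show "\<not> (sless S (sval S (sproj S (u \<oplus>\<^bsub>svecs S\<^esub> v))) (sval S (sproj S u)) \<and>
          sless S (sval S (sproj S (u \<oplus>\<^bsub>svecs S\<^esub> v))) (sval S (sproj S v)))"
    using T.ultrametric[of "hv u" "hv v"] by (simp add: less iso_simps)
next
  fix k v assume k: "k \<in> carrier (sfield S)" "k \<noteq> \<zero>\<^bsub>sfield S\<^esub>" and v: "v \<in> carrier (svecs S)"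
  show "sproj S (k \<odot>\<^bsub>svecs S\<^esub> v) = sscal S k (sproj S v)"
    using k v by (simp add: hs_eq iso_simps T.proj_smult)
  show "sval S (sproj S (k \<odot>\<^bsub>svecs S\<^esub> v)) = sval S (sproj S v)"
    using k v by (simp add: hg_eq iso_simps T.val_smult)
next
  have 1: "s \<in> sproj S ` carrier (svecs S) \<longleftrightarrow> hs s \<in> sproj T ` carrier (svecs T)" if "s \<in> sskel S" for s
  proof
    assume "s \<in> sproj S ` carrier (svecs S)"
    then show "hs s \<in> sproj T ` carrier (svecs T)" by (auto simp: iso_simps)
  next
    assume "hs s \<in> sproj T ` carrier (svecs T)"
    then obtain v where "v \<in> carrier (svecs S)" "hs s = sproj T (hv v)" using hv_surj by blast
    then show "s \<in> sproj S ` carrier (svecs S)"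
      using that by (intro image_eqI[of _ _ v]) (simp_all add: hs_eq iso_simps)
  qed
  show "sproj S ` carrier (svecs S) = {s \<in> sskel S. in_image S s}"
  proof (intro equalityI subsetI)
    fix s assume s: "s \<in> sproj S ` carrier (svecs S)"
    then have "s \<in> sskel S" by (auto simp: iso_simps)
    then show "s \<in> {s \<in> sskel S. in_image S s}"
      using 1 s T.proj_image by (auto simp: in_image_iff)
  next
    fix s assume "s \<in> {s \<in> sskel S. in_image S s}"
    then have s: "s \<in> sskel S" "in_image S s" by blast+
    then have "hs s \<in> sproj T ` carrier (svecs T)"
      using T.proj_image in_image_iff[OF s(1)] hs_closed[OF s(1)] by blast
    then show "s \<in> sproj S ` carrier (svecs S)" using 1[OF s(1)] by blast
  qed
qed (simp_all add: iso_simps)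

end

text \<open>A field can be pushed forward along an isomorphism, so the inverse of \<open>h\<close>
  is used. That it is a homomorphism follows from the equations for \<open>h\<close> and
  injectivity, before \<open>S\<close> is known to be a ring.\<close>

lemma field_iso_back:
  fixes S :: "'k ring" and T :: "'l ring"
  assumes "field T" "bij_betw h (carrier S) (carrier T)"
    and closed: "\<And>a b. \<lbrakk>a \<in> carrier S; b \<in> carrier S\<rbrakk> \<Longrightarrow> a \<oplus>\<^bsub>S\<^esub> b \<in> carrier S"
      "\<And>a b. \<lbrakk>a \<in> carrier S; b \<in> carrier S\<rbrakk> \<Longrightarrow> a \<otimes>\<^bsub>S\<^esub> b \<in> carrier S"
      "\<zero>\<^bsub>S\<^esub> \<in> carrier S" "\<one>\<^bsub>S\<^esub> \<in> carrier S"
    and hom: "\<And>a b. \<lbrakk>a \<in> carrier S; b \<in> carrier S\<rbrakk> \<Longrightarrow> h (a \<oplus>\<^bsub>S\<^esub> b) = h a \<oplus>\<^bsub>T\<^esub> h b"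
      "\<And>a b. \<lbrakk>a \<in> carrier S; b \<in> carrier S\<rbrakk> \<Longrightarrow> h (a \<otimes>\<^bsub>S\<^esub> b) = h a \<otimes>\<^bsub>T\<^esub> h b"
      "h \<zero>\<^bsub>S\<^esub> = \<zero>\<^bsub>T\<^esub>" "h \<one>\<^bsub>S\<^esub> = \<one>\<^bsub>T\<^esub>"
  shows "field S" "h \<in> ring_iso S T"
proof -
  interpret T: field T by (rule assms(1))
  let ?g = "inv_into (carrier S) h"
  have g: "?g a \<in> carrier S" "h (?g a) = a" if "a \<in> carrier T" for a
    using that assms(2) by (auto simp: bij_betw_def inv_into_into f_inv_into_f)
  have gh: "?g (h a) = a" if "a \<in> carrier S" for a
    using that assms(2) by (simp add: bij_betw_def)
  show "h \<in> ring_iso S T"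
    using assms by (auto simp: ring_iso_def ring_hom_def bij_betw_apply)
  have "?g (a \<oplus>\<^bsub>T\<^esub> b) = ?g a \<oplus>\<^bsub>S\<^esub> ?g b" "?g (a \<otimes>\<^bsub>T\<^esub> b) = ?g a \<otimes>\<^bsub>S\<^esub> ?g b"
    if "a \<in> carrier T" "b \<in> carrier T" for a b
    using gh[of "?g a \<oplus>\<^bsub>S\<^esub> ?g b"] gh[of "?g a \<otimes>\<^bsub>S\<^esub> ?g b"] g that closed hom by simp_all
  moreover have "?g \<one>\<^bsub>T\<^esub> = \<one>\<^bsub>S\<^esub>" "?g \<zero>\<^bsub>T\<^esub> = \<zero>\<^bsub>S\<^esub>"
    using gh[OF closed(3)] gh[OF closed(4)] hom by simp_all
  moreover have "bij_betw ?g (carrier T) (carrier S)" using assms(2) by (rule bij_betw_inv_into)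
  ultimately have "?g \<in> ring_iso T S" using g by (auto simp: ring_iso_def ring_hom_def)
  from T.ring_iso_imp_img_field[OF this] show "field S"
    using \<open>?g \<zero>\<^bsub>T\<^esub> = \<zero>\<^bsub>S\<^esub>\<close> by simp
qed

text \<open>Outside the sort \<Gamma> the relation \<open>Less\<close> of a structure is
  unconstrained. Restricting \<open>sless\<close> to the sort lets irreflexivity and transitivity
  hold for all elements of the type.\<close>

definition SK_ops :: "'k ring \<Rightarrow> (vsort, 'k SK_sym, vrel, 'u) struct \<Rightarrow> ('k, 'u, 'u, 'u) skel_ops" where
  "SK_ops K M = \<lparr>sfield = K,
     svecs = \<lparr>carrier = univ M VecS, mult = undefined, one = undefined,
       zero = fun_in M ZeroK [], add = (\<lambda>x y. fun_in M AddK [x, y]),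
       smult = (\<lambda>k x. fun_in M (ScalK k) [x])\<rparr>,
     sgam = univ M GamS, sskel = univ M SkelS,
     sless = (\<lambda>a b. a \<in> univ M GamS \<and> b \<in> univ M GamS \<and> rel_in M Less [a, b]),
     sadd = (\<lambda>s t. fun_in M SAddK [s, t]), szero = fun_in M SZeroK [],
     sscal = (\<lambda>k s. fun_in M (SScalK k) [s]), sval = (\<lambda>s. fun_in M SValK [s]),
     sproj = (\<lambda>v. fun_in M ProjK [v])\<rparr>"

definition S_ops :: "(vsort, S_sym, vrel, 'u) struct \<Rightarrow> ('u, 'u, 'u, 'u) skel_ops" where
  "S_ops M = \<lparr>sfield = \<lparr>carrier = univ M FieldS, mult = (\<lambda>x y. fun_in M FMult [x, y]),
       one = fun_in M FOne [], zero = fun_in M FZero [], add = (\<lambda>x y. fun_in M FAdd [x, y])\<rparr>,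
     svecs = \<lparr>carrier = univ M VecS, mult = undefined, one = undefined,
       zero = fun_in M Zero [], add = (\<lambda>x y. fun_in M Add [x, y]),
       smult = (\<lambda>k x. fun_in M Scal [k, x])\<rparr>,
     sgam = univ M GamS, sskel = univ M SkelS,
     sless = (\<lambda>a b. a \<in> univ M GamS \<and> b \<in> univ M GamS \<and> rel_in M Less [a, b]),
     sadd = (\<lambda>s t. fun_in M SAdd [s, t]), szero = fun_in M SZero [],
     sscal = (\<lambda>k s. fun_in M SScal [k, s]), sval = (\<lambda>s. fun_in M SVal [s]),
     sproj = (\<lambda>v. fun_in M Proj [v])\<rparr>"

lemma SK_ops_simps [simp]:
  "sfield (SK_ops K M) = K" "carrier (svecs (SK_ops K M)) = univ M VecS"
  "\<zero>\<^bsub>svecs (SK_ops K M)\<^esub> = fun_in M ZeroK []"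
  "x \<oplus>\<^bsub>svecs (SK_ops K M)\<^esub> y = fun_in M AddK [x, y]"
  "k \<odot>\<^bsub>svecs (SK_ops K M)\<^esub> x = fun_in M (ScalK k) [x]"
  "sgam (SK_ops K M) = univ M GamS" "sskel (SK_ops K M) = univ M SkelS"
  "sless (SK_ops K M) a b \<longleftrightarrow> a \<in> univ M GamS \<and> b \<in> univ M GamS \<and> rel_in M Less [a, b]"
  "sadd (SK_ops K M) s t = fun_in M SAddK [s, t]" "szero (SK_ops K M) = fun_in M SZeroK []"
  "sscal (SK_ops K M) k s = fun_in M (SScalK k) [s]" "sval (SK_ops K M) s = fun_in M SValK [s]"
  "sproj (SK_ops K M) x = fun_in M ProjK [x]"
  by (simp_all add: SK_ops_def)

lemma S_ops_simps [simp]: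
  "carrier (sfield (S_ops M)) = univ M FieldS"
  "\<zero>\<^bsub>sfield (S_ops M)\<^esub> = fun_in M FZero []" "\<one>\<^bsub>sfield (S_ops M)\<^esub> = fun_in M FOne []"
  "k \<oplus>\<^bsub>sfield (S_ops M)\<^esub> l = fun_in M FAdd [k, l]" "k \<otimes>\<^bsub>sfield (S_ops M)\<^esub> l = fun_in M FMult [k, l]"
  "carrier (svecs (S_ops M)) = univ M VecS"
  "\<zero>\<^bsub>svecs (S_ops M)\<^esub> = fun_in M Zero []"
  "x \<oplus>\<^bsub>svecs (S_ops M)\<^esub> y = fun_in M Add [x, y]"
  "k \<odot>\<^bsub>svecs (S_ops M)\<^esub> x = fun_in M Scal [k, x]"
  "sgam (S_ops M) = univ M GamS" "sskel (S_ops M) = univ M SkelS"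
  "sless (S_ops M) a b \<longleftrightarrow> a \<in> univ M GamS \<and> b \<in> univ M GamS \<and> rel_in M Less [a, b]"
  "sadd (S_ops M) s t = fun_in M SAdd [s, t]" "szero (S_ops M) = fun_in M SZero []"
  "sscal (S_ops M) k s = fun_in M SScal [k, s]" "sval (S_ops M) s = fun_in M SVal [s]"
  "sproj (S_ops M) x = fun_in M Proj [x]"
  by (simp_all add: S_ops_def)

section \<open>Models as skeleton spaces\<close>

lemma bij_betw_elt:
  "bij_betw the_vec (Vec ` A) A" "bij_betw the_sca (Sca ` B) B" "bij_betw the_gam (Gam ` C) C"
  "bij_betw the_skel (Skel ` D) D"
  by (auto simp: bij_betw_def inj_on_def image_image)

lemma is_structureD:
  "is_structure L M \<Longrightarrow> f \<in> funs L \<Longrightarrow> xs \<in> args_in M (fun_args L f) \<Longrightarrow>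
    fun_in M f xs \<in> univ M (fun_sort L f)"
  by (simp add: is_structure_def)

lemma isomorphicE:
  assumes "isomorphic L M N"
  obtains h where "is_structure L M" "\<And>s. s \<in> sorts L \<Longrightarrow> bij_betw (h s) (univ M s) (univ N s)"
    "\<And>f xs. \<lbrakk>f \<in> funs L; xs \<in> args_in M (fun_args L f)\<rbrakk> \<Longrightarrow>
       h (fun_sort L f) (fun_in M f xs) = fun_in N f (map2 h (fun_args L f) xs)"
    "\<And>r xs. \<lbrakk>r \<in> rels L; xs \<in> args_in M (rel_args L r)\<rbrakk> \<Longrightarrow>
       rel_in M r xs \<longleftrightarrow> rel_in N r (map2 h (rel_args L r) xs)"
  using assms unfolding isomorphic_def by blast

lemma L_SK_simps:
  "sorts (L_SK K) = {VecS, GamS, SkelS}" "rels (L_SK K) = {Less}" "fun_args (L_SK K) = SK_args"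
  "fun_sort (L_SK K) = SK_sort" "rel_args (L_SK K) = vrel_args"
  by (simp_all add: L_SK_def)

lemma L_S_simps:
  "sorts L_S = UNIV" "funs L_S = UNIV" "rels L_S = {Less}" "fun_args L_S = S_args"
  "fun_sort L_S = S_sort" "rel_args L_S = vrel_args"
  by (simp_all add: L_S_def)

text \<open>Everything is pulled back from the standard structure. The last two conclusions express
  \<infinity> and val through \<open>sval\<close>, \<open>szero\<close> and \<open>sproj\<close>, as
  the skeleton language has no symbol for either of them.\<close>

lemma SK_model_space:
  assumes K: "field K" and M: "SK_model K M"
  shows "skel_space (SK_ops K M)" "is_structure (L_SK K) M"
    "fun_in M InftyK [] = sval (SK_ops K M) (szero (SK_ops K M))"
    "v \<in> univ M VecS \<Longrightarrow> fun_in M ValK [v] = sval (SK_ops K M) (sproj (SK_ops K M) v)"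
proof -
  obtain X :: "('a, 'b, 'b) vvs" where X: "valued_vector_space X" "base X = K"
    and iso: "isomorphic (L_SK K) M (SK_structure X)"
    using M by (auto simp: SK_model_def)
  interpret X: vvs_space X by (unfold_locales) (rule X(1))
  let ?T = "std_ops X"
  interpret T: skel_space ?T by (rule X.skel_space_std)
  obtain h where M: "is_structure (L_SK K) M"
    and bij: "\<And>s. s \<in> sorts (L_SK K) \<Longrightarrow> bij_betw (h s) (univ M s) (univ (SK_structure X) s)"
    and hf: "\<And>f xs. \<lbrakk>f \<in> funs (L_SK K); xs \<in> args_in M (fun_args (L_SK K) f)\<rbrakk> \<Longrightarrow>
       h (fun_sort (L_SK K) f) (fun_in M f xs) =
         fun_in (SK_structure X) f (map2 h (fun_args (L_SK K) f) xs)"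
    and hr: "\<And>r xs. \<lbrakk>r \<in> rels (L_SK K); xs \<in> args_in M (rel_args (L_SK K) r)\<rbrakk> \<Longrightarrow>
       rel_in M r xs \<longleftrightarrow> rel_in (SK_structure X) r (map2 h (rel_args (L_SK K) r) xs)"
    using isomorphicE[OF iso] by blast
  show "is_structure (L_SK K) M" by (rule M)
  note bij = bij[unfolded L_SK_simps SK_structure_def struct.simps]
  note hf = hf[unfolded L_SK_simps SK_structure_def struct.simps]
  note hr = hr[unfolded L_SK_simps SK_structure_def struct.simps, of Less, simplified]
  have cl: "fun_in M f xs \<in> univ M (SK_sort f)" if "f \<in> funs (L_SK K)" "xs \<in> args_in M (SK_args f)" for f xs
    using is_structureD[OF M that(1)] that(2) by (simp add: L_SK_def)
  \<comment> \<open>Removing the constructors \<open>Vec\<close>, \<open>Gam\<close> and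
    \<open>Skel\<close> turns the isomorphism of structures into maps to the components of
    \<open>X\<close>.\<close>
  define hv where "hv = the_vec \<circ> h VecS"
  define hg where "hg = the_gam \<circ> h GamS"
  define hs where "hs = the_skel \<circ> h SkelS"
  have bv: "bij_betw hv (univ M VecS) (carrier (vecs X))"
    and bg: "bij_betw hg (univ M GamS) (gam X)"
    and bs: "bij_betw hs (univ M SkelS) (skeleton X)"
    unfolding hv_def hg_def hs_def
    using bij_betw_trans[OF bij[of VecS, simplified] bij_betw_elt(1)]
      bij_betw_trans[OF bij[of GamS, simplified] bij_betw_elt(3)]
      bij_betw_trans[OF bij[of SkelS, simplified] bij_betw_elt(4)] by simp_all
  have fs: "AddK \<in> funs (L_SK K)" "ZeroK \<in> funs (L_SK K)" "InftyK \<in> funs (L_SK K)" "ValK \<in> funs (L_SK K)"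
    "SAddK \<in> funs (L_SK K)" "SZeroK \<in> funs (L_SK K)" "SValK \<in> funs (L_SK K)" "ProjK \<in> funs (L_SK K)"
    "k \<in> carrier K \<Longrightarrow> ScalK k \<in> funs (L_SK K)" "k \<in> carrier K \<Longrightarrow> SScalK k \<in> funs (L_SK K)" for k
    by (simp_all add: L_SK_def)
  note args = args_in_def hv_def hg_def hs_def
  interpret I: skel_iso "SK_ops K M" ?T id hv hg hs
  proof (intro skel_iso.intro skel_iso_axioms.intro T.skel_space_axioms, simp_all only: SK_ops_simps std_ops_simps)
    show "field K" by (rule K)
    show "id \<in> ring_iso K (base X)" by (simp add: X(2) ring_iso_def ring_hom_def)
    show "bij_betw hv (univ M VecS) (carrier (vecs X))" "bij_betw hg (univ M GamS) (gam X)"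
      "bij_betw hs (univ M SkelS) (skeleton X)" by (rule bv, rule bg, rule bs)
  next
    fix u v assume "u \<in> univ M VecS" "v \<in> univ M VecS"
    then show "fun_in M AddK [u, v] \<in> univ M VecS \<and> hv (fun_in M AddK [u, v]) = hv u \<oplus>\<^bsub>vecs X\<^esub> hv v"
      using cl[OF fs(1), of "[u, v]"] hf[OF fs(1), of "[u, v]"] by (simp add: args)
  next
    show "fun_in M ZeroK [] \<in> univ M VecS \<and> hv (fun_in M ZeroK []) = \<zero>\<^bsub>vecs X\<^esub>"
      using cl[OF fs(2), of "[]"] hf[OF fs(2), of "[]"] by (simp add: args)
  next
    fix k v assume "k \<in> carrier K" "v \<in> univ M VecS"
    then show "fun_in M (ScalK k) [v] \<in> univ M VecS \<and> hv (fun_in M (ScalK k) [v]) = id k \<odot>\<^bsub>vecs X\<^esub> hv v"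
      using cl[OF fs(9), of k "[v]"] hf[OF fs(9), of k "[v]"] by (simp add: args)
  next
    fix v assume "v \<in> univ M VecS"
    then show "fun_in M ProjK [v] \<in> univ M SkelS \<and> hs (fun_in M ProjK [v]) = skel_proj X (hv v)"
      using cl[OF fs(8), of "[v]"] hf[OF fs(8), of "[v]"] by (simp add: args)
  next
    show "fun_in M SZeroK [] \<in> univ M SkelS \<and> hs (fun_in M SZeroK []) = skel_zero X"
      using cl[OF fs(6), of "[]"] hf[OF fs(6), of "[]"] by (simp add: args)
  next
    fix u v assume "u \<in> univ M SkelS" "v \<in> univ M SkelS"
    then show "fun_in M SAddK [u, v] \<in> univ M SkelS \<and> hs (fun_in M SAddK [u, v]) = skel_add X (hs u) (hs v)"
      using cl[OF fs(5), of "[u, v]"] hf[OF fs(5), of "[u, v]"] by (simp add: args)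
  next
    fix k v assume "k \<in> carrier K" "v \<in> univ M SkelS"
    then show "fun_in M (SScalK k) [v] \<in> univ M SkelS \<and> hs (fun_in M (SScalK k) [v]) = skel_scal X (id k) (hs v)"
      using cl[OF fs(10), of k "[v]"] hf[OF fs(10), of k "[v]"] by (simp add: args)
  next
    fix v assume "v \<in> univ M SkelS"
    then show "fun_in M SValK [v] \<in> univ M GamS \<and> hg (fun_in M SValK [v]) = skel_val (hs v)"
      using cl[OF fs(7), of "[v]"] hf[OF fs(7), of "[v]"] by (simp add: args)
  next
    fix a b
    show "(a \<in> univ M GamS \<and> b \<in> univ M GamS \<and> rel_in M Less [a, b]) =
       (a \<in> univ M GamS \<and> b \<in> univ M GamS \<and> (hg a, hg b) \<in> lt X)"
      using hr[of "[a, b]"] by (auto simp: args)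
  qed
  show "skel_space (SK_ops K M)" by (rule I.skel_space_S)
  show "fun_in M InftyK [] = sval (SK_ops K M) (szero (SK_ops K M))"
  proof -
    have "hg (fun_in M InftyK []) = infty X" "fun_in M InftyK [] \<in> univ M GamS"
      using cl[OF fs(3), of "[]"] hf[OF fs(3), of "[]"] by (simp_all add: args)
    moreover have "hg (sval (SK_ops K M) (szero (SK_ops K M))) = infty X"
      using X.skel_val_class[OF X.zero_pair[OF X.infty_closed]]
      by (simp only: I.hom_simps) (simp add: skel_zero_def)
    ultimately show ?thesis using I.hg_eq I.hom_simps by simp
  qed
  show "fun_in M ValK [v] = sval (SK_ops K M) (sproj (SK_ops K M) v)" if v: "v \<in> univ M VecS"
  proof -
    have v': "v \<in> carrier (svecs (SK_ops K M))" using v by simp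
    have "hg (fun_in M ValK [v]) = vl X (hv v)" "fun_in M ValK [v] \<in> univ M GamS"
      using cl[OF fs(4), of "[v]"] hf[OF fs(4), of "[v]"] v by (simp_all add: args)
    moreover have "hg (sval (SK_ops K M) (sproj (SK_ops K M) v)) = vl X (hv v)"
      using X.skel_val_proj[of "hv v"] I.hv_closed[OF v']
      by (simp only: I.hom_simps v') simp
    ultimately show ?thesis using I.hg_eq I.hom_simps(7,15) v' by simp
  qed
qed

lemma S_model_space:
  assumes M: "S_model M"
  shows "skel_space (S_ops M)" "is_structure L_S M"
    "fun_in M Infty [] = sval (S_ops M) (szero (S_ops M))"
    "v \<in> univ M VecS \<Longrightarrow> fun_in M Val [v] = sval (S_ops M) (sproj (S_ops M) v)"
proof -
  obtain X :: "('a, 'a, 'a) vvs" where X: "valued_vector_space X"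
    and iso: "isomorphic L_S M (S_structure X)"
    using M by (auto simp: S_model_def)
  interpret X: vvs_space X by (unfold_locales) (rule X(1))
  let ?T = "std_ops X"
  interpret T: skel_space ?T by (rule X.skel_space_std)
  obtain h where M: "is_structure L_S M"
    and bij: "\<And>s. s \<in> sorts L_S \<Longrightarrow> bij_betw (h s) (univ M s) (univ (S_structure X) s)"
    and hf: "\<And>f xs. \<lbrakk>f \<in> funs L_S; xs \<in> args_in M (fun_args L_S f)\<rbrakk> \<Longrightarrow>
       h (fun_sort L_S f) (fun_in M f xs) =
         fun_in (S_structure X) f (map2 h (fun_args L_S f) xs)"
    and hr: "\<And>r xs. \<lbrakk>r \<in> rels L_S; xs \<in> args_in M (rel_args L_S r)\<rbrakk> \<Longrightarrow>
       rel_in M r xs \<longleftrightarrow> rel_in (S_structure X) r (map2 h (rel_args L_S r) xs)"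
    using isomorphicE[OF iso] by blast
  show "is_structure L_S M" by (rule M)
  note bij = bij[unfolded L_S_simps SK_structure_def S_structure_def struct.simps, OF UNIV_I]
  note hf = hf[unfolded L_S_simps S_structure_def struct.simps, OF UNIV_I]
  note hr = hr[unfolded L_S_simps S_structure_def struct.simps, of Less, simplified]
  have cl: "fun_in M f xs \<in> univ M (S_sort f)" if "xs \<in> args_in M (S_args f)" for f xs
    using is_structureD[OF M, of f xs] that by (simp add: L_S_def)
  define hk where "hk = the_sca \<circ> h FieldS"
  define hv where "hv = the_vec \<circ> h VecS"
  define hg where "hg = the_gam \<circ> h GamS"
  define hs where "hs = the_skel \<circ> h SkelS"
  have bv: "bij_betw hv (univ M VecS) (carrier (vecs X))"
    and bk: "bij_betw hk (univ M FieldS) (carrier (base X))"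
    and bg: "bij_betw hg (univ M GamS) (gam X)"
    and bs: "bij_betw hs (univ M SkelS) (skeleton X)"
    unfolding hv_def hg_def hs_def hk_def
    using bij_betw_trans[OF bij[of VecS, simplified] bij_betw_elt(1)]
      bij_betw_trans[OF bij[of FieldS, simplified] bij_betw_elt(2)]
      bij_betw_trans[OF bij[of GamS, simplified] bij_betw_elt(3)]
      bij_betw_trans[OF bij[of SkelS, simplified] bij_betw_elt(4)] by simp_all
  note args = args_in_def hv_def hg_def hs_def hk_def
  \<comment> \<open>Here the scalars are a sort of \<open>M\<close>, so the field axioms have to be
    transported as well.\<close>
  have fk: "field (sfield (S_ops M))" "hk \<in> ring_iso (sfield (S_ops M)) (base X)"
  proof -
    have b: "bij_betw hk (carrier (sfield (S_ops M))) (carrier (base X))" using bk by simp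
    have c: "a \<oplus>\<^bsub>sfield (S_ops M)\<^esub> b \<in> carrier (sfield (S_ops M))"
       "a \<otimes>\<^bsub>sfield (S_ops M)\<^esub> b \<in> carrier (sfield (S_ops M))"
       "hk (a \<oplus>\<^bsub>sfield (S_ops M)\<^esub> b) = hk a \<oplus>\<^bsub>base X\<^esub> hk b"
       "hk (a \<otimes>\<^bsub>sfield (S_ops M)\<^esub> b) = hk a \<otimes>\<^bsub>base X\<^esub> hk b"
      if "a \<in> carrier (sfield (S_ops M))" "b \<in> carrier (sfield (S_ops M))" for a b
      using cl[of "[a, b]" FAdd] hf[of "[a, b]" FAdd] cl[of "[a, b]" FMult] hf[of "[a, b]" FMult] that
      by (simp_all add: args)
    have z: "\<zero>\<^bsub>sfield (S_ops M)\<^esub> \<in> carrier (sfield (S_ops M))" "\<one>\<^bsub>sfield (S_ops M)\<^esub> \<in> carrier (sfield (S_ops M))"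
       "hk \<zero>\<^bsub>sfield (S_ops M)\<^esub> = \<zero>\<^bsub>base X\<^esub>" "hk \<one>\<^bsub>sfield (S_ops M)\<^esub> = \<one>\<^bsub>base X\<^esub>"
      using cl[of "[]" FZero] hf[of "[]" FZero] cl[of "[]" FOne] hf[of "[]" FOne]
      by (simp_all add: args)
    show "field (sfield (S_ops M))" "hk \<in> ring_iso (sfield (S_ops M)) (base X)"
      using field_iso_back[OF X.field_axioms b c(1,2) z(1,2) c(3,4) z(3,4)] by simp_all
  qed
  interpret I: skel_iso "S_ops M" ?T hk hv hg hs
  proof (intro skel_iso.intro skel_iso_axioms.intro T.skel_space_axioms, simp_all only: S_ops_simps std_ops_simps)
    show "field (sfield (S_ops M))" "hk \<in> ring_iso (sfield (S_ops M)) (base X)" by (rule fk)+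
    show "bij_betw hv (univ M VecS) (carrier (vecs X))" "bij_betw hg (univ M GamS) (gam X)"
      "bij_betw hs (univ M SkelS) (skeleton X)" by (rule bv, rule bg, rule bs)
  next
    fix u v assume "u \<in> univ M VecS" "v \<in> univ M VecS"
    then show "fun_in M Add [u, v] \<in> univ M VecS \<and> hv (fun_in M Add [u, v]) = hv u \<oplus>\<^bsub>vecs X\<^esub> hv v"
      using cl[of "[u, v]" Add] hf[of "[u, v]" Add] by (simp add: args)
  next
    show "fun_in M Zero [] \<in> univ M VecS \<and> hv (fun_in M Zero []) = \<zero>\<^bsub>vecs X\<^esub>"
      using cl[of "[]" Zero] hf[of "[]" Zero] by (simp add: args)
  next
    fix k v assume "k \<in> univ M FieldS" "v \<in> univ M VecS"
    then show "fun_in M Scal [k, v] \<in> univ M VecS \<and> hv (fun_in M Scal [k, v]) = hk k \<odot>\<^bsub>vecs X\<^esub> hv v"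
      using cl[of "[k, v]" Scal] hf[of "[k, v]" Scal] by (simp add: args)
  next
    fix v assume "v \<in> univ M VecS"
    then show "fun_in M Proj [v] \<in> univ M SkelS \<and> hs (fun_in M Proj [v]) = skel_proj X (hv v)"
      using cl[of "[v]" Proj] hf[of "[v]" Proj] by (simp add: args)
  next
    show "fun_in M SZero [] \<in> univ M SkelS \<and> hs (fun_in M SZero []) = skel_zero X"
      using cl[of "[]" SZero] hf[of "[]" SZero] by (simp add: args)
  next
    fix u v assume "u \<in> univ M SkelS" "v \<in> univ M SkelS"
    then show "fun_in M SAdd [u, v] \<in> univ M SkelS \<and> hs (fun_in M SAdd [u, v]) = skel_add X (hs u) (hs v)"
      using cl[of "[u, v]" SAdd] hf[of "[u, v]" SAdd] by (simp add: args)
  next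
    fix k v assume "k \<in> univ M FieldS" "v \<in> univ M SkelS"
    then show "fun_in M SScal [k, v] \<in> univ M SkelS \<and> hs (fun_in M SScal [k, v]) = skel_scal X (hk k) (hs v)"
      using cl[of "[k, v]" SScal] hf[of "[k, v]" SScal] by (simp add: args)
  next
    fix v assume "v \<in> univ M SkelS"
    then show "fun_in M SVal [v] \<in> univ M GamS \<and> hg (fun_in M SVal [v]) = skel_val (hs v)"
      using cl[of "[v]" SVal] hf[of "[v]" SVal] by (simp add: args)
  next
    fix a b
    show "(a \<in> univ M GamS \<and> b \<in> univ M GamS \<and> rel_in M Less [a, b]) =
       (a \<in> univ M GamS \<and> b \<in> univ M GamS \<and> (hg a, hg b) \<in> lt X)"
      using hr[of "[a, b]"] by (auto simp: args)
  qed
  show "skel_space (S_ops M)" by (rule I.skel_space_S)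
  show "fun_in M Infty [] = sval (S_ops M) (szero (S_ops M))"
  proof -
    have "hg (fun_in M Infty []) = infty X" "fun_in M Infty [] \<in> univ M GamS"
      using cl[of "[]" Infty] hf[of "[]" Infty] by (simp_all add: args)
    moreover have "hg (sval (S_ops M) (szero (S_ops M))) = infty X"
      using X.skel_val_class[OF X.zero_pair[OF X.infty_closed]]
      by (simp only: I.hom_simps) (simp add: skel_zero_def)
    ultimately show ?thesis using I.hg_eq I.hom_simps by simp
  qed
  show "fun_in M Val [v] = sval (S_ops M) (sproj (S_ops M) v)" if v: "v \<in> univ M VecS"
  proof -
    have v': "v \<in> carrier (svecs (S_ops M))" using v by simp
    have "hg (fun_in M Val [v]) = vl X (hv v)" "fun_in M Val [v] \<in> univ M GamS"
      using cl[of "[v]" Val] hf[of "[v]" Val] v by (simp_all add: args)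
    moreover have "hg (sval (S_ops M) (sproj (S_ops M) v)) = vl X (hv v)"
      using X.skel_val_proj[of "hv v"] I.hv_closed[OF v']
      by (simp only: I.hom_simps v') simp
    ultimately show ?thesis using I.hg_eq I.hom_simps(7,15) v' by simp
  qed
qed

text \<open>The symbols shared by both skeleton languages suffice to define \<open>sjoin\<close> and
  \<open>in_image\<close>, the two notions in which cancellation is expressed.\<close>

locale skel_language =
  fixes L :: "(vsort, 'f, vrel) language"
    and MM :: "(vsort, 'f, vrel, 'u) struct set"
    and Op :: "(vsort, 'f, vrel, 'u) struct \<Rightarrow> ('k, 'u, 'u, 'u) skel_ops"
    and fadd fzero fval :: 'f
  assumes sorts: "SkelS \<in> sorts L" "GamS \<in> sorts L"
    and fadd: "fadd \<in> funs L" "fun_args L fadd = [SkelS, SkelS]" "fun_sort L fadd = SkelS"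
    and fzero: "fzero \<in> funs L" "fun_args L fzero = []" "fun_sort L fzero = SkelS"
    and fval: "fval \<in> funs L" "fun_args L fval = [SkelS]" "fun_sort L fval = GamS"
    and less: "Less \<in> rels L" "rel_args L Less = [GamS, GamS]"
    and ops: "M \<in> MM \<Longrightarrow> sadd (Op M) a b = fun_in M fadd [a, b]"
      "M \<in> MM \<Longrightarrow> szero (Op M) = fun_in M fzero []"
      "M \<in> MM \<Longrightarrow> sval (Op M) a = fun_in M fval [a]"
      "M \<in> MM \<Longrightarrow> sless (Op M) g h \<longleftrightarrow> g \<in> univ M GamS \<and> h \<in> univ M GamS \<and> rel_in M Less [g, h]"
    and struct: "M \<in> MM \<Longrightarrow> is_structure L M"
begin

lemma sorts_ne: "sorts L \<noteq> {}"
  using sorts by blast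

lemma definable_sadd:
  assumes "definable_fun L MM SkelS F" "definable_fun L MM SkelS G"
  shows "definable_fun L MM SkelS (\<lambda>M e. sadd (Op M) (F M e) (G M e))"
  by (rule definable_fun_cong[OF definable_fun_app2[OF fadd sorts(1) struct assms]]) (simp_all add: ops)

lemma definable_szero: "definable_fun L MM SkelS (\<lambda>M e. szero (Op M))"
  by (rule definable_fun_cong[OF definable_fun_app0[OF fzero sorts(1) struct]]) (simp_all add: ops)

lemma definable_sval:
  assumes "definable_fun L MM SkelS F"
  shows "definable_fun L MM GamS (\<lambda>M e. sval (Op M) (F M e))"
  by (rule definable_fun_cong[OF definable_fun_app1[OF fval sorts(2) struct assms]]) (simp_all add: ops)

lemma definable_sless:
  assumes "definable_fun L MM GamS F" "definable_fun L MM GamS G"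
  shows "definable L MM (\<lambda>M e. sless (Op M) (F M e) (G M e))"
  by (rule definable_cong[OF definable_rel[OF finite_vsorts assms less]])
     (simp add: ops definable_fun_closed[OF assms(1)] definable_fun_closed[OF assms(2)])

lemma definable_sjoin:
  assumes "definable_fun L MM SkelS F" "definable_fun L MM SkelS G"
  shows "definable_fun L MM SkelS (\<lambda>M e. sjoin (Op M) (F M e) (G M e))"
  unfolding sjoin_def
  by (intro definable_fun_if finite_vsorts definable_sless definable_sval definable_sadd assms)

lemma definable_in_image:
  assumes "definable_fun L MM SkelS F"
  shows "definable L MM (\<lambda>M e. in_image (Op M) (F M e))"
  unfolding in_image_def
  by (intro definable_disj definable_not definable_eq[OF finite_vsorts, where s = SkelS]
      definable_sadd definable_szero assms)

end

section \<open>Fixed base field\<close>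

text \<open>\<open>MM\<close> will be the pair of models to be compared; one formula has to serve
  all its members.\<close>

locale SK_qe =
  fixes K :: "'k ring" and MM :: "(vsort, 'k SK_sym, vrel, 'u) struct set"
  assumes field: "field K" and models: "M \<in> MM \<Longrightarrow> SK_model K M"
begin

abbreviation "L \<equiv> L_SK K"
abbreviation "Ls \<equiv> L_SK_skel K"
abbreviation "Op \<equiv> SK_ops K"

lemma Ls_simps:
  "sorts Ls = {GamS, SkelS}" "rels Ls = {Less}" "fun_args Ls = SK_args"
  "fun_sort Ls = SK_sort" "rel_args Ls = vrel_args" "funs Ls = {SAddK, SZeroK, SValK} \<union> SScalK ` carrier K"
  by (simp_all add: L_SK_skel_def)

lemma space: "M \<in> MM \<Longrightarrow> skel_space (Op M)"
  using SK_model_space(1)[OF field models] .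

lemma struct: "M \<in> MM \<Longrightarrow> is_structure L M"
  using SK_model_space(2)[OF field models] .

lemma struct_s: "M \<in> MM \<Longrightarrow> is_structure Ls M"
  by (rule is_structure_mono[OF struct]) (auto simp: L_SK_def L_SK_skel_def)

sublocale skel_language Ls MM Op SAddK SZeroK SValK
  by unfold_locales (simp_all add: Ls_simps struct_s)

lemma definable_sscal:
  assumes "k \<in> carrier K" "definable_fun Ls MM SkelS F"
  shows "definable_fun Ls MM SkelS (\<lambda>M e. sscal (Op M) k (F M e))"
proof -
  have "definable_fun Ls MM SkelS (\<lambda>M e. fun_in M (SScalK k) [F M e])"
    using assms by (intro definable_fun_app1[where a = SkelS] struct_s) (simp_all add: Ls_simps)
  then show ?thesis by simp
qed

section \<open>Vector terms as linear functions of a variable\<close>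

definition vec_trm :: "(vsort, 'k SK_sym) trm \<Rightarrow> bool" where
  "vec_trm t \<longleftrightarrow> wf_trm L t \<and> sort_of L t = VecS"

lemma vec_trm_cases:
  assumes "vec_trm t"
  obtains n where "t = Var VecS n" | "t = App ZeroK []"
  | a b where "t = App AddK [a, b]" "vec_trm a" "vec_trm b"
  | k a where "t = App (ScalK k) [a]" "k \<in> carrier K" "vec_trm a"
proof (cases t)
  case (Var s n)
  then show ?thesis using assms that by (simp add: vec_trm_def)
next
  case (App f ts)
  with assms have f: "f \<in> funs L" "map (sort_of L) ts = SK_args f" "\<forall>t\<in>set ts. wf_trm L t" "SK_sort f = VecS"
    by (simp_all add: vec_trm_def L_SK_simps)
  then show ?thesis
  proof (cases f)
    case AddK
    with f obtain a b where "ts = [a, b]" by (auto simp: map_eq_Cons_conv)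
    then show ?thesis using f AddK App that by (simp add: vec_trm_def)
  next
    case (ScalK k)
    with f obtain a where "ts = [a]" by auto
    moreover have "k \<in> carrier K" using f(1) ScalK by (auto simp: L_SK_def)
    ultimately show ?thesis using f ScalK App that by (simp add: vec_trm_def)
  qed (use f App that in \<open>auto simp: vec_trm_def\<close>)
qed

lemma vec_trm_intros:
  "vec_trm (Var VecS n)" "vec_trm (App ZeroK [])"
  "vec_trm a \<Longrightarrow> vec_trm b \<Longrightarrow> vec_trm (App AddK [a, b])"
  "k \<in> carrier K \<Longrightarrow> vec_trm a \<Longrightarrow> vec_trm (App (ScalK k) [a])"
  by (simp_all add: vec_trm_def L_SK_def)

lemma vec_trm_induct [consumes 1, case_names var zero add scal]:
  assumes "vec_trm t" "\<And>n. P (Var VecS n)" "P (App ZeroK [])"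
    "\<And>a b. \<lbrakk>vec_trm a; vec_trm b; P a; P b\<rbrakk> \<Longrightarrow> P (App AddK [a, b])"
    "\<And>k a. \<lbrakk>k \<in> carrier K; vec_trm a; P a\<rbrakk> \<Longrightarrow> P (App (ScalK k) [a])"
  shows "P t"
  using assms(1)
proof (induction t)
  case (Var s n)
  then show ?case using assms(2) by (simp add: vec_trm_def)
next
  case (App f ts)
  from App.prems show ?case by (rule vec_trm_cases) (use App assms in auto)
qed

lemma vec_trm_closed:
  assumes "M \<in> MM" "good_env L M e" "vec_trm t"
  shows "trm_val M e t \<in> univ M VecS"
proof -
  interpret skel_space "Op M" by (rule space[OF assms(1)])
  from assms(3) show ?thesis
  proof (induction rule: vec_trm_induct)
    case (var n)
    then show ?case using assms(2) by (simp add: good_env_def L_SK_simps)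
  next
    case zero
    then show ?case using M.zero_closed by simp
  next
    case (add a b)
    then show ?case using M.add.m_closed[of "trm_val M e a" "trm_val M e b"] by simp
  next
    case (scal k a)
    then show ?case using smult_closed[of k "trm_val M e a"] by simp
  qed
qed

lemma vec_trm_cong:
  assumes "vec_trm t" "e VecS = e' VecS"
  shows "trm_val M e t = trm_val M e' t"
  using assms(1) by (induction rule: vec_trm_induct) (simp_all add: assms(2))

text \<open>\<open>c\<close> and \<open>l\<close> depend on the term and on \<open>x\<close> only,
  not on the model or the environment; this is possible because scalars are symbols of the language.
  \<open>l\<close> is evaluated in the old environment and so does not depend on the new value of
  \<open>x\<close>.\<close>

lemma trm_linear:
  assumes "vec_trm t"
  shows "\<exists>c l. c \<in> carrier K \<and> vec_trm l \<and>
    (\<forall>M\<in>MM. \<forall>e. good_env L M e \<longrightarrow> (\<forall>v\<in>univ M VecS.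
       trm_val M (e(VecS := (e VecS)(x := v))) t =
         (c \<odot>\<^bsub>svecs (Op M)\<^esub> v) \<oplus>\<^bsub>svecs (Op M)\<^esub> trm_val M e l))"
    (is "\<exists>c l. _ \<and> _ \<and> ?P t c l")
  using assms
proof (induction rule: vec_trm_induct)
  case (var n)
  interpret K: field K by (rule field)
  show ?case
  proof (cases "n = x")
    case True
    have "?P (Var VecS n) \<one>\<^bsub>K\<^esub> (App ZeroK [])"
    proof (intro ballI allI impI)
      fix M v and e :: "vsort \<Rightarrow> nat \<Rightarrow> 'u" assume M: "M \<in> MM" and v: "v \<in> univ M VecS"
      interpret skel_space "Op M" by (rule space[OF M])
      show "trm_val M (e(VecS := (e VecS)(x := v))) (Var VecS n) =
         (\<one>\<^bsub>K\<^esub> \<odot>\<^bsub>svecs (Op M)\<^esub> v) \<oplus>\<^bsub>svecs (Op M)\<^esub> trm_val M e (App ZeroK [])"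
        using smult_one[of v] M.r_zero[of v] v True by simp
    qed
    then show ?thesis using vec_trm_intros(2) K.one_closed by blast
  next
    case False
    have "?P (Var VecS n) \<zero>\<^bsub>K\<^esub> (Var VecS n)"
    proof (intro ballI allI impI)
      fix M v and e :: "vsort \<Rightarrow> nat \<Rightarrow> 'u" assume M: "M \<in> MM" and v: "v \<in> univ M VecS" and e: "good_env L M e"
      interpret skel_space "Op M" by (rule space[OF M])
      have "e VecS n \<in> univ M VecS" using e by (simp add: good_env_def L_SK_simps)
      then show "trm_val M (e(VecS := (e VecS)(x := v))) (Var VecS n) =
         (\<zero>\<^bsub>K\<^esub> \<odot>\<^bsub>svecs (Op M)\<^esub> v) \<oplus>\<^bsub>svecs (Op M)\<^esub> trm_val M e (Var VecS n)"
        using smult_l_null[of v] M.l_zero[of "e VecS n"] v False by simp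
    qed
    then show ?thesis using vec_trm_intros(1) K.zero_closed by blast
  qed
next
  case zero
  interpret K: field K by (rule field)
  have "?P (App ZeroK []) \<zero>\<^bsub>K\<^esub> (App ZeroK [])"
  proof (intro ballI allI impI)
    fix M v and e :: "vsort \<Rightarrow> nat \<Rightarrow> 'u" assume M: "M \<in> MM" and v: "v \<in> univ M VecS"
    interpret skel_space "Op M" by (rule space[OF M])
    show "trm_val M (e(VecS := (e VecS)(x := v))) (App ZeroK []) =
       (\<zero>\<^bsub>K\<^esub> \<odot>\<^bsub>svecs (Op M)\<^esub> v) \<oplus>\<^bsub>svecs (Op M)\<^esub> trm_val M e (App ZeroK [])"
      using smult_l_null[of v] M.l_zero[OF M.zero_closed] v by simp
  qed
  then show ?case using vec_trm_intros(2) K.zero_closed by blast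
next
  case (add a b)
  interpret K: field K by (rule field)
  obtain c l where cl: "c \<in> carrier K" "vec_trm l" "?P a c l" using add.IH(1) by blast
  obtain d m where dm: "d \<in> carrier K" "vec_trm m" "?P b d m" using add.IH(2) by blast
  have "?P (App AddK [a, b]) (c \<oplus>\<^bsub>K\<^esub> d) (App AddK [l, m])"
  proof (intro ballI allI impI)
    fix M v and e :: "vsort \<Rightarrow> nat \<Rightarrow> 'u" assume M: "M \<in> MM" and v: "v \<in> univ M VecS" and e: "good_env L M e"
    interpret skel_space "Op M" by (rule space[OF M])
    let ?e = "e(VecS := (e VecS)(x := v))" and ?U = "svecs (Op M)"
    have h: "trm_val M ?e a = c \<odot>\<^bsub>?U\<^esub> v \<oplus>\<^bsub>?U\<^esub> trm_val M e l"
      "trm_val M ?e b = d \<odot>\<^bsub>?U\<^esub> v \<oplus>\<^bsub>?U\<^esub> trm_val M e m"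
      using cl(3) dm(3) M v e by blast+
    have k: "c \<in> carrier (sfield (Op M))" "d \<in> carrier (sfield (Op M))" "v \<in> carrier ?U"
      "trm_val M e l \<in> carrier ?U" "trm_val M e m \<in> carrier ?U"
      using cl dm v vec_trm_closed[OF M e] by simp_all
    have "trm_val M ?e (App AddK [a, b]) = trm_val M ?e a \<oplus>\<^bsub>?U\<^esub> trm_val M ?e b" by simp
    also have "\<dots> = (c \<oplus>\<^bsub>sfield (Op M)\<^esub> d) \<odot>\<^bsub>?U\<^esub> v \<oplus>\<^bsub>?U\<^esub> (trm_val M e l \<oplus>\<^bsub>?U\<^esub> trm_val M e m)"
      unfolding h using k by (simp only: smult_l_distr smult_closed M.a_ac M.add.m_closed)
    finally show "trm_val M ?e (App AddK [a, b]) =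
        (c \<oplus>\<^bsub>K\<^esub> d) \<odot>\<^bsub>?U\<^esub> v \<oplus>\<^bsub>?U\<^esub> trm_val M e (App AddK [l, m])" by simp
  qed
  then show ?case using vec_trm_intros(3)[OF cl(2) dm(2)] K.add.m_closed[OF cl(1) dm(1)] by blast
next
  case (scal k a)
  interpret K: field K by (rule field)
  obtain c l where cl: "c \<in> carrier K" "vec_trm l" "?P a c l" using scal.IH by blast
  have "?P (App (ScalK k) [a]) (k \<otimes>\<^bsub>K\<^esub> c) (App (ScalK k) [l])"
  proof (intro ballI allI impI)
    fix M v and e :: "vsort \<Rightarrow> nat \<Rightarrow> 'u" assume M: "M \<in> MM" and v: "v \<in> univ M VecS" and e: "good_env L M e"
    interpret skel_space "Op M" by (rule space[OF M])
    let ?e = "e(VecS := (e VecS)(x := v))" and ?U = "svecs (Op M)"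
    have h: "trm_val M ?e a = c \<odot>\<^bsub>?U\<^esub> v \<oplus>\<^bsub>?U\<^esub> trm_val M e l"
      using cl(3) M v e by blast
    have k: "k \<in> carrier (sfield (Op M))" "c \<in> carrier (sfield (Op M))" "v \<in> carrier ?U"
      "trm_val M e l \<in> carrier ?U"
      using cl scal v vec_trm_closed[OF M e] by simp_all
    have "trm_val M ?e (App (ScalK k) [a]) = k \<odot>\<^bsub>?U\<^esub> trm_val M ?e a" by simp
    also have "\<dots> = (k \<otimes>\<^bsub>sfield (Op M)\<^esub> c) \<odot>\<^bsub>?U\<^esub> v \<oplus>\<^bsub>?U\<^esub> k \<odot>\<^bsub>?U\<^esub> trm_val M e l"
      unfolding h using k by (simp only: smult_r_distr smult_closed smult_assoc1)
    finally show "trm_val M ?e (App (ScalK k) [a]) =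
        (k \<otimes>\<^bsub>K\<^esub> c) \<odot>\<^bsub>?U\<^esub> v \<oplus>\<^bsub>?U\<^esub> trm_val M e (App (ScalK k) [l])" by simp
  qed
  then show ?case using vec_trm_intros(4)[OF scal(1) cl(2)] K.m_closed[OF scal(1) cl(1)] by blast
qed

text \<open>The index \<open>Inr t\<close> stands for \<open>\<pi>(t)\<close>; in the other sorts it only has a dummy value.\<close>

definition skel_env ::
  "(vsort, 'k SK_sym, vrel, 'u) struct \<Rightarrow> (vsort \<Rightarrow> nat \<Rightarrow> 'u) \<Rightarrow> vsort \<Rightarrow>
   nat + (vsort, 'k SK_sym) trm \<Rightarrow> 'u" where
  "skel_env M e s i = (case i of Inl n \<Rightarrow> e s n
     | Inr t \<Rightarrow> if s = SkelS then if vec_trm t then sproj (Op M) (trm_val M e t) else szero (Op M)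
        else sval (Op M) (szero (Op M)))"

lemma szero_closed: "M \<in> MM \<Longrightarrow> szero (Op M) \<in> univ M SkelS"
  using skel_space.proj_closed[OF space] skel_space.proj_zero[OF space]
  by (metis SK_ops_simps(2,7) abelian_groupE(2) module.axioms(2) skel_space.axioms(2) space)

lemma good_skel_env:
  assumes "M \<in> MM" "good_env L M e"
  shows "good_env Ls M (skel_env M e)"
proof -
  interpret skel_space "Op M" by (rule space[OF assms(1)])
  have "sproj (Op M) (trm_val M e t) \<in> univ M SkelS" if "vec_trm t" for t
    using proj_closed[of "trm_val M e t"] vec_trm_closed[OF assms that] by simp
  then show ?thesis using assms szero_closed[OF assms(1)] sval_closed[of "szero (Op M)"]
    by (auto simp: good_env_def Ls_simps L_SK_simps skel_env_def split: sum.splits)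
qed

text \<open>The only symbols leading from the vectors to another sort are \<open>ValK\<close> and
  \<open>ProjK\<close>, and both read a vector term through its class under \<pi> alone.\<close>

lemma skel_trm_definable:
  assumes "wf_trm L t" "sort_of L t \<noteq> VecS"
  shows "\<exists>F. definable_fun Ls MM (sort_of L t) F \<and>
    (\<forall>M\<in>MM. \<forall>e. good_env L M e \<longrightarrow> trm_val M e t = F M (skel_env M e))"
  using assms
proof (induction t)
  case (Var s n)
  then have "s \<in> sorts Ls" by (auto simp: L_SK_simps Ls_simps)
  from definable_fun_var[OF this, of MM "Inl n :: nat + (vsort, 'k SK_sym) trm"] show ?case
    by (intro exI[of _ "\<lambda>M e. e s (Inl n)"]) (simp add: skel_env_def)
next
  case (App f ts)
  then have f: "f \<in> funs L" "map (sort_of L) ts = SK_args f" "\<forall>t\<in>set ts. wf_trm L t" "SK_sort f \<noteq> VecS"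
    and sort: "sort_of L (App f ts) = SK_sort f"
    by (simp_all add: L_SK_simps)
  have var: "definable_fun Ls MM SkelS (\<lambda>M e. e SkelS i)" for i :: "nat + (vsort, 'k SK_sym) trm"
    by (rule definable_fun_var) (simp add: Ls_simps)
  have one: "\<exists>a F. ts = [a] \<and> definable_fun Ls MM SkelS F \<and>
      (\<forall>M\<in>MM. \<forall>e. good_env L M e \<longrightarrow> trm_val M e a = F M (skel_env M e))"
    if args: "SK_args f = [SkelS]"
  proof -
    obtain a where "ts = [a]" "sort_of L a = SkelS" using f(2) unfolding args by auto
    then show ?thesis using App.IH[of a] f(3) by auto
  qed
  show ?case
    unfolding sort
  proof (cases f)
    case InftyK
    then have ts: "ts = []" using f(2) by simp
    show "\<exists>F. definable_fun Ls MM (SK_sort f) F \<and>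
      (\<forall>M\<in>MM. \<forall>e. good_env L M e \<longrightarrow> trm_val M e (App f ts) = F M (skel_env M e))"
      using definable_sval[OF definable_szero] SK_model_space(3)[OF field models] InftyK ts
      by (intro exI[of _ "\<lambda>M e. sval (Op M) (szero (Op M))"]) simp
  next
    case ValK
    then obtain a where a: "ts = [a]" "sort_of L a = VecS" "wf_trm L a" using f(2,3) by auto
    then have v: "vec_trm a" by (simp add: vec_trm_def)
    have "trm_val M e (App f ts) = sval (Op M) (skel_env M e SkelS (Inr a))"
      if "M \<in> MM" "good_env L M e" for M e
      using SK_model_space(4)[OF field models[OF that(1)] vec_trm_closed[OF that v]] ValK a v
      by (simp add: skel_env_def)
    then show "\<exists>F. definable_fun Ls MM (SK_sort f) F \<and>
      (\<forall>M\<in>MM. \<forall>e. good_env L M e \<longrightarrow> trm_val M e (App f ts) = F M (skel_env M e))"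
      using definable_sval[OF var[of "Inr a"]] ValK
      by (intro exI[of _ "\<lambda>M e. sval (Op M) (e SkelS (Inr a))"]) simp
  next
    case ProjK
    then obtain a where a: "ts = [a]" "sort_of L a = VecS" "wf_trm L a" using f(2,3) by auto
    then show "\<exists>F. definable_fun Ls MM (SK_sort f) F \<and>
      (\<forall>M\<in>MM. \<forall>e. good_env L M e \<longrightarrow> trm_val M e (App f ts) = F M (skel_env M e))"
      using var[of "Inr a"] ProjK
      by (intro exI[of _ "\<lambda>M e. e SkelS (Inr a)"]) (simp add: skel_env_def vec_trm_def)
  next
    case SAddK
    then obtain a b where ab: "ts = [a, b]" "sort_of L a = SkelS" "sort_of L b = SkelS" "wf_trm L a" "wf_trm L b"
      using f(2,3) by (auto simp: map_eq_Cons_conv)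
    obtain F where F: "definable_fun Ls MM SkelS F"
      "\<forall>M\<in>MM. \<forall>e. good_env L M e \<longrightarrow> trm_val M e a = F M (skel_env M e)"
      using App.IH[of a] ab by auto
    obtain G where G: "definable_fun Ls MM SkelS G"
      "\<forall>M\<in>MM. \<forall>e. good_env L M e \<longrightarrow> trm_val M e b = G M (skel_env M e)"
      using App.IH[of b] ab by auto
    show "\<exists>F. definable_fun Ls MM (SK_sort f) F \<and>
      (\<forall>M\<in>MM. \<forall>e. good_env L M e \<longrightarrow> trm_val M e (App f ts) = F M (skel_env M e))"
      using definable_sadd[OF F(1) G(1)] F(2) G(2) SAddK ab
      by (intro exI[of _ "\<lambda>M e. sadd (Op M) (F M e) (G M e)"]) simp
  next
    case SZeroK
    then have ts: "ts = []" using f(2) by simp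
    show "\<exists>F. definable_fun Ls MM (SK_sort f) F \<and>
      (\<forall>M\<in>MM. \<forall>e. good_env L M e \<longrightarrow> trm_val M e (App f ts) = F M (skel_env M e))"
      using definable_szero SZeroK ts
      by (intro exI[of _ "\<lambda>M e. szero (Op M)"]) simp
  next
    case (SScalK k)
    then have k: "k \<in> carrier K" using f(1) by (auto simp: L_SK_def)
    obtain a F where a: "ts = [a]" and F: "definable_fun Ls MM SkelS F"
      "\<forall>M\<in>MM. \<forall>e. good_env L M e \<longrightarrow> trm_val M e a = F M (skel_env M e)"
      using one SScalK by auto
    show "\<exists>F. definable_fun Ls MM (SK_sort f) F \<and>
      (\<forall>M\<in>MM. \<forall>e. good_env L M e \<longrightarrow> trm_val M e (App f ts) = F M (skel_env M e))"
      using definable_sscal[OF k F(1)] F(2) SScalK a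
      by (intro exI[of _ "\<lambda>M e. sscal (Op M) k (F M e)"]) simp
  next
    case SValK
    obtain a F where a: "ts = [a]" and F: "definable_fun Ls MM SkelS F"
      "\<forall>M\<in>MM. \<forall>e. good_env L M e \<longrightarrow> trm_val M e a = F M (skel_env M e)"
      using one SValK by auto
    show "\<exists>F. definable_fun Ls MM (SK_sort f) F \<and>
      (\<forall>M\<in>MM. \<forall>e. good_env L M e \<longrightarrow> trm_val M e (App f ts) = F M (skel_env M e))"
      using definable_sval[OF F(1)] F(2) SValK a
      by (intro exI[of _ "\<lambda>M e. sval (Op M) (F M e)"]) simp
  qed (use f in simp_all)
qed

section \<open>Elimination of quantifiers over a fixed base field\<close>

definition diff_trm :: "(vsort, 'k SK_sym) trm \<Rightarrow> (vsort, 'k SK_sym) trm \<Rightarrow> (vsort, 'k SK_sym) trm" where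
  "diff_trm a b = App AddK [a, App (ScalK (\<ominus>\<^bsub>K\<^esub> \<one>\<^bsub>K\<^esub>)) [b]]"

text \<open>Since -1 belongs to the fixed field, it has a scalar symbol and differences are
  terms.\<close>

lemma diff_trm:
  assumes "vec_trm a" "vec_trm b"
  shows "vec_trm (diff_trm a b)"
    and "\<lbrakk>M \<in> MM; good_env L M e\<rbrakk> \<Longrightarrow>
      trm_val M e (diff_trm a b) = trm_val M e a \<ominus>\<^bsub>svecs (Op M)\<^esub> trm_val M e b"
proof -
  interpret K: field K by (rule field)
  show "vec_trm (diff_trm a b)" unfolding diff_trm_def using assms by (intro vec_trm_intros) simp_all
  assume M: "M \<in> MM" and e: "good_env L M e"
  interpret skel_space "Op M" by (rule space[OF M])
  show "trm_val M e (diff_trm a b) = trm_val M e a \<ominus>\<^bsub>svecs (Op M)\<^esub> trm_val M e b"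
    using minus_one_smult[of "trm_val M e b"] vec_trm_closed[OF M e assms(2)]
    by (simp add: diff_trm_def M.minus_eq)
qed

text \<open>A term in which \<open>x\<close> has coefficient c \<noteq> 0 equals c (x - a) for a
  term \<open>a\<close> without \<open>x\<close>, so the new skeleton environment is a function
  \<open>G\<close> of \<sigma> and the old one. By \<open>definable_support\<close> only finitely
  many terms matter, and the centre is chosen by a finite disjunction.\<close>

lemma sat_ex_vec:
  assumes Q: "definable Ls MM Q"
    and p: "\<And>M e. \<lbrakk>M \<in> MM; good_env L M e\<rbrakk> \<Longrightarrow> sat M e p = Q M (skel_env M e)"
  shows "\<exists>Q'. definable Ls MM Q' \<and> (\<forall>M\<in>MM. \<forall>e. good_env L M e \<longrightarrow>
    sat M e (Exists VecS x p) = Q' M (skel_env M e))"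
proof -
  interpret K: field K by (rule field)
  have "\<forall>t. \<exists>c l. vec_trm t \<longrightarrow> c \<in> carrier K \<and> vec_trm l \<and>
    (\<forall>M\<in>MM. \<forall>e. good_env L M e \<longrightarrow> (\<forall>v\<in>univ M VecS.
       trm_val M (e(VecS := (e VecS)(x := v))) t =
         (c \<odot>\<^bsub>svecs (Op M)\<^esub> v) \<oplus>\<^bsub>svecs (Op M)\<^esub> trm_val M e l))"
    using trm_linear[of _ x] by blast
  then obtain c l where cl: "\<forall>t. vec_trm t \<longrightarrow> c t \<in> carrier K \<and> vec_trm (l t) \<and>
    (\<forall>M\<in>MM. \<forall>e. good_env L M e \<longrightarrow> (\<forall>v\<in>univ M VecS.
       trm_val M (e(VecS := (e VecS)(x := v))) t =
         (c t \<odot>\<^bsub>svecs (Op M)\<^esub> v) \<oplus>\<^bsub>svecs (Op M)\<^esub> trm_val M e (l t)))"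
    unfolding choice_iff by (elim exE)
  have c: "c t \<in> carrier K" and l: "vec_trm (l t)" if "vec_trm t" for t
    using cl that by simp_all
  \<comment> \<open>The zero of \<open>t\<close> as a function of \<open>x\<close>: if c t \<noteq>
    0, then t takes the value c t (v - a t) at v.\<close>
  define a where "a = (\<lambda>t. App (ScalK (\<ominus>\<^bsub>K\<^esub> (inv\<^bsub>K\<^esub> (c t)))) [l t])"
  obtain I where I: "finite I" and supp': "\<And>M e e'. \<lbrakk>M \<in> MM; good_env Ls M e; good_env Ls M e';
      \<forall>s\<in>sorts Ls. \<forall>i\<in>I. e s i = e' s i\<rbrakk> \<Longrightarrow> Q M e = Q M e'"
    by (rule definable_support[OF Q]) (rule that)
  have supp: "Q M e = Q M e'" if "M \<in> MM" "good_env Ls M e" "good_env Ls M e'"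
    "\<And>s i. \<lbrakk>s \<in> sorts Ls; i \<in> I\<rbrakk> \<Longrightarrow> e s i = e' s i" for M e e'
    by (rule supp'[OF that(1-3)]) (use that(4) in blast)
  define T where "T = {t. Inr t \<in> I \<and> vec_trm t \<and> c t \<noteq> \<zero>\<^bsub>K\<^esub>}"
  \<comment> \<open>The zero term guarantees a centre even if no relevant term contains
    \<open>x\<close>.\<close>
  define A where "A = insert (App ZeroK []) (a ` T)"
  have "finite (Inr -` I)" using I by (intro finite_vimageI) auto
  then have "finite T" by (rule finite_subset[rotated]) (auto simp: T_def)
  then have finA: "finite A" by (simp add: A_def)
  have inv: "\<ominus>\<^bsub>K\<^esub> (inv\<^bsub>K\<^esub> (c t)) \<in> carrier K" if "vec_trm t" "c t \<noteq> \<zero>\<^bsub>K\<^esub>" for t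
    using that c[OF that(1)] K.field_Units by simp
  have a: "vec_trm (a t)" if "vec_trm t" "c t \<noteq> \<zero>\<^bsub>K\<^esub>" for t
    unfolding a_def using inv[OF that] l[OF that(1)] by (rule vec_trm_intros)
  have vecA: "vec_trm b" if "b \<in> A" for b
    using that a by (auto simp: A_def T_def vec_trm_intros)
  \<comment> \<open>\<open>G\<close> predicts the skeleton environment after \<open>x\<close> has
    received a value v with \<pi>(v - a0) = \<sigma>. Where \<open>x\<close> has coefficient 0, the
    entry is already known as that of \<open>l t\<close>.\<close>
  define G where "G = (\<lambda>a0 (s :: vsort) i M (\<sigma> :: 'u) e. case i of
      Inl n \<Rightarrow> e s (Inl n :: nat + (vsort, 'k SK_sym) trm)
    | Inr t \<Rightarrow> if s = SkelS then if vec_trm t then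
          if c t = \<zero>\<^bsub>K\<^esub> then e s (Inr (l t))
          else sscal (Op M) (c t) (sjoin (Op M) \<sigma> (e s (Inr (diff_trm a0 (a t)))))
        else szero (Op M) else e s (Inr t))"
  \<comment> \<open>Closeness of \<open>a0\<close> to \<open>x\<close> is replaced by the absence of
    cancellation, a condition on classes that already makes \<open>G\<close> correct.\<close>
  define R where "R = (\<lambda>a0 M \<sigma> e. in_image (Op M) \<sigma> \<and>
     (\<forall>b\<in>A. in_image (Op M) (sjoin (Op M) \<sigma> (e SkelS (Inr (diff_trm a0 b))))) \<and>
     Q M (\<lambda>s i. G a0 s i M \<sigma> e))"
  define Q' where "Q' = (\<lambda>M e. \<exists>a0\<in>A. \<exists>\<sigma>\<in>univ M SkelS. R a0 M \<sigma> e)"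
  have var: "definable_fun Ls MM s (\<lambda>M e. e s i)" if "s \<in> sorts Ls"
    for s and i :: "(nat + (vsort, 'k SK_sym) trm) + unit"
    using that by (rule definable_fun_var)
  have SkelS: "SkelS \<in> sorts Ls" by (simp add: Ls_simps)
  have G_def': "definable_fun Ls MM s (\<lambda>M (e :: vsort \<Rightarrow> (nat + (vsort, 'k SK_sym) trm) + unit \<Rightarrow> 'u).
      G a0 s i M (e SkelS (Inr ())) (\<lambda>s i. e s (Inl i)))" if s: "s \<in> sorts Ls" for a0 s i
  proof (cases i)
    case (Inl n)
    then show ?thesis using var[OF s] by (simp add: G_def)
  next
    case (Inr t)
    show ?thesis
    proof (cases "s = SkelS")
      case False
      then show ?thesis using var[OF s] by (simp add: G_def Inr)
    next
      case s: True
      show ?thesis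
      proof (cases "vec_trm t")
        case False
        then show ?thesis using definable_szero by (simp add: G_def Inr s)
      next
        case True
        then show ?thesis
          using var[OF SkelS] definable_sscal[OF c[OF True] definable_sjoin[OF var[OF SkelS] var[OF SkelS]]]
          by (cases "c t = \<zero>\<^bsub>K\<^esub>") (simp_all add: G_def Inr s)
      qed
    qed
  qed
  have "definable Ls MM Q'"
    unfolding Q'_def
  proof (intro definable_bex[OF finA sorts_ne] definable_bex_univ[OF _ SkelS])
    fix a0
    show "definable Ls MM (\<lambda>M (e :: vsort \<Rightarrow> (nat + (vsort, 'k SK_sym) trm) + unit \<Rightarrow> 'u).
      R a0 M (e SkelS (Inr ())) (\<lambda>s i. e s (Inl i)))"
      unfolding R_def
      by (intro definable_conj definable_ball[OF finA sorts_ne] definable_in_image definable_sjoin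
          var[OF SkelS] definable_subst[OF Q finite_vsorts] G_def')
  qed
  moreover have "sat M e (Exists VecS x p) = Q' M (skel_env M e)"
    if M: "M \<in> MM" and e: "good_env L M e" for M e
  proof -
    interpret skel_space "Op M" by (rule space[OF M])
    let ?ev = "\<lambda>v. e(VecS := (e VecS)(x := v))"
    let ?E = "skel_env M e"
    let ?t = "trm_val M e"
    have ev: "good_env L M (?ev v)" if "v \<in> univ M VecS" for v
      using e that by (auto simp: good_env_def)
    have tc: "?t b \<in> carrier (svecs (Op M))" if "vec_trm b" for b
      using vec_trm_closed[OF M e that] by simp
    have ER: "?E SkelS (Inr b) = sproj (Op M) (?t b)" if "vec_trm b" for b
      using that by (simp add: skel_env_def)
    have ED: "?E SkelS (Inr (diff_trm b b')) = sproj (Op M) (?t b \<ominus>\<^bsub>svecs (Op M)\<^esub> ?t b')"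
      if "vec_trm b" "vec_trm b'" for b b'
      using that diff_trm[OF that] M e by (simp add: ER)
    \<comment> \<open>\<open>Q\<close> sees only the indices in \<open>I\<close>, so the two
      environments are compared there. For such a term with c t \<noteq> 0 the point
      \<open>a t\<close> lies in \<open>A\<close>, and \<open>best\<close> applies.\<close>
    have key: "Q M (skel_env M (?ev v)) =
        Q M (\<lambda>s i. G a0 s i M (sproj (Op M) (v \<ominus>\<^bsub>svecs (Op M)\<^esub> ?t a0)) ?E)"
      if v: "v \<in> univ M VecS" and a0: "a0 \<in> A"
        and best: "\<And>b. b \<in> A \<Longrightarrow> sjoin (Op M) (sproj (Op M) (v \<ominus>\<^bsub>svecs (Op M)\<^esub> ?t a0))
            (?E SkelS (Inr (diff_trm a0 b))) = sproj (Op M) (v \<ominus>\<^bsub>svecs (Op M)\<^esub> ?t b)" for v a0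
    proof (rule supp[OF M good_skel_env[OF M ev[OF v]]])
      have v': "v \<in> carrier (svecs (Op M))" using v by simp
      let ?\<sigma> = "sproj (Op M) (v \<ominus>\<^bsub>svecs (Op M)\<^esub> ?t a0)"
      have \<sigma>: "?\<sigma> \<in> univ M SkelS"
        using proj_closed[OF M.minus_closed[OF v' tc[OF vecA[OF a0]]]] by simp
      \<comment> \<open>An auxiliary environment with \<sigma> at the extra index. It shows that
        \<open>G\<close> stays in the sorts, because its entries are definable functions.\<close>
      define F where "F = (\<lambda>s. case_sum (?E s) (\<lambda>_ :: unit. if s = SkelS then ?\<sigma> else ?E s (Inl 0)))"
      have F: "good_env Ls M F"
        using good_skel_env[OF M e] \<sigma> by (auto simp: F_def good_env_def split: sum.splits)
      have "G a0 s i M (F SkelS (Inr ())) (\<lambda>s i. F s (Inl i)) \<in> univ M s" if "s \<in> sorts Ls" for s i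
        using definable_fun_closed[OF G_def'[OF that] M F] .
      then show "good_env Ls M (\<lambda>s i. G a0 s i M ?\<sigma> ?E)"
        by (simp add: good_env_def F_def)
      fix s i assume s: "s \<in> sorts Ls" and i: "i \<in> I"
      show "skel_env M (?ev v) s i = G a0 s i M ?\<sigma> ?E"
      proof (cases i)
        case (Inl n)
        then show ?thesis using s by (auto simp: G_def skel_env_def Ls_simps)
      next
        case (Inr t)
        show ?thesis
        proof (cases "s = SkelS \<and> vec_trm t")
          case False
          then show ?thesis using s by (auto simp: G_def skel_env_def Ls_simps Inr)
        next
          case True
          then have t: "vec_trm t" and [simp]: "s = SkelS" by simp_all
          have lin: "trm_val M (?ev v) t = (c t \<odot>\<^bsub>svecs (Op M)\<^esub> v) \<oplus>\<^bsub>svecs (Op M)\<^esub> ?t (l t)"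
            using cl t M e v by blast
          have lhs: "skel_env M (?ev v) s i = sproj (Op M) (trm_val M (?ev v) t)"
            using t by (simp add: skel_env_def Inr)
          show ?thesis
          proof (cases "c t = \<zero>\<^bsub>K\<^esub>")
            case True
            then have "trm_val M (?ev v) t = ?t (l t)"
              unfolding lin using smult_l_null[OF v'] M.l_zero[OF tc[OF l[OF t]]] True by (simp only: SK_ops_simps(1))
            then show ?thesis unfolding lhs using ER[OF l[OF t]] True t by (simp add: G_def Inr)
          next
            case False
            have at: "a t \<in> A" using False t i Inr by (simp add: A_def T_def)
            have cc: "c t \<in> carrier (sfield (Op M))" "c t \<noteq> \<zero>\<^bsub>sfield (Op M)\<^esub>"
              using c[OF t] False by simp_all
            let ?l = "?t (l t)" and ?U = "svecs (Op M)" and ?K = "sfield (Op M)"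
            have lc: "?l \<in> carrier ?U" by (rule tc[OF l[OF t]])
            have "?t (a t) = (\<ominus>\<^bsub>?K\<^esub> (inv\<^bsub>?K\<^esub> (c t))) \<odot>\<^bsub>?U\<^esub> ?l" by (simp add: a_def)
            then have "?t (a t) = \<ominus>\<^bsub>?U\<^esub> (inv\<^bsub>?K\<^esub> (c t) \<odot>\<^bsub>?U\<^esub> ?l)"
              using smult_l_minus[OF inverse_props(1)[OF cc] lc] by (simp only:)
            then have "v \<ominus>\<^bsub>?U\<^esub> ?t (a t) = v \<oplus>\<^bsub>?U\<^esub> inv\<^bsub>?K\<^esub> (c t) \<odot>\<^bsub>?U\<^esub> ?l"
              using smult_closed[OF inverse_props(1)[OF cc] lc] by (simp only: M.minus_eq M.minus_minus)
            then have "c t \<odot>\<^bsub>?U\<^esub> (v \<ominus>\<^bsub>?U\<^esub> ?t (a t)) = c t \<odot>\<^bsub>?U\<^esub> v \<oplus>\<^bsub>?U\<^esub> ?l"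
              using smult_r_distr[OF cc(1) v' smult_closed[OF inverse_props(1)[OF cc] lc]]
                smult_assoc1[OF cc(1) inverse_props(1)[OF cc] lc] inverse_props(4)[OF cc] smult_one[OF lc]
              by (simp only:)
            then have "trm_val M (?ev v) t = c t \<odot>\<^bsub>?U\<^esub> (v \<ominus>\<^bsub>?U\<^esub> ?t (a t))" using lin by (simp only:)
            then have "sproj (Op M) (trm_val M (?ev v) t) =
                sscal (Op M) (c t) (sproj (Op M) (v \<ominus>\<^bsub>?U\<^esub> ?t (a t)))"
              using proj_smult[OF cc M.minus_closed[OF v' tc[OF a[OF t False]]]] by (simp only:)
            then show ?thesis unfolding lhs using best[OF at] False t by (simp add: G_def Inr)
          qed
        qed
      qed
    qed
    have bestE: "(\<lambda>b. ?t b) ` A \<subseteq> carrier (svecs (Op M))" "(\<lambda>b. ?t b) ` A \<noteq> {}" "finite ((\<lambda>b. ?t b) ` A)"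
    proof -
      show "(\<lambda>b. ?t b) ` A \<subseteq> carrier (svecs (Op M))" using tc vecA by blast
      show "(\<lambda>b. ?t b) ` A \<noteq> {}" by (simp add: A_def)
      show "finite ((\<lambda>b. ?t b) ` A)" using finA by (rule finite_imageI)
    qed
    show ?thesis
    proof
      assume "sat M e (Exists VecS x p)"
      then obtain v where v: "v \<in> univ M VecS" "sat M (?ev v) p" by auto
      then have v': "v \<in> carrier (svecs (Op M))" by simp
      obtain a1 where a1: "a1 \<in> ?t ` A" "\<And>b. b \<in> ?t ` A \<Longrightarrow>
          sjoin (Op M) (sproj (Op M) (v \<ominus>\<^bsub>svecs (Op M)\<^esub> a1)) (sproj (Op M) (a1 \<ominus>\<^bsub>svecs (Op M)\<^esub> b)) =
          sproj (Op M) (v \<ominus>\<^bsub>svecs (Op M)\<^esub> b)"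
        by (rule best_approximation[OF bestE(3,2,1) v']) (rule that)
      obtain a0 where a0: "a0 \<in> A" "a1 = ?t a0" using a1(1) by blast
      let ?\<sigma> = "sproj (Op M) (v \<ominus>\<^bsub>svecs (Op M)\<^esub> ?t a0)"
      have best: "sjoin (Op M) ?\<sigma> (?E SkelS (Inr (diff_trm a0 b))) = sproj (Op M) (v \<ominus>\<^bsub>svecs (Op M)\<^esub> ?t b)"
        if "b \<in> A" for b
        using a1(2)[of "?t b"] that a0 ED[OF vecA[OF a0(1)] vecA[OF that]] by simp
      have vc: "v \<ominus>\<^bsub>svecs (Op M)\<^esub> ?t b \<in> carrier (svecs (Op M))" if "b \<in> A" for b
        using v' tc[OF vecA[OF that]] by (rule M.minus_closed)
      have "R a0 M ?\<sigma> ?E"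
        unfolding R_def using key[OF v(1) a0(1) best] best p[OF M ev[OF v(1)]] v(2) proj_in_image vc a0(1) by simp
      moreover have "?\<sigma> \<in> univ M SkelS" using proj_closed[OF vc[OF a0(1)]] by simp
      ultimately show "Q' M ?E" unfolding Q'_def using a0(1) by blast
    next
      assume "Q' M ?E"
      then obtain a0 \<sigma> where a0: "a0 \<in> A" and \<sigma>: "\<sigma> \<in> univ M SkelS" and R: "R a0 M \<sigma> ?E"
        unfolding Q'_def by blast
      have "\<sigma> \<in> sproj (Op M) ` carrier (svecs (Op M))"
        using R \<sigma> proj_image by (simp add: R_def)
      then obtain z where z: "z \<in> carrier (svecs (Op M))" "\<sigma> = sproj (Op M) z" by blast
      let ?U = "svecs (Op M)"
      have a0c: "?t a0 \<in> carrier ?U" using tc[OF vecA[OF a0]] .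
      \<comment> \<open>Any preimage \<open>z\<close> of \<sigma>, moved to the centre, is a
        witness.\<close>
      define v where "v = z \<oplus>\<^bsub>?U\<^esub> ?t a0"
      have v: "v \<in> carrier ?U" using z(1) a0c unfolding v_def by (rule M.add.m_closed)
      have vz: "v \<ominus>\<^bsub>?U\<^esub> ?t b = z \<oplus>\<^bsub>?U\<^esub> (?t a0 \<ominus>\<^bsub>?U\<^esub> ?t b)" if "b \<in> A" for b
        using z(1) a0c tc[OF vecA[OF that]]
        by (simp only: v_def M.minus_eq M.a_assoc M.a_inv_closed M.add.m_closed)
      have vz0: "v \<ominus>\<^bsub>?U\<^esub> ?t a0 = z"
        using vz[OF a0] z(1) M.r_neg[OF a0c] M.r_zero[OF z(1)] by (simp only: M.minus_eq)
      have best: "sjoin (Op M) (sproj (Op M) (v \<ominus>\<^bsub>?U\<^esub> ?t a0)) (?E SkelS (Inr (diff_trm a0 b))) =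
          sproj (Op M) (v \<ominus>\<^bsub>?U\<^esub> ?t b)" if b: "b \<in> A" for b
      proof -
        have "in_image (Op M) (sjoin (Op M) (sproj (Op M) z) (sproj (Op M) (?t a0 \<ominus>\<^bsub>?U\<^esub> ?t b)))"
          using R b unfolding R_def z(2) ED[OF vecA[OF a0] vecA[OF b], symmetric] by blast
        then show ?thesis
          unfolding vz0 ED[OF vecA[OF a0] vecA[OF b]] vz[OF b]
          using sjoin_proj_image(1)[OF z(1) M.minus_closed[OF a0c tc[OF vecA[OF b]]]] by blast
      qed
      have vu: "v \<in> univ M VecS" using v by simp
      have "Q M (skel_env M (?ev v))"
        using key[OF vu a0 best] R by (simp only: vz0 R_def z(2))
      then have "sat M (?ev v) p" using p[OF M ev[OF vu]] by simp
      then show "sat M e (Exists VecS x p)" using vu by auto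
    qed
  qed
  ultimately show ?thesis by blast
qed

text \<open>Vector terms contain vector variables only, so changing a variable of another sort
  leaves all entries \<pi>(t) untouched.\<close>

lemma sat_ex_skel:
  assumes Q: "definable Ls MM Q" and s: "s \<in> sorts Ls"
    and p: "\<And>M e. \<lbrakk>M \<in> MM; good_env L M e\<rbrakk> \<Longrightarrow> sat M e p = Q M (skel_env M e)"
  shows "\<exists>Q'. definable Ls MM Q' \<and> (\<forall>M\<in>MM. \<forall>e. good_env L M e \<longrightarrow>
    sat M e (Exists s n p) = Q' M (skel_env M e))"
proof -
  let ?upd = "\<lambda>(v :: 'u) e s' i. if s' = s \<and> i = Inl n then v else e s' i"
  have var: "definable_fun Ls MM s' (\<lambda>M e. e s' i)" if "s' \<in> sorts Ls"
    for s' and i :: "(nat + (vsort, 'k SK_sym) trm) + unit"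
    using that by (rule definable_fun_var)
  have "definable_fun Ls MM s' (\<lambda>M (e :: vsort \<Rightarrow> (nat + (vsort, 'k SK_sym) trm) + unit \<Rightarrow> 'u).
      ?upd (e s (Inr ())) (\<lambda>s i. e s (Inl i)) s' i)" if "s' \<in> sorts Ls" for s' i
    using var[OF that] by (cases "s' = s \<and> i = Inl n") auto
  from definable_subst[OF Q finite_vsorts this]
  have "definable Ls MM (\<lambda>M e. \<exists>v\<in>univ M s. Q M (?upd v e))"
    by (intro definable_bex_univ[OF _ s])
  moreover have "sat M e (Exists s n p) = (\<exists>v\<in>univ M s. Q M (?upd v (skel_env M e)))"
    if M: "M \<in> MM" and e: "good_env L M e" for M e
  proof -
    have "s \<noteq> VecS" using s by (auto simp: Ls_simps)
    then have "skel_env M (e(s := (e s)(n := v))) = ?upd v (skel_env M e)" for v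
      using vec_trm_cong[of _ "e(s := (e s)(n := v))" e M]
      by (intro ext) (auto simp: skel_env_def split: sum.splits)
    moreover have "good_env L M (e(s := (e s)(n := v)))" if "v \<in> univ M s" for v
      using e that by (auto simp: good_env_def)
    ultimately show ?thesis using p[OF M] by simp
  qed
  ultimately show ?thesis by blast
qed

lemma sat_definable:
  assumes "wf_form L p"
  shows "\<exists>Q. definable Ls MM Q \<and> (\<forall>M\<in>MM. \<forall>e. good_env L M e \<longrightarrow> sat M e p = Q M (skel_env M e))"
  using assms
proof (induction p)
  case (Equal t u)
  then have tu: "wf_trm L t" "wf_trm L u" "sort_of L t = sort_of L u" by simp_all
  show ?case
  proof (cases "sort_of L t = VecS")
    case True
    then have v: "vec_trm t" "vec_trm u" using tu by (simp_all add: vec_trm_def)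
    \<comment> \<open>Two vectors are equal iff \<pi> of their difference is zero, which turns the
      equation into a condition on a single entry.\<close>
    have "definable Ls MM (\<lambda>M (e :: vsort \<Rightarrow> nat + (vsort, 'k SK_sym) trm \<Rightarrow> 'u).
        e SkelS (Inr (diff_trm t u)) = szero (Op M))"
      by (intro definable_eq[OF finite_vsorts, where s = SkelS] definable_szero definable_fun_var)
        (simp add: Ls_simps)
    moreover have "sat M e (Equal t u) = (skel_env M e SkelS (Inr (diff_trm t u)) = szero (Op M))"
      if M: "M \<in> MM" and e: "good_env L M e" for M e
    proof -
      interpret skel_space "Op M" by (rule space[OF M])
      let ?t = "trm_val M e t" and ?u = "trm_val M e u" and ?U = "svecs (Op M)"
      have c: "?t \<in> carrier ?U" "?u \<in> carrier ?U"
        using vec_trm_closed[OF M e] v by simp_all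
      have "skel_env M e SkelS (Inr (diff_trm t u)) = sproj (Op M) (?t \<ominus>\<^bsub>?U\<^esub> ?u)"
        using diff_trm[OF v] M e by (simp add: skel_env_def)
      moreover have "?t \<ominus>\<^bsub>?U\<^esub> ?u = \<zero>\<^bsub>?U\<^esub> \<longleftrightarrow> ?t = ?u"
        by (rule diff_eq_zero[OF c])
      ultimately show ?thesis using proj_eq_zero[OF M.minus_closed[OF c]] by simp
    qed
    ultimately show ?thesis by blast
  next
    case False
    obtain F where F: "definable_fun Ls MM (sort_of L t) F"
      "\<forall>M\<in>MM. \<forall>e. good_env L M e \<longrightarrow> trm_val M e t = F M (skel_env M e)"
      using skel_trm_definable[OF tu(1) False] by blast
    obtain G where G: "definable_fun Ls MM (sort_of L t) G"
      "\<forall>M\<in>MM. \<forall>e. good_env L M e \<longrightarrow> trm_val M e u = G M (skel_env M e)"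
      using skel_trm_definable[OF tu(2)] False tu(3) by auto
    show ?thesis using definable_eq[OF finite_vsorts F(1) G(1)] F(2) G(2)
      by (intro exI[of _ "\<lambda>M e. F M e = G M e"]) simp
  qed
next
  case (Atom r ts)
  then have r: "r = Less" by (cases r)
  then obtain t u where tu: "ts = [t, u]" "sort_of L t = GamS" "sort_of L u = GamS" "wf_trm L t" "wf_trm L u"
    using Atom by (auto simp: L_SK_simps map_eq_Cons_conv)
  obtain F where F: "definable_fun Ls MM GamS F"
    "\<forall>M\<in>MM. \<forall>e. good_env L M e \<longrightarrow> trm_val M e t = F M (skel_env M e)"
    using skel_trm_definable[OF tu(4)] tu by auto
  obtain G where G: "definable_fun Ls MM GamS G"
    "\<forall>M\<in>MM. \<forall>e. good_env L M e \<longrightarrow> trm_val M e u = G M (skel_env M e)"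
    using skel_trm_definable[OF tu(5)] tu by auto
  show ?case using definable_rel[OF finite_vsorts F(1) G(1) less] F(2) G(2) tu(1) r
    by (intro exI[of _ "\<lambda>M e. rel_in M Less [F M e, G M e]"]) simp
next
  case (Neg p)
  then obtain Q where "definable Ls MM Q"
    "\<forall>M\<in>MM. \<forall>e. good_env L M e \<longrightarrow> sat M e p = Q M (skel_env M e)" by auto
  then show ?case using definable_not[of Ls MM Q]
    by (intro exI[of _ "\<lambda>M e. \<not> Q M e"]) simp
next
  case (Conj p q)
  then obtain Q R where "definable Ls MM Q" "definable Ls MM R"
    "\<forall>M\<in>MM. \<forall>e. good_env L M e \<longrightarrow> sat M e p = Q M (skel_env M e)"
    "\<forall>M\<in>MM. \<forall>e. good_env L M e \<longrightarrow> sat M e q = R M (skel_env M e)" by auto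
  then show ?case using definable_conj[of Ls MM Q R]
    by (intro exI[of _ "\<lambda>M e. Q M e \<and> R M e"]) simp
next
  case (Exists s n p)
  then obtain Q where Q: "definable Ls MM Q"
    "\<forall>M\<in>MM. \<forall>e. good_env L M e \<longrightarrow> sat M e p = Q M (skel_env M e)" by auto
  have "s = VecS \<or> s \<in> sorts Ls" using Exists.prems by (auto simp: L_SK_simps Ls_simps)
  then show ?case
  proof
    assume "s = VecS"
    then show ?thesis using sat_ex_vec[OF Q(1)] Q(2) by blast
  next
    assume "s \<in> sorts Ls"
    then show ?thesis using sat_ex_skel[OF Q(1)] Q(2) by blast
  qed
qed

end

section \<open>Model completeness over a fixed base field\<close>

lemma SK_args_sorts: "f \<in> funs (L_SK K) \<Longrightarrow> set (fun_args (L_SK K) f) \<subseteq> sorts (L_SK K)"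
  by (cases f) (simp_all add: L_SK_simps)

text \<open>Terms and \<pi> have the same values in a substructure, so both models yield the same
  skeleton environment, dummy entries included. Only the definable condition on it remains to be
  transferred.\<close>

lemma SK_model_complete:
  assumes K: "field K" and V: "SK_model K V" and W: "SK_model K W" and sub: "substructure (L_SK K) V W"
  shows "elementary_substructure (L_SK K) V W \<longleftrightarrow> elementary_substructure (L_SK_skel K) V W"
proof
  assume "elementary_substructure (L_SK K) V W"
  then show "elementary_substructure (L_SK_skel K) V W"
    by (rule elementary_sublanguage) (auto simp: L_SK_def L_SK_skel_def)
next
  assume el: "elementary_substructure (L_SK_skel K) V W"
  interpret SK_qe K "{V, W}" by (rule SK_qe.intro) (use K V W in auto)
  show "elementary_substructure (L_SK K) V W"
    unfolding elementary_substructure_def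
  proof (intro conjI allI impI sub)
    fix p and e :: "vsort \<Rightarrow> nat \<Rightarrow> 'b"
    assume p: "wf_form (L_SK K) p" and "\<forall>s\<in>sorts (L_SK K). \<forall>n. e s n \<in> univ V s"
    then have e: "good_env L V e" by (simp add: good_env_def)
    have eW: "good_env L W e" using e sub unfolding good_env_def substructure_def by blast
    obtain Q where Q: "definable Ls {V, W} Q"
      "\<forall>M\<in>{V, W}. \<forall>e. good_env L M e \<longrightarrow> sat M e p = Q M (skel_env M e)"
      using sat_definable[OF p] by blast
    interpret V: skel_space "SK_ops K V" by (rule space) simp
    have fe: "fun_in V f xs = fun_in W f xs" if "f \<in> funs L" "xs \<in> args_in V (SK_args f)" for f xs
      using sub that by (simp add: substructure_def L_SK_simps)
    have z: "szero (Op V) = szero (Op W)" using fe[of SZeroK "[]"] by (simp add: args_in_def L_SK_def)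
    have zv: "sval (Op V) (szero (Op V)) = sval (Op W) (szero (Op V))"
      using fe[of SValK "[szero (Op V)]"] szero_closed[of V] by (simp add: args_in_def L_SK_def)
    have t: "trm_val V e t = trm_val W e t" "sproj (Op V) (trm_val V e t) = sproj (Op W) (trm_val V e t)"
      if "vec_trm t" for t
    proof -
      show "trm_val V e t = trm_val W e t"
        using substructure_trm_val[OF sub _ e SK_args_sorts] that by (simp add: vec_trm_def)
      show "sproj (Op V) (trm_val V e t) = sproj (Op W) (trm_val V e t)"
        using fe[of ProjK "[trm_val V e t]"] vec_trm_closed[OF _ e that] by (simp add: args_in_def L_SK_def)
    qed
    have E: "skel_env V e = skel_env W e"
    proof (intro ext)
      fix s i show "skel_env V e s i = skel_env W e s i"
        using z zv t by (cases i) (simp_all only: skel_env_def sum.case split: if_splits, metis+)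
    qed
    have "sat V e p = Q V (skel_env V e)" using Q(2) e by blast
    also have "\<dots> = Q W (skel_env V e)"
      by (rule elementary_definable[OF el Q(1) _ _ good_skel_env[OF _ e]]) simp_all
    also have "\<dots> = sat W e p" using Q(2) eW E by simp
    finally show "sat V e p = sat W e p" .
  qed
qed

section \<open>Variable base field\<close>

datatype coord = Orig nat | Bas nat | Coef nat nat

locale S_elim =
  fixes MM :: "(vsort, S_sym, vrel, 'u) struct set"
  assumes models: "M \<in> MM \<Longrightarrow> S_model M"
begin

abbreviation "Ls \<equiv> L_S_skel"
abbreviation "Op \<equiv> S_ops"

lemma Ls_simps:
  "sorts Ls = {FieldS, GamS, SkelS}" "rels Ls = {Less}" "fun_args Ls = S_args"
  "fun_sort Ls = S_sort" "rel_args Ls = vrel_args"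
  "funs Ls = {SAdd, SZero, FAdd, FMult, FZero, FOne, SScal, SVal}"
  by (simp_all add: L_S_skel_def)

lemma space: "M \<in> MM \<Longrightarrow> skel_space (Op M)"
  using S_model_space(1)[OF models] .

lemma struct: "M \<in> MM \<Longrightarrow> is_structure L_S M"
  using S_model_space(2)[OF models] .

lemma struct_s: "M \<in> MM \<Longrightarrow> is_structure Ls M"
  by (rule is_structure_mono[OF struct]) (auto simp: L_S_def L_S_skel_def)

lemma in_univ: "M \<in> MM \<Longrightarrow> xs \<in> args_in M (S_args f) \<Longrightarrow> fun_in M f xs \<in> univ M (S_sort f)"
  using is_structureD[OF struct, of M f xs] by (simp add: L_S_simps)

sublocale skel_language Ls MM Op SAdd SZero SVal
  by unfold_locales (simp_all add: Ls_simps struct_s)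

section \<open>Definable operations with scalars\<close>

lemma definable_fun_const:
  assumes "f \<in> {FZero, FOne}"
  shows "definable_fun Ls MM FieldS (\<lambda>M e. fun_in M f [])"
  using assms by (intro definable_fun_app0 struct_s) (auto simp: Ls_simps)

lemma definable_fun_field:
  assumes "f \<in> {FAdd, FMult}" "definable_fun Ls MM FieldS F" "definable_fun Ls MM FieldS G"
  shows "definable_fun Ls MM FieldS (\<lambda>M e. fun_in M f [F M e, G M e])"
  using assms by (intro definable_fun_app2[where a = FieldS and b = FieldS] struct_s) (auto simp: Ls_simps)

lemma definable_sscal:
  assumes "definable_fun Ls MM FieldS F" "definable_fun Ls MM SkelS G"
  shows "definable_fun Ls MM SkelS (\<lambda>M e. sscal (Op M) (F M e) (G M e))"
proof -
  have "definable_fun Ls MM SkelS (\<lambda>M e. fun_in M SScal [F M e, G M e])"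
    using assms by (intro definable_fun_app2[where a = FieldS and b = SkelS] struct_s) (simp_all add: Ls_simps)
  then show ?thesis by simp
qed

lemma definable_smul:
  assumes "definable_fun Ls MM FieldS F" "definable_fun Ls MM SkelS G"
  shows "definable_fun Ls MM SkelS (\<lambda>M e. smul (Op M) (F M e) (G M e))"
  unfolding smul_def S_ops_simps(2)
  by (intro definable_fun_if finite_vsorts definable_eq[OF finite_vsorts assms(1)] definable_szero
      definable_sscal assms definable_fun_const) simp

lemma definable_ssum:
  assumes "\<And>i. definable_fun Ls MM FieldS (C i)" "\<And>i. definable_fun Ls MM SkelS (G i)"
  shows "definable_fun Ls MM SkelS (\<lambda>M e. ssum (Op M) n (\<lambda>i. C i M e) (\<lambda>i. G i M e))"
proof (induction n)
  case 0
  then show ?case using definable_szero by simp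
next
  case (Suc n)
  show ?case
    unfolding ssum.simps by (intro definable_sjoin definable_smul Suc.IH assms)
qed

text \<open>The coefficients range over the sort of scalars and \<open>ssum\<close> reads only
  finitely many of them, so the universal quantifier over sequences is the dual of
  \<open>definable_ex\<close>.\<close>

lemma definable_separated:
  fixes G :: "nat \<Rightarrow> (vsort, S_sym, vrel, 'u) struct \<Rightarrow> (vsort \<Rightarrow> 'i \<Rightarrow> 'u) \<Rightarrow> 'u"
  assumes "\<And>i. definable_fun Ls MM SkelS (G i)"
  shows "definable Ls MM (\<lambda>M e. separated (Op M) n (\<lambda>i. G i M e))"
proof -
  have F: "FieldS \<in> sorts Ls" by (simp add: Ls_simps)
  let ?R = "\<lambda>M c e. \<not> (\<forall>m\<in>{..n}. in_image (Op M) (ssum (Op M) m c (\<lambda>i. G i M e)))"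
  have "definable Ls MM (\<lambda>M (e :: vsort \<Rightarrow> 'i + nat \<Rightarrow> 'u). ?R M (\<lambda>j. e FieldS (Inr j)) (\<lambda>s i. e s (Inl i)))"
    by (intro definable_not definable_ball sorts_ne definable_in_image definable_ssum
        definable_fun_var[OF F] definable_fun_rename[OF assms finite_vsorts]) simp
  from definable_not[OF definable_ex[OF this F]] show ?thesis
    by (rule definable_cong) (auto simp: separated_def)
qed

text \<open>The index \<open>Bas b\<close> stands for \<open>\<pi>(y\<^sub>b)\<close> and \<open>Coef j b\<close> for the coefficient of \<open>y\<^sub>b\<close> in the
  \<open>j\<close>-th vector variable; in the other sorts they have dummy values.\<close>

definition coord_env ::
  "(vsort, S_sym, vrel, 'u) struct \<Rightarrow> (vsort \<Rightarrow> nat \<Rightarrow> 'u) \<Rightarrow> (nat \<Rightarrow> nat \<Rightarrow> 'u) \<Rightarrow> (nat \<Rightarrow> 'u) \<Rightarrow>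
   vsort \<Rightarrow> coord \<Rightarrow> 'u" where
  "coord_env M e c \<sigma> s i =
    (let d = (case s of FieldS \<Rightarrow> fun_in M FZero [] | GamS \<Rightarrow> sval (Op M) (szero (Op M))
                | SkelS \<Rightarrow> szero (Op M) | VecS \<Rightarrow> undefined)
     in case i of Orig m \<Rightarrow> if s = VecS then d else e s m
        | Bas b \<Rightarrow> if s = SkelS then \<sigma> b else d
        | Coef j b \<Rightarrow> if s = FieldS then c j b else d)"

lemma good_coord_env:
  assumes M: "M \<in> MM" and e: "good_env L_S M e" and c: "\<And>j b. c j b \<in> univ M FieldS"
    and \<sigma>: "\<And>b. \<sigma> b \<in> univ M SkelS"
  shows "good_env Ls M (coord_env M e c \<sigma>)"
proof -
  have "fun_in M FZero [] \<in> univ M FieldS" "fun_in M SZero [] \<in> univ M SkelS"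
    using in_univ[OF M, of "[]" FZero] in_univ[OF M, of "[]" SZero] by (simp_all add: args_in_def)
  moreover from this have "fun_in M SVal [fun_in M SZero []] \<in> univ M GamS"
    using in_univ[OF M, of "[fun_in M SZero []]" SVal] by (simp add: args_in_def)
  ultimately show ?thesis using e c \<sigma>
    by (auto simp: good_env_def Ls_simps L_S_simps coord_env_def Let_def split: coord.splits)
qed

text \<open>One finite tuple has to span the values of all vector variables at once, although there
  are infinitely many. An environment is brought into this form by changing variables that the
  formula does not contain.\<close>

definition coordinates ::
  "(vsort, S_sym, vrel, 'u) struct \<Rightarrow> nat \<Rightarrow> (vsort \<Rightarrow> nat \<Rightarrow> 'u) \<Rightarrow> (nat \<Rightarrow> 'u) \<Rightarrow> (nat \<Rightarrow> nat \<Rightarrow> 'u) \<Rightarrow> bool" where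
  "coordinates M n e y c \<longleftrightarrow> M \<in> MM \<and> good_env L_S M e \<and> (\<forall>i. y i \<in> univ M VecS) \<and>
     (\<forall>j i. c j i \<in> univ M FieldS) \<and> separated (Op M) n (\<lambda>i. sproj (Op M) (y i)) \<and>
     (\<forall>j. e VecS j = lin (svecs (Op M)) n (c j) y)"

abbreviation "cenv M e y c \<equiv> coord_env M e c (\<lambda>i. sproj (Op M) (y i))"

lemma coordinates_good:
  assumes "coordinates M n e y c"
  shows "good_env Ls M (cenv M e y c)"
proof -
  have M: "M \<in> MM" using assms by (simp add: coordinates_def)
  interpret skel_space "Op M" by (rule space[OF M])
  have "sproj (Op M) (y i) \<in> univ M SkelS" for i
    using proj_closed[of "y i"] assms by (simp add: coordinates_def)
  then show ?thesis using assms by (intro good_coord_env M) (simp_all add: coordinates_def)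
qed

text \<open>Both halves are proved together, since scalar terms occur as factors of vectors and
  vector terms occur under val and \<pi>. Coefficients follow the vector operations, and \<pi> of
  the result is an \<open>ssum\<close>.\<close>

lemma trm_coordinates:
  assumes "wf_trm L_S t"
  shows "(sort_of L_S t = VecS \<longrightarrow> (\<exists>C. (\<forall>i. definable_fun Ls MM FieldS (C i)) \<and>
      (\<forall>M e y c. coordinates M n e y c \<longrightarrow>
         trm_val M e t = lin (svecs (Op M)) n (\<lambda>i. C i M (cenv M e y c)) y))) \<and>
    (sort_of L_S t \<noteq> VecS \<longrightarrow> (\<exists>F. definable_fun Ls MM (sort_of L_S t) F \<and>
      (\<forall>M e y c. coordinates M n e y c \<longrightarrow> trm_val M e t = F M (cenv M e y c))))"
    (is "?P t")
  using assms
proof (induction t)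
  case (Var s m)
  show ?case
  proof (cases "s = VecS")
    case True
    have "definable_fun Ls MM FieldS (\<lambda>M e. e FieldS (Coef m i))" for i
      by (rule definable_fun_var) (simp add: Ls_simps)
    moreover have "trm_val M e (Var s m) =
        lin (svecs (Op M)) n (\<lambda>i. cenv M e y c FieldS (Coef m i)) y" if "coordinates M n e y c" for M e y c
      using that True by (simp add: coordinates_def coord_env_def Let_def)
    ultimately show ?thesis using True
      by (simp del: trm_val.simps) (rule exI[of _ "\<lambda>i M e. e FieldS (Coef m i)"], simp)
  next
    case False
    then have "definable_fun Ls MM s (\<lambda>M e. e s (Orig m))"
      by (intro definable_fun_var) (cases s; simp add: Ls_simps)
    then show ?thesis using False
      by (simp add: L_S_simps) (rule exI[of _ "\<lambda>M e. e s (Orig m)"], simp add: coord_env_def Let_def)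
  qed
next
  case (App f ts)
  then have f: "map (sort_of L_S) ts = S_args f" "\<forall>t\<in>set ts. wf_trm L_S t"
    and sort: "sort_of L_S (App f ts) = S_sort f"
    by (simp_all add: L_S_simps)
  have IHF: "\<exists>F. definable_fun Ls MM (sort_of L_S t) F \<and>
      (\<forall>M e y c. coordinates M n e y c \<longrightarrow> trm_val M e t = F M (cenv M e y c))"
    if "t \<in> set ts" "sort_of L_S t \<noteq> VecS" for t
    using App.IH[OF that(1)] f(2) that by blast
  have IHC: "\<exists>C. (\<forall>i. definable_fun Ls MM FieldS (C i)) \<and>
      (\<forall>M e y c. coordinates M n e y c \<longrightarrow>
         trm_val M e t = lin (svecs (Op M)) n (\<lambda>i. C i M (cenv M e y c)) y)"
    if "t \<in> set ts" "sort_of L_S t = VecS" for t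
    using App.IH[OF that(1)] f(2) that by blast
  have base: "definable_fun Ls MM SkelS (\<lambda>M e. e SkelS (Bas i))" for i
    by (rule definable_fun_var) (simp add: Ls_simps)
  have two: "\<exists>a b. ts = [a, b] \<and> sort_of L_S a = s \<and> sort_of L_S b = s'" if args: "S_args f = [s, s']" for s s'
    using f(1) unfolding args by (auto simp: map_eq_Cons_conv)
  have one: "\<exists>a. ts = [a] \<and> sort_of L_S a = s" if args: "S_args f = [s]" for s
    using f(1) unfolding args by auto
  have zero: "ts = []" if args: "S_args f = []"
    using f(1) unfolding args by simp
  have vecI: "?P (App f ts)" if "S_sort f = VecS" "\<And>i. definable_fun Ls MM FieldS (C i)"
      "\<And>M e y c. coordinates M n e y c \<Longrightarrow>
         trm_val M e (App f ts) = lin (svecs (Op M)) n (\<lambda>i. C i M (cenv M e y c)) y" for C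
    unfolding sort using that by blast
  have funI: "?P (App f ts)" if "S_sort f \<noteq> VecS" "definable_fun Ls MM (S_sort f) F"
      "\<And>M e y c. coordinates M n e y c \<Longrightarrow> trm_val M e (App f ts) = F M (cenv M e y c)" for F
    unfolding sort using that by blast
  have closed: "C i M (cenv M e y c) \<in> carrier (sfield (Op M))"
    if "coordinates M n e y c" "\<And>i. definable_fun Ls MM FieldS (C i)" for C i M e y c
    using definable_fun_closed[OF that(2) _ coordinates_good[OF that(1)]] that(1) by (simp add: coordinates_def)
  have ycl: "y i \<in> carrier (svecs (Op M))" and sp: "skel_space (Op M)"
      and sepd: "separated (Op M) n (\<lambda>i. sproj (Op M) (y i))"
    if "coordinates M n e y c" for M e y c i
    using that space by (simp_all add: coordinates_def)
  have basE: "cenv M e y c SkelS (Bas i) = sproj (Op M) (y i)" for M e y c i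
    by (simp add: coord_env_def Let_def)
  \<comment> \<open>Separatedness is used here: it makes \<pi> of a vector computable from its
    coordinates and the classes of the tuple.\<close>
  have ssumE: "sproj (Op M) (lin (svecs (Op M)) n (\<lambda>i. C i M (cenv M e y c)) y) =
      ssum (Op M) n (\<lambda>i. C i M (cenv M e y c)) (\<lambda>i. cenv M e y c SkelS (Bas i))"
    if "coordinates M n e y c" "\<And>i. definable_fun Ls MM FieldS (C i)" for C M e y c
  proof -
    interpret skel_space "Op M" by (rule sp[OF that(1)])
    show ?thesis unfolding basE
      by (rule ssum_proj[OF sepd[OF that(1)] closed[OF that(1), of C, OF that(2)] ycl[OF that(1)]
            order_refl, symmetric])
  qed
  show ?case
  proof (cases f)
    case Add
    obtain a b where ab: "ts = [a, b]" "sort_of L_S a = VecS" "sort_of L_S b = VecS"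
      using two Add by auto
    obtain C where C: "\<And>i. definable_fun Ls MM FieldS (C i)" "\<And>M e y c. coordinates M n e y c \<Longrightarrow>
         trm_val M e a = lin (svecs (Op M)) n (\<lambda>i. C i M (cenv M e y c)) y" using IHC[of a] ab by auto
    obtain D where D: "\<And>i. definable_fun Ls MM FieldS (D i)" "\<And>M e y c. coordinates M n e y c \<Longrightarrow>
         trm_val M e b = lin (svecs (Op M)) n (\<lambda>i. D i M (cenv M e y c)) y" using IHC[of b] ab by auto
    show ?thesis
    proof (rule vecI[of "\<lambda>i M e. fun_in M FAdd [C i M e, D i M e]"])
      show "definable_fun Ls MM FieldS (\<lambda>M e. fun_in M FAdd [C i M e, D i M e])" for i
        using C(1) D(1) by (intro definable_fun_field) simp_all
      fix M e y c assume co: "coordinates M n e y c"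
      interpret skel_space "Op M" by (rule sp[OF co])
      show "trm_val M e (App f ts) =
          lin (svecs (Op M)) n (\<lambda>i. fun_in M FAdd [C i M (cenv M e y c), D i M (cenv M e y c)]) y"
        using lin_add[of "\<lambda>i. C i M (cenv M e y c)" "\<lambda>i. D i M (cenv M e y c)" y n,
            OF closed[OF co, of C, OF C(1)] closed[OF co, of D, OF D(1)] ycl[OF co]] C(2)[OF co] D(2)[OF co] ab Add by simp
    qed (simp add: Add)
  next
    case Zero
    then have ts: "ts = []" using zero by simp
    show ?thesis
    proof (rule vecI[of "\<lambda>i M e. fun_in M FZero []"])
      show "definable_fun Ls MM FieldS (\<lambda>M e. fun_in M FZero [])"
        by (rule definable_fun_const) simp
      fix M e y c assume co: "coordinates M n e y c"
      interpret skel_space "Op M" by (rule sp[OF co])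
      show "trm_val M e (App f ts) = lin (svecs (Op M)) n (\<lambda>i. fun_in M FZero []) y"
        using lin_zero[of y n, OF ycl[OF co]] ts Zero by simp
    qed (simp add: Zero)
  next
    case Scal
    obtain a b where ab: "ts = [a, b]" "sort_of L_S a = FieldS" "sort_of L_S b = VecS"
      using two Scal by auto
    obtain F where F: "definable_fun Ls MM FieldS F" "\<And>M e y c. coordinates M n e y c \<Longrightarrow>
         trm_val M e a = F M (cenv M e y c)" using IHF[of a] ab by auto
    obtain D where D: "\<And>i. definable_fun Ls MM FieldS (D i)" "\<And>M e y c. coordinates M n e y c \<Longrightarrow>
         trm_val M e b = lin (svecs (Op M)) n (\<lambda>i. D i M (cenv M e y c)) y" using IHC[of b] ab by auto
    show ?thesis
    proof (rule vecI[of "\<lambda>i M e. fun_in M FMult [F M e, D i M e]"])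
      show "definable_fun Ls MM FieldS (\<lambda>M e. fun_in M FMult [F M e, D i M e])" for i
        using F(1) D(1) by (intro definable_fun_field) simp_all
      fix M e y c assume co: "coordinates M n e y c"
      interpret skel_space "Op M" by (rule sp[OF co])
      show "trm_val M e (App f ts) =
          lin (svecs (Op M)) n (\<lambda>i. fun_in M FMult [F M (cenv M e y c), D i M (cenv M e y c)]) y"
        using lin_smult[of "F M (cenv M e y c)" "\<lambda>i. D i M (cenv M e y c)" y n,
            OF closed[OF co, of "\<lambda>_. F", OF F(1)] closed[OF co, of D, OF D(1)] ycl[OF co]] F(2)[OF co] D(2)[OF co] ab Scal by simp
    qed (simp add: Scal)
  next
    case Val
    obtain a where a: "ts = [a]" "sort_of L_S a = VecS" using one Val by auto
    obtain C where C: "\<And>i. definable_fun Ls MM FieldS (C i)" "\<And>M e y c. coordinates M n e y c \<Longrightarrow>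
         trm_val M e a = lin (svecs (Op M)) n (\<lambda>i. C i M (cenv M e y c)) y" using IHC[of a] a by auto
    show ?thesis
    proof (rule funI[of "\<lambda>M e. sval (Op M) (ssum (Op M) n (\<lambda>i. C i M e) (\<lambda>i. e SkelS (Bas i)))"])
      show "definable_fun Ls MM (S_sort f)
          (\<lambda>M e. sval (Op M) (ssum (Op M) n (\<lambda>i. C i M e) (\<lambda>i. e SkelS (Bas i))))"
        unfolding Val S_sort.simps by (intro definable_sval definable_ssum C(1) base)
      fix M e y c assume co: "coordinates M n e y c"
      interpret skel_space "Op M" by (rule sp[OF co])
      let ?v = "lin (svecs (Op M)) n (\<lambda>i. C i M (cenv M e y c)) y"
      have "?v \<in> carrier (svecs (Op M))"
        using lin_closed[OF closed[OF co, of C, OF C(1)] ycl[OF co]] .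
      then have "?v \<in> univ M VecS" by simp
      then have "fun_in M Val [?v] = sval (Op M) (sproj (Op M) ?v)"
        using S_model_space(4)[OF models] co by (simp add: coordinates_def)
      then show "trm_val M e (App f ts) = sval (Op M)
          (ssum (Op M) n (\<lambda>i. C i M (cenv M e y c)) (\<lambda>i. cenv M e y c SkelS (Bas i)))"
        unfolding ssumE[OF co, of C, OF C(1)] using C(2)[OF co] a Val by simp
    qed (simp add: Val)
  next
    case Proj
    obtain a where a: "ts = [a]" "sort_of L_S a = VecS" using one Proj by auto
    obtain C where C: "\<And>i. definable_fun Ls MM FieldS (C i)" "\<And>M e y c. coordinates M n e y c \<Longrightarrow>
         trm_val M e a = lin (svecs (Op M)) n (\<lambda>i. C i M (cenv M e y c)) y" using IHC[of a] a by auto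
    show ?thesis
    proof (rule funI[of "\<lambda>M e. ssum (Op M) n (\<lambda>i. C i M e) (\<lambda>i. e SkelS (Bas i))"])
      show "definable_fun Ls MM (S_sort f)
          (\<lambda>M e. ssum (Op M) n (\<lambda>i. C i M e) (\<lambda>i. e SkelS (Bas i)))"
        unfolding Proj S_sort.simps by (intro definable_ssum C(1) base)
      fix M e y c assume co: "coordinates M n e y c"
      show "trm_val M e (App f ts) =
          ssum (Op M) n (\<lambda>i. C i M (cenv M e y c)) (\<lambda>i. cenv M e y c SkelS (Bas i))"
        using ssumE[OF co, of C, OF C(1)] C(2)[OF co] a Proj by simp
    qed (simp add: Proj)
  next
    case FAdd
    obtain a b where ab: "ts = [a, b]" "sort_of L_S a = FieldS" "sort_of L_S b = FieldS"
      using two FAdd by auto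
    obtain F where F: "definable_fun Ls MM FieldS F" "\<And>M e y c. coordinates M n e y c \<Longrightarrow>
         trm_val M e a = F M (cenv M e y c)" using IHF[of a] ab by auto
    obtain G where G: "definable_fun Ls MM FieldS G" "\<And>M e y c. coordinates M n e y c \<Longrightarrow>
         trm_val M e b = G M (cenv M e y c)" using IHF[of b] ab by auto
    show ?thesis
      by (rule funI[of "\<lambda>M e. fun_in M FAdd [F M e, G M e]"])
        (simp_all add: FAdd ab F(2) G(2) definable_fun_field[OF _ F(1) G(1)])
  next
    case FMult
    obtain a b where ab: "ts = [a, b]" "sort_of L_S a = FieldS" "sort_of L_S b = FieldS"
      using two FMult by auto
    obtain F where F: "definable_fun Ls MM FieldS F" "\<And>M e y c. coordinates M n e y c \<Longrightarrow>
         trm_val M e a = F M (cenv M e y c)" using IHF[of a] ab by auto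
    obtain G where G: "definable_fun Ls MM FieldS G" "\<And>M e y c. coordinates M n e y c \<Longrightarrow>
         trm_val M e b = G M (cenv M e y c)" using IHF[of b] ab by auto
    show ?thesis
      by (rule funI[of "\<lambda>M e. fun_in M FMult [F M e, G M e]"])
        (simp_all add: FMult ab F(2) G(2) definable_fun_field[OF _ F(1) G(1)])
  next
    case FZero
    then show ?thesis using zero
      by (intro funI[of "\<lambda>M e. fun_in M FZero []"]) (simp_all add: definable_fun_const)
  next
    case FOne
    then show ?thesis using zero
      by (intro funI[of "\<lambda>M e. fun_in M FOne []"]) (simp_all add: definable_fun_const)
  next
    case Infty
    then have ts: "ts = []" using zero by simp
    have "trm_val M e (App f ts) = sval (Op M) (szero (Op M))" if "coordinates M n e y c" for M e y c
      using S_model_space(3)[OF models] that ts Infty by (simp add: coordinates_def)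
    then show ?thesis using definable_sval[OF definable_szero]
      by (intro funI[of "\<lambda>M e. sval (Op M) (szero (Op M))"]) (simp_all add: Infty)
  next
    case SAdd
    obtain a b where ab: "ts = [a, b]" "sort_of L_S a = SkelS" "sort_of L_S b = SkelS"
      using two SAdd by auto
    obtain F where F: "definable_fun Ls MM SkelS F" "\<And>M e y c. coordinates M n e y c \<Longrightarrow>
         trm_val M e a = F M (cenv M e y c)" using IHF[of a] ab by auto
    obtain G where G: "definable_fun Ls MM SkelS G" "\<And>M e y c. coordinates M n e y c \<Longrightarrow>
         trm_val M e b = G M (cenv M e y c)" using IHF[of b] ab by auto
    show ?thesis using definable_sadd[OF F(1) G(1)]
      by (intro funI[of "\<lambda>M e. sadd (Op M) (F M e) (G M e)"])
        (simp_all add: SAdd ab F(2) G(2))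
  next
    case SZero
    then show ?thesis using zero definable_szero
      by (intro funI[of "\<lambda>M e. szero (Op M)"]) simp_all
  next
    case SScal
    obtain a b where ab: "ts = [a, b]" "sort_of L_S a = FieldS" "sort_of L_S b = SkelS"
      using two SScal by auto
    obtain F where F: "definable_fun Ls MM FieldS F" "\<And>M e y c. coordinates M n e y c \<Longrightarrow>
         trm_val M e a = F M (cenv M e y c)" using IHF[of a] ab by auto
    obtain G where G: "definable_fun Ls MM SkelS G" "\<And>M e y c. coordinates M n e y c \<Longrightarrow>
         trm_val M e b = G M (cenv M e y c)" using IHF[of b] ab by auto
    show ?thesis using definable_sscal[OF F(1) G(1)]
      by (intro funI[of "\<lambda>M e. sscal (Op M) (F M e) (G M e)"])
        (simp_all add: SScal ab F(2) G(2))
  next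
    case SVal
    obtain a where a: "ts = [a]" "sort_of L_S a = SkelS" using one SVal by auto
    obtain F where F: "definable_fun Ls MM SkelS F" "\<And>M e y c. coordinates M n e y c \<Longrightarrow>
         trm_val M e a = F M (cenv M e y c)" using IHF[of a] a by auto
    show ?thesis using definable_sval[OF F(1)]
      by (intro funI[of "\<lambda>M e. sval (Op M) (F M e)"]) (simp_all add: SVal a F(2))
  qed
qed

section \<open>Elimination of quantifiers in coordinates\<close>

text \<open>By \<open>separated_extend\<close> a further vector amounts to coordinates
  \<open>k\<close> in the old tuple and one new entry, of which only the class \<sigma> matters.
  Hence the hypothesis concerns tuples of length \<open>Suc n\<close>, and one vector quantifier
  becomes quantifiers over \<open>k\<close> and \<sigma>.\<close>

lemma sat_ex_vec:
  assumes Q: "definable Ls MM Q"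
    and p: "\<And>M e y c. coordinates M (Suc n) e y c \<Longrightarrow> sat M e p = Q M (cenv M e y c)"
  shows "\<exists>Q'. definable Ls MM Q' \<and> (\<forall>M e y c. coordinates M n e y c \<longrightarrow>
    sat M e (Exists VecS x p) = Q' M (cenv M e y c))"
proof -
  \<comment> \<open>The coordinates after the extension: \<open>x\<close> gets \<open>k\<close> and
    a final 1, the other vectors a final 0. Index \<open>n\<close> lies beyond the old tuple, so its
    entries may be overwritten.\<close>
  define G where "G = (\<lambda>(s :: vsort) i (M :: (vsort, S_sym, vrel, 'u) struct) (k :: nat \<Rightarrow> 'u) (\<sigma> :: 'u) e. case i of
      Orig m \<Rightarrow> e s (Orig m)
    | Bas b \<Rightarrow> if s = SkelS \<and> b = n then \<sigma> else e s (Bas b)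
    | Coef j b \<Rightarrow> if s = FieldS then
        if j = x then if b = n then fun_in M FOne [] else k b
        else if b = n then fun_in M FZero [] else e s (Coef j b)
      else e s (Coef j b))"
  \<comment> \<open>Separatedness of the longer tuple is a condition on classes and can be imposed
    before a vector is chosen.\<close>
  define R where "R = (\<lambda>(M :: (vsort, S_sym, vrel, 'u) struct) k \<sigma> e. in_image (Op M) \<sigma> \<and>
    separated (Op M) (Suc n) (\<lambda>b. if b = n then \<sigma> else e SkelS (Bas b)) \<and>
    Q M (\<lambda>s i. G s i M k \<sigma> e))"
  define Q' where "Q' = (\<lambda>M e. \<exists>k. (\<forall>b. k b \<in> univ M FieldS) \<and> (\<exists>\<sigma>\<in>univ M SkelS. R M k \<sigma> e))"
  have F: "FieldS \<in> sorts Ls" and Sk: "SkelS \<in> sorts Ls" by (simp_all add: Ls_simps)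
  have var: "definable_fun Ls MM s (\<lambda>M e. e s i)" if "s \<in> sorts Ls"
    for s and i :: "(coord + nat) + unit"
    using that by (rule definable_fun_var)
  have const: "definable_fun Ls MM FieldS (\<lambda>M (e :: vsort \<Rightarrow> (coord + nat) + unit \<Rightarrow> 'u). fun_in M FZero [])"
    "definable_fun Ls MM FieldS (\<lambda>M (e :: vsort \<Rightarrow> (coord + nat) + unit \<Rightarrow> 'u). fun_in M FOne [])"
    by (rule definable_fun_const, simp)+
  have G_definable: "definable_fun Ls MM s (\<lambda>M (e :: vsort \<Rightarrow> (coord + nat) + unit \<Rightarrow> 'u).
      G s i M (\<lambda>b. e FieldS (Inl (Inr b))) (e SkelS (Inr ())) (\<lambda>s i. e s (Inl (Inl i))))"
    if s: "s \<in> sorts Ls" for s i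
  proof (cases i)
    case (Orig m)
    then show ?thesis using var[OF s] by (simp add: G_def)
  next
    case (Bas b)
    then show ?thesis using var[OF s] by (cases "s = SkelS \<and> b = n") (auto simp: G_def)
  next
    case (Coef j b)
    then show ?thesis using var[OF s] const
      by (cases "s = FieldS"; cases "j = x"; cases "b = n") (simp_all add: G_def)
  qed
  have sep: "definable_fun Ls MM SkelS (\<lambda>M (e :: vsort \<Rightarrow> (coord + nat) + unit \<Rightarrow> 'u).
      if b = n then e SkelS (Inr ()) else e SkelS (Inl (Inl (Bas b))))" for b
    using var[OF Sk] by (cases "b = n") simp_all
  have "definable Ls MM Q'"
    unfolding Q'_def
  proof (intro definable_ex[OF _ F] definable_bex_univ[OF _ Sk])
    show "definable Ls MM (\<lambda>M (e :: vsort \<Rightarrow> (coord + nat) + unit \<Rightarrow> 'u).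
       R M (\<lambda>b. e FieldS (Inl (Inr b))) (e SkelS (Inr ())) (\<lambda>s i. e s (Inl (Inl i))))"
      unfolding R_def
      by (intro definable_conj definable_in_image definable_separated sep
          var[OF Sk] definable_subst[OF Q finite_vsorts] G_definable)
  qed
  moreover have "sat M e (Exists VecS x p) = Q' M (cenv M e y c)" if co: "coordinates M n e y c" for M e y c
  proof -
    have M: "M \<in> MM" and e: "good_env L_S M e" using co by (simp_all add: coordinates_def)
    interpret skel_space "Op M" by (rule space[OF M])
    let ?U = "svecs (Op M)" and ?K = "sfield (Op M)"
    have y: "y i \<in> carrier ?U" and c: "c j i \<in> carrier ?K" for i j
      using co by (simp_all add: coordinates_def)
    have sepd: "separated (Op M) n (\<lambda>i. sproj (Op M) (y i))"
      and rep: "e VecS j = lin ?U n (c j) y" for j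
      using co by (simp_all add: coordinates_def)
    let ?ev = "\<lambda>v. e(VecS := (e VecS)(x := v))"
    define d where "d = (\<lambda>k j b. if j = x then (if b = n then \<one>\<^bsub>?K\<^esub> else k b)
        else (if b = n then \<zero>\<^bsub>?K\<^esub> else c j b))"
    have co': "coordinates M (Suc n) (?ev v) (y(n := z)) (d k)"
      if k: "\<forall>i. k i \<in> carrier ?K" and z: "z \<in> carrier ?U" "v = lin ?U n k y \<oplus>\<^bsub>?U\<^esub> z"
        and s: "separated (Op M) (Suc n) (\<lambda>i. sproj (Op M) ((y(n := z)) i))" for k z v
    proof -
      have lk: "lin ?U n k y \<in> carrier ?U" using k y by (intro lin_closed) blast+
      then have v: "v \<in> carrier ?U" using z by (simp only: M.add.m_closed)
      have "good_env L_S M (?ev v)" using e v by (auto simp: good_env_def)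
      moreover have "d k j i \<in> carrier ?K" for j i using k c field_closed(4,5) by (simp add: d_def)
      moreover have "(y(n := z)) i \<in> carrier ?U" for i using y z(1) by (cases "i = n") simp_all
      moreover have "?ev v VecS j = lin ?U (Suc n) (d k j) (y(n := z))" for j
      proof (cases "j = x")
        case True
        have "lin ?U (Suc n) (d k j) (y(n := z)) = v"
          unfolding z(2) d_def using lin_upd_one[of k y z n, OF spec[OF k] y z(1)] True by (simp only: simp_thms if_True)
        then show ?thesis using True by simp
      next
        case False
        have "lin ?U (Suc n) (d k j) (y(n := z)) = lin ?U n (c j) y"
          unfolding d_def using lin_upd_zero[of "c j" y z n, OF c y z(1)] False by (simp only: simp_thms if_False)
        then show ?thesis using False rep[of j] by simp
      qed
      ultimately show ?thesis using M s unfolding coordinates_def S_ops_simps(1,6) by blast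
    qed
    \<comment> \<open>\<open>cenv\<close> forgets the vectors and keeps coordinates and classes, so
      the effect of the extension on it is exactly \<open>G\<close>.\<close>
    have env: "cenv M (?ev v) (y(n := z)) (d k) = (\<lambda>s i. G s i M k (sproj (Op M) z) (cenv M e y c))"
      for v z k
      by (intro ext) (auto simp: coord_env_def G_def d_def Let_def split: coord.splits vsort.splits)
    have sfun: "(\<lambda>b. if b = n then sproj (Op M) z else cenv M e y c SkelS (Bas b)) =
        (\<lambda>i. sproj (Op M) ((y(n := z)) i))" for z
      by (intro ext) (simp add: coord_env_def Let_def)
    show ?thesis
    proof
      assume "sat M e (Exists VecS x p)"
      then obtain v where v: "v \<in> carrier ?U" "sat M (?ev v) p" by auto
      obtain k z where kz: "\<forall>i. k i \<in> carrier ?K" "z \<in> carrier ?U" "v = lin ?U n k y \<oplus>\<^bsub>?U\<^esub> z"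
        "separated (Op M) (Suc n) (\<lambda>i. sproj (Op M) ((y(n := z)) i))"
        by (rule separated_extend[OF sepd y v(1)]) (rule that)
      have "R M k (sproj (Op M) z) (cenv M e y c)"
        unfolding R_def sfun using proj_in_image[OF kz(2)] kz(4) p[OF co'[OF kz]] v(2)
        unfolding env by blast
      moreover have "sproj (Op M) z \<in> univ M SkelS" using proj_closed[OF kz(2)] by simp
      moreover have "\<forall>b. k b \<in> univ M FieldS" using kz(1) by simp
      ultimately show "Q' M (cenv M e y c)" unfolding Q'_def by blast
    next
      assume "Q' M (cenv M e y c)"
      then obtain k \<sigma> where k: "\<forall>b. k b \<in> univ M FieldS" and \<sigma>: "\<sigma> \<in> univ M SkelS"
        and R: "R M k \<sigma> (cenv M e y c)"
        unfolding Q'_def by blast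
      have k': "\<forall>i. k i \<in> carrier ?K" using k by simp
      have "\<sigma> \<in> sproj (Op M) ` carrier ?U" using R \<sigma> proj_image by (simp add: R_def)
      then obtain z where z: "z \<in> carrier ?U" "\<sigma> = sproj (Op M) z" by blast
      have s: "separated (Op M) (Suc n) (\<lambda>i. sproj (Op M) ((y(n := z)) i))"
        and q: "Q M (\<lambda>s i. G s i M k (sproj (Op M) z) (cenv M e y c))"
        using R unfolding R_def z(2) sfun by blast+
      \<comment> \<open>Any \<open>z\<close> with \<pi>(z) = \<sigma> works, since
        \<open>cenv\<close> reads it only through \<pi>.\<close>
      let ?v = "lin ?U n k y \<oplus>\<^bsub>?U\<^esub> z"
      have lk: "lin ?U n k y \<in> carrier ?U" using k' y by (intro lin_closed) blast+
      have v: "?v \<in> carrier ?U" using lk z(1) by (rule M.add.m_closed)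
      have "sat M (?ev ?v) p"
        using p[OF co'[OF k' z(1) refl s]] q unfolding env by blast
      moreover have "?v \<in> univ M VecS" using v by (simp only: S_ops_simps)
      ultimately show "sat M e (Exists VecS x p)" unfolding sat.simps by blast
    qed
  qed
  ultimately show ?thesis by blast
qed

text \<open>Coordinates describe the values of the vector variables, so a new value for a variable
  of another sort, scalars included, does not disturb them.\<close>

lemma sat_ex_skel:
  assumes Q: "definable Ls MM Q" and s: "s \<noteq> VecS"
    and p: "\<And>M e y c. coordinates M n e y c \<Longrightarrow> sat M e p = Q M (cenv M e y c)"
  shows "\<exists>Q'. definable Ls MM Q' \<and> (\<forall>M e y c. coordinates M n e y c \<longrightarrow>
    sat M e (Exists s m p) = Q' M (cenv M e y c))"
proof -
  have sL: "s \<in> sorts Ls" using s by (cases s) (simp_all add: Ls_simps)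
  let ?upd = "\<lambda>(v :: 'u) e s' i. if s' = s \<and> i = Orig m then v else e s' i"
  have var: "definable_fun Ls MM s' (\<lambda>M e. e s' i)" if "s' \<in> sorts Ls"
    for s' and i :: "coord + unit"
    using that by (rule definable_fun_var)
  have "definable_fun Ls MM s' (\<lambda>M (e :: vsort \<Rightarrow> coord + unit \<Rightarrow> 'u).
      ?upd (e s (Inr ())) (\<lambda>s i. e s (Inl i)) s' i)" if "s' \<in> sorts Ls" for s' i
    using var[OF that] by (cases "s' = s \<and> i = Orig m") auto
  from definable_subst[OF Q finite_vsorts this]
  have "definable Ls MM (\<lambda>M e. \<exists>v\<in>univ M s. Q M (?upd v e))"
    by (intro definable_bex_univ[OF _ sL])
  moreover have "sat M e (Exists s m p) = (\<exists>v\<in>univ M s. Q M (?upd v (cenv M e y c)))"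
    if co: "coordinates M n e y c" for M e y c
  proof -
    have env: "cenv M (e(s := (e s)(m := v))) y c = ?upd v (cenv M e y c)" for v
      using s by (intro ext) (auto simp: coord_env_def Let_def split: coord.splits)
    have "coordinates M n (e(s := (e s)(m := v))) y c" if "v \<in> univ M s" for v
      using co that s by (auto simp: coordinates_def good_env_def)
    from p[OF this] have "sat M (e(s := (e s)(m := v))) p = Q M (?upd v (cenv M e y c))"
      if "v \<in> univ M s" for v
      using that unfolding env by blast
    then show ?thesis unfolding sat.simps by blast
  qed
  ultimately show ?thesis by blast
qed

lemma trm_vec_coordinates:
  assumes "wf_trm L_S t" "sort_of L_S t = VecS"
  obtains C where "\<forall>i. definable_fun Ls MM FieldS (C i)"
    "\<forall>M e y c. coordinates M n e y c \<longrightarrow>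
         trm_val M e t = lin (svecs (Op M)) n (\<lambda>i. C i M (cenv M e y c)) y"
  using trm_coordinates[OF assms(1), of n] assms(2) by blast

lemma trm_skel_coordinates:
  assumes "wf_trm L_S t" "sort_of L_S t \<noteq> VecS"
  obtains F where "definable_fun Ls MM (sort_of L_S t) F"
    "\<forall>M e y c. coordinates M n e y c \<longrightarrow> trm_val M e t = F M (cenv M e y c)"
  using trm_coordinates[OF assms(1), of n] assms(2) by blast

text \<open>There is no symbol for \<open>-1\<close>, so equality of two vectors is expressed by the difference
  \<open>t + k u\<close> with \<open>1 + k = 0\<close>.\<close>

lemma sat_equal_vec:
  assumes wf: "wf_trm L_S t" "wf_trm L_S u" "sort_of L_S t = VecS" "sort_of L_S u = VecS"
  shows "\<exists>Q. definable Ls MM Q \<and> (\<forall>M e y c. coordinates M n e y c \<longrightarrow>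
    sat M e (Equal t u) = Q M (cenv M e y c))"
proof -
  obtain C where C: "\<forall>i. definable_fun Ls MM FieldS (C i)"
    "\<forall>M e y c. coordinates M n e y c \<longrightarrow>
         trm_val M e t = lin (svecs (Op M)) n (\<lambda>i. C i M (cenv M e y c)) y"
    by (rule trm_vec_coordinates[OF wf(1,3)]) (rule that)
  obtain D where D: "\<forall>i. definable_fun Ls MM FieldS (D i)"
    "\<forall>M e y c. coordinates M n e y c \<longrightarrow>
         trm_val M e u = lin (svecs (Op M)) n (\<lambda>i. D i M (cenv M e y c)) y"
    by (rule trm_vec_coordinates[OF wf(2,4)]) (rule that)
  define R where "R = (\<lambda>(M :: (vsort, S_sym, vrel, 'u) struct) k e. fun_in M FAdd [fun_in M FOne [], k] = fun_in M FZero [] \<and>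
     ssum (Op M) n (\<lambda>i. fun_in M FAdd [C i M e, fun_in M FMult [k, D i M e]]) (\<lambda>i. e SkelS (Bas i)) =
       szero (Op M))"
  have F: "FieldS \<in> sorts Ls" and Sk: "SkelS \<in> sorts Ls" by (simp_all add: Ls_simps)
  have var: "definable_fun Ls MM s (\<lambda>M e. e s i)" if "s \<in> sorts Ls" for s and i :: "coord + unit"
    using that by (rule definable_fun_var)
  have CD: "definable_fun Ls MM FieldS (\<lambda>M (e :: vsort \<Rightarrow> coord + unit \<Rightarrow> 'u). C i M (\<lambda>s j. e s (Inl j)))"
    "definable_fun Ls MM FieldS (\<lambda>M (e :: vsort \<Rightarrow> coord + unit \<Rightarrow> 'u). D i M (\<lambda>s j. e s (Inl j)))" for i
    using definable_fun_rename[OF _ finite_vsorts, where r = Inl] C(1) D(1) by blast+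
  have def: "definable Ls MM (\<lambda>M e. \<exists>k\<in>univ M FieldS. R M k e)"
  proof (rule definable_bex_univ[OF _ F])
    show "definable Ls MM (\<lambda>M (e :: vsort \<Rightarrow> coord + unit \<Rightarrow> 'u). R M (e FieldS (Inr ())) (\<lambda>s i. e s (Inl i)))"
      unfolding R_def
      by (intro definable_conj definable_eq[OF finite_vsorts, where s = FieldS]
          definable_eq[OF finite_vsorts, where s = SkelS] definable_ssum definable_szero
          definable_fun_field definable_fun_const var[OF F] var[OF Sk] CD) simp_all
  qed
  have "sat M e (Equal t u) = (\<exists>k\<in>univ M FieldS. R M k (cenv M e y c))"
    if co: "coordinates M n e y c" for M e y c
  proof -
    have M: "M \<in> MM" using co by (simp add: coordinates_def)
    interpret skel_space "Op M" by (rule space[OF M])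
    let ?U = "svecs (Op M)" and ?K = "sfield (Op M)" and ?E = "cenv M e y c"
    let ?C = "\<lambda>i. C i M ?E" and ?D = "\<lambda>i. D i M ?E"
    have y: "y i \<in> carrier ?U" for i using co by (simp add: coordinates_def)
    have sepd: "separated (Op M) n (\<lambda>i. sproj (Op M) (y i))" using co by (simp add: coordinates_def)
    have c: "?C i \<in> carrier ?K" "?D i \<in> carrier ?K" for i
      using definable_fun_closed[OF spec[OF C(1)] M coordinates_good[OF co]]
        definable_fun_closed[OF spec[OF D(1)] M coordinates_good[OF co]] by simp_all
    have tc: "trm_val M e t = lin ?U n ?C y" "trm_val M e u = lin ?U n ?D y"
      using C(2) D(2) co by blast+
    have lc: "lin ?U n ?C y \<in> carrier ?U" "lin ?U n ?D y \<in> carrier ?U"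
      using lin_closed[of ?C y n, OF c(1) y] lin_closed[of ?D y n, OF c(2) y] .
    \<comment> \<open>The sums of coefficients in \<open>R\<close> are the coordinates of t + k u,
      and this vector vanishes iff its \<open>ssum\<close> is zero.\<close>
    have R: "R M k ?E \<longleftrightarrow> \<one>\<^bsub>?K\<^esub> \<oplus>\<^bsub>?K\<^esub> k = \<zero>\<^bsub>?K\<^esub> \<and>
        lin ?U n ?C y \<oplus>\<^bsub>?U\<^esub> k \<odot>\<^bsub>?U\<^esub> lin ?U n ?D y = \<zero>\<^bsub>?U\<^esub>" if k: "k \<in> carrier ?K" for k
    proof -
      have kD: "k \<otimes>\<^bsub>?K\<^esub> ?D i \<in> carrier ?K" for i using k c(2) by (rule field_closed(2))
      have s: "?C i \<oplus>\<^bsub>?K\<^esub> k \<otimes>\<^bsub>?K\<^esub> ?D i \<in> carrier ?K" for i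
        using c(1) kD by (rule field_closed(1))
      have "ssum (Op M) n (\<lambda>i. ?C i \<oplus>\<^bsub>?K\<^esub> k \<otimes>\<^bsub>?K\<^esub> ?D i) (\<lambda>i. sproj (Op M) (y i)) =
          sproj (Op M) (lin ?U n (\<lambda>i. ?C i \<oplus>\<^bsub>?K\<^esub> k \<otimes>\<^bsub>?K\<^esub> ?D i) y)"
        by (rule ssum_proj[OF sepd s y order_refl])
      also have "lin ?U n (\<lambda>i. ?C i \<oplus>\<^bsub>?K\<^esub> k \<otimes>\<^bsub>?K\<^esub> ?D i) y = lin ?U n ?C y \<oplus>\<^bsub>?U\<^esub> k \<odot>\<^bsub>?U\<^esub> lin ?U n ?D y"
        using lin_add[of ?C "\<lambda>i. k \<otimes>\<^bsub>?K\<^esub> ?D i" y n, OF c(1) kD y] lin_smult[of k ?D y n, OF k c(2) y] by (simp only:)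
      finally have "ssum (Op M) n (\<lambda>i. ?C i \<oplus>\<^bsub>?K\<^esub> k \<otimes>\<^bsub>?K\<^esub> ?D i) (\<lambda>i. sproj (Op M) (y i)) = szero (Op M) \<longleftrightarrow>
          lin ?U n ?C y \<oplus>\<^bsub>?U\<^esub> k \<odot>\<^bsub>?U\<^esub> lin ?U n ?D y = \<zero>\<^bsub>?U\<^esub>"
        using proj_eq_zero[OF M.add.m_closed[OF lc(1) smult_closed[OF k lc(2)]]] by (simp only:)
      moreover have "(\<lambda>i. ?E SkelS (Bas i)) = (\<lambda>i. sproj (Op M) (y i))"
        by (simp add: coord_env_def)
      ultimately show ?thesis unfolding R_def by simp
    qed
    have m1: "\<ominus>\<^bsub>?K\<^esub> \<one>\<^bsub>?K\<^esub> \<in> carrier ?K" by (rule field_closed(3))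
    have uniq: "k = \<ominus>\<^bsub>?K\<^esub> \<one>\<^bsub>?K\<^esub>" if "k \<in> carrier ?K" "\<one>\<^bsub>?K\<^esub> \<oplus>\<^bsub>?K\<^esub> k = \<zero>\<^bsub>?K\<^esub>" for k
      using that one_add_eq_zero by blast
    have "(\<exists>k\<in>carrier ?K. R M k ?E) \<longleftrightarrow> lin ?U n ?C y \<ominus>\<^bsub>?U\<^esub> lin ?U n ?D y = \<zero>\<^bsub>?U\<^esub>"
    proof
      assume "\<exists>k\<in>carrier ?K. R M k ?E"
      then obtain k where k: "k \<in> carrier ?K" "R M k ?E" by blast
      then have "k = \<ominus>\<^bsub>?K\<^esub> \<one>\<^bsub>?K\<^esub>" using uniq R by blast
      then show "lin ?U n ?C y \<ominus>\<^bsub>?U\<^esub> lin ?U n ?D y = \<zero>\<^bsub>?U\<^esub>"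
        using k(2) R[OF k(1)] unfolding M.minus_eq minus_one_smult[OF lc(2), symmetric] by blast
    next
      assume "lin ?U n ?C y \<ominus>\<^bsub>?U\<^esub> lin ?U n ?D y = \<zero>\<^bsub>?U\<^esub>"
      then have "R M (\<ominus>\<^bsub>?K\<^esub> \<one>\<^bsub>?K\<^esub>) ?E"
        unfolding R[OF m1] minus_one_smult[OF lc(2)] using one_add_eq_zero[OF m1] by (simp only: M.minus_eq)
      then show "\<exists>k\<in>carrier ?K. R M k ?E" using m1 by blast
    qed
    moreover have "lin ?U n ?C y \<ominus>\<^bsub>?U\<^esub> lin ?U n ?D y = \<zero>\<^bsub>?U\<^esub> \<longleftrightarrow> lin ?U n ?C y = lin ?U n ?D y"
      using diff_eq_zero[OF lc] .
    ultimately show ?thesis unfolding sat.simps tc by simp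
  qed
  with def show ?thesis by blast
qed

text \<open>The length \<open>n\<close> is left general in the induction, since a vector quantifier
  passes to tuples of length \<open>Suc n\<close>.\<close>

lemma sat_coordinates:
  assumes "wf_form L_S p"
  shows "\<exists>Q. definable Ls MM Q \<and> (\<forall>M e y c. coordinates M n e y c \<longrightarrow> sat M e p = Q M (cenv M e y c))"
  using assms
proof (induction p arbitrary: n)
  case (Equal t u)
  then have tu: "wf_trm L_S t" "wf_trm L_S u" "sort_of L_S t = sort_of L_S u" by simp_all
  show ?case
  proof (cases "sort_of L_S t = VecS")
    case True
    then show ?thesis using sat_equal_vec tu by simp
  next
    case False
    obtain F where F: "definable_fun Ls MM (sort_of L_S t) F"
      "\<forall>M e y c. coordinates M n e y c \<longrightarrow> trm_val M e t = F M (cenv M e y c)"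
      by (rule trm_skel_coordinates[OF tu(1) False]) (rule that)
    obtain G where G: "definable_fun Ls MM (sort_of L_S u) G"
      "\<forall>M e y c. coordinates M n e y c \<longrightarrow> trm_val M e u = G M (cenv M e y c)"
      by (rule trm_skel_coordinates[OF tu(2)]) (use False tu(3) that in simp_all)
    show ?thesis using definable_eq[OF finite_vsorts F(1)] G(1) F(2) G(2) tu(3)
      by (intro exI[of _ "\<lambda>M e. F M e = G M e"]) simp
  qed
next
  case (Atom r ts)
  then have r: "r = Less" by (cases r)
  then obtain t u where tu: "ts = [t, u]" "sort_of L_S t = GamS" "sort_of L_S u = GamS" "wf_trm L_S t" "wf_trm L_S u"
    using Atom by (auto simp: L_S_simps map_eq_Cons_conv)
  obtain F where F: "definable_fun Ls MM (sort_of L_S t) F"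
    "\<forall>M e y c. coordinates M n e y c \<longrightarrow> trm_val M e t = F M (cenv M e y c)"
    by (rule trm_skel_coordinates[OF tu(4)]) (use tu(2) that in simp_all)
  obtain G where G: "definable_fun Ls MM (sort_of L_S u) G"
    "\<forall>M e y c. coordinates M n e y c \<longrightarrow> trm_val M e u = G M (cenv M e y c)"
    by (rule trm_skel_coordinates[OF tu(5)]) (use tu(3) that in simp_all)
  show ?case using definable_rel[OF finite_vsorts F(1)[unfolded tu(2)] G(1)[unfolded tu(3)] less] F(2) G(2) tu(1) r
    by (intro exI[of _ "\<lambda>M e. rel_in M Less [F M e, G M e]"]) simp
next
  case (Neg p)
  have wf: "wf_form L_S p" using Neg.prems by simp
  obtain Q where Q: "definable Ls MM Q"
    "\<forall>M e y c. coordinates M n e y c \<longrightarrow> sat M e p = Q M (cenv M e y c)"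
    using Neg.IH[OF wf, of n] by (elim exE conjE)
  show ?case using definable_not[OF Q(1)] Q(2)
    by (intro exI[of _ "\<lambda>M e. \<not> Q M e"]) simp
next
  case (Conj p q)
  have wf: "wf_form L_S p" "wf_form L_S q" using Conj.prems by simp_all
  obtain Q where Q: "definable Ls MM Q"
    "\<forall>M e y c. coordinates M n e y c \<longrightarrow> sat M e p = Q M (cenv M e y c)"
    using Conj.IH(1)[OF wf(1), of n] by (elim exE conjE)
  obtain R where R: "definable Ls MM R"
    "\<forall>M e y c. coordinates M n e y c \<longrightarrow> sat M e q = R M (cenv M e y c)"
    using Conj.IH(2)[OF wf(2), of n] by (elim exE conjE)
  show ?case using definable_conj[OF Q(1) R(1)] Q(2) R(2)
    by (intro exI[of _ "\<lambda>M e. Q M e \<and> R M e"]) simp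
next
  case (Exists s m p)
  have wf: "wf_form L_S p" using Exists.prems by simp
  show ?case
  proof (cases "s = VecS")
    case True
    obtain Q where Q: "definable Ls MM Q"
      "\<forall>M e y c. coordinates M (Suc n) e y c \<longrightarrow> sat M e p = Q M (cenv M e y c)"
      using Exists.IH[OF wf, of "Suc n"] by (elim exE conjE)
    show ?thesis unfolding True by (rule sat_ex_vec[OF Q(1)]) (use Q(2) in blast)
  next
    case False
    obtain Q where Q: "definable Ls MM Q"
      "\<forall>M e y c. coordinates M n e y c \<longrightarrow> sat M e p = Q M (cenv M e y c)"
      using Exists.IH[OF wf, of n] by (elim exE conjE)
    show ?thesis by (rule sat_ex_skel[OF Q(1) False]) (use Q(2) in blast)
  qed
qed

end

section \<open>Model completeness over a variable base field\<close>

text \<open>Coordinates are chosen in \<open>V\<close> and remain coordinates in \<open>W\<close>: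
  linear combinations and classes are the same there, and separatedness, being definable in the
  skeleton, is preserved by elementarity.\<close>

lemma S_model_complete:
  assumes V: "S_model V" and W: "S_model W" and sub: "substructure L_S V W"
  shows "elementary_substructure L_S V W \<longleftrightarrow> elementary_substructure L_S_skel V W"
proof
  assume "elementary_substructure L_S V W"
  then show "elementary_substructure L_S_skel V W"
    by (rule elementary_sublanguage) (auto simp: L_S_def L_S_skel_def)
next
  assume el: "elementary_substructure L_S_skel V W"
  interpret S_elim "{V, W}" by (rule S_elim.intro) (use V W in auto)
  interpret V: skel_space "Op V" by (rule space) simp
  interpret W: skel_space "Op W" by (rule space) simp
  have fe: "fun_in W f xs = fun_in V f xs" if "xs \<in> args_in V (S_args f)" for f xs
    using sub that by (simp add: substructure_def L_S_simps)
  have uVW: "univ V s \<subseteq> univ W s" for s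
    using sub by (simp add: substructure_def L_S_simps)
  show "elementary_substructure L_S V W"
    unfolding elementary_substructure_def
  proof (intro conjI allI impI sub)
    fix p and e :: "vsort \<Rightarrow> nat \<Rightarrow> 'a"
    assume p: "wf_form L_S p" and "\<forall>s\<in>sorts L_S. \<forall>n. e s n \<in> univ V s"
    then have e: "\<And>s n. e s n \<in> univ V s" by (simp add: L_S_simps)
    \<comment> \<open>Only variables numbered below \<open>?N\<close> can occur in \<open>p\<close>,
      so finitely many vectors have to be put into coordinates.\<close>
    let ?N = "form_bound p"
    have "\<exists>y c. (\<forall>i. y i \<in> carrier V.U) \<and> (\<forall>j i. c j i \<in> carrier V.K) \<and>
        separated (Op V) ?N (\<lambda>i. sproj (Op V) (y i)) \<and> (\<forall>j<?N. e VecS j = lin V.U ?N (c j) y)"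
      using V.separated_basis_exists[of "e VecS" ?N] e by simp
    then obtain y c where yc: "\<forall>i. y i \<in> carrier V.U" "\<forall>j i. c j i \<in> carrier V.K"
      "separated (Op V) ?N (\<lambda>i. sproj (Op V) (y i))" "\<forall>j<?N. e VecS j = lin V.U ?N (c j) y"
      by (elim exE conjE) (rule that)
    have y: "y i \<in> univ V VecS" and c: "c j i \<in> univ V FieldS" for i j
      using yc(1,2) by simp_all
    have sep: "separated (Op V) ?N (\<lambda>i. sproj (Op V) (y i))"
      and rep: "\<And>j. j < ?N \<Longrightarrow> e VecS j = lin V.U ?N (c j) y"
      using yc(3,4) by blast+
    \<comment> \<open>Variables beyond the bound are moved into the span, as
      \<open>coordinates\<close> demands; \<open>p\<close> cannot see the change.\<close>
    define e1 where "e1 = e(VecS := (\<lambda>j. lin V.U ?N (c j) y))"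
    have linV: "lin V.U m (c j) y \<in> univ V VecS" for m j
      using V.lin_closed[of "c j" y m] y c by simp
    have e1: "e1 s n \<in> univ V s" for s n
      using e linV by (simp add: e1_def)
    have linE: "lin W.U m (c j) y = lin V.U m (c j) y" for m j
    proof (induction m)
      case 0
      show ?case using fe[of "[]" Zero] by (simp add: args_in_def)
    next
      case (Suc m)
      have "fun_in W Scal [c j m, y m] = fun_in V Scal [c j m, y m]"
        using fe[of "[c j m, y m]" Scal] c y by (simp add: args_in_def)
      moreover have "fun_in V Scal [c j m, y m] \<in> univ V VecS"
        using V.smult_closed[of "c j m" "y m"] c y by simp
      ultimately show ?case
        using fe[of "[lin V.U m (c j) y, fun_in V Scal [c j m, y m]]" Add] linV Suc
        by (simp add: args_in_def)
    qed
    have projE: "sproj (Op W) (y i) = sproj (Op V) (y i)" for i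
      using fe[of "[y i]" Proj] y by (simp add: args_in_def)
    have coV: "coordinates V ?N e1 y c"
      using e1 y c sep by (simp add: coordinates_def good_env_def) (simp add: e1_def)
    have goodV: "good_env Ls V (cenv V e1 y c)" by (rule coordinates_good[OF coV])
    \<comment> \<open>The first use of elementarity: in \<open>W\<close> the coefficients in
      \<open>separated\<close> range over a possibly larger field.\<close>
    have "definable Ls {V, W} (\<lambda>M (e :: vsort \<Rightarrow> coord \<Rightarrow> 'a). separated (Op M) ?N (\<lambda>i. e SkelS (Bas i)))"
      by (intro definable_separated definable_fun_var) (simp add: Ls_simps)
    from elementary_definable[OF el this _ _ goodV] sep
    have "separated (Op W) ?N (\<lambda>i. sproj (Op V) (y i))"
      by (simp add: coord_env_def Let_def)
    then have sepW: "separated (Op W) ?N (\<lambda>i. sproj (Op W) (y i))"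
      unfolding projE .
    have inW: "x \<in> univ W s" if "x \<in> univ V s" for x s using that uVW by blast
    have "good_env L_S W e1" unfolding good_env_def using inW[OF e1] by blast
    moreover have "e1 VecS j = lin W.U ?N (c j) y" for j
      unfolding linE by (simp add: e1_def)
    ultimately have coW: "coordinates W ?N e1 y c"
      unfolding coordinates_def using inW[OF y] inW[OF c] sepW by blast
    have z: "szero (Op W) = szero (Op V)" "fun_in W FZero [] = fun_in V FZero []"
      using fe[of "[]" SZero] fe[of "[]" FZero] by (simp_all add: args_in_def)
    have "szero (Op V) \<in> univ V SkelS"
      using in_univ[of V "[]" SZero] by (simp add: args_in_def)
    then have zv: "sval (Op W) (szero (Op V)) = sval (Op V) (szero (Op V))"
      using fe[of "[szero (Op V)]" SVal] by (simp add: args_in_def)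
    \<comment> \<open>The values of vector variables do not enter \<open>cenv\<close>, and all other
      entries, dummy values included, agree in the two models.\<close>
    have env: "cenv W e1 y c = cenv V e1 y c"
      unfolding coord_env_def projE z zv ..
    obtain Q where Q: "definable Ls {V, W} Q"
      "\<forall>M e y c. coordinates M ?N e y c \<longrightarrow> sat M e p = Q M (cenv M e y c)"
      using sat_coordinates[OF p] by blast
    have N1: "sat M e p = sat M e1 p" for M
      by (rule sat_bound) (use rep in \<open>simp add: e1_def\<close>)
    have "sat V e1 p = Q V (cenv V e1 y c)" using Q(2) coV by blast
    also have "\<dots> = Q W (cenv V e1 y c)"
      by (rule elementary_definable[OF el Q(1) _ _ goodV]) simp_all
    also have "\<dots> = sat W e1 p" using Q(2) coW env by metis
    finally show "sat V e p = sat W e p" unfolding N1 .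
  qed
qed

theorem proposition3p5:
  fixes K :: "'k ring"
    and V\<^sub>1 W\<^sub>1 :: "(vsort, 'k SK_sym, vrel, 'u) struct"
    and V\<^sub>2 W\<^sub>2 :: "(vsort, S_sym, vrel, 'w) struct"
  shows "(field K \<longrightarrow> SK_model K V\<^sub>1 \<longrightarrow> SK_model K W\<^sub>1 \<longrightarrow> substructure (L_SK K) V\<^sub>1 W\<^sub>1 \<longrightarrow>
            (elementary_substructure (L_SK K) V\<^sub>1 W\<^sub>1 \<longleftrightarrow>
             elementary_substructure (L_SK_skel K) V\<^sub>1 W\<^sub>1)) \<and>
         (S_model V\<^sub>2 \<longrightarrow> S_model W\<^sub>2 \<longrightarrow> substructure L_S V\<^sub>2 W\<^sub>2 \<longrightarrow>
            (elementary_substructure L_S V\<^sub>2 W\<^sub>2 \<longleftrightarrow>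
             elementary_substructure L_S_skel V\<^sub>2 W\<^sub>2))"
proof (rule conjI; intro impI)
  show "elementary_substructure (L_SK K) V\<^sub>1 W\<^sub>1 \<longleftrightarrow> elementary_substructure (L_SK_skel K) V\<^sub>1 W\<^sub>1"
    if "field K" "SK_model K V\<^sub>1" "SK_model K W\<^sub>1" "substructure (L_SK K) V\<^sub>1 W\<^sub>1"
    using that by (rule SK_model_complete)
  show "elementary_substructure L_S V\<^sub>2 W\<^sub>2 \<longleftrightarrow> elementary_substructure L_S_skel V\<^sub>2 W\<^sub>2"
    if "S_model V\<^sub>2" "S_model W\<^sub>2" "substructure L_S V\<^sub>2 W\<^sub>2"
    using that by (rule S_model_complete)
qed

end
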